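(* Let $A=kQ/I$ be a finite-dimensional monomial algebra over a field $k$. If $A$ is $2$-Gorenstein, then $A$ is a string algebra. In particular, every Auslander-Gorenstein monomial algebra is a string algebra.
   Context: $k$ is a field, $Q$ is a finite quiver, $I\subset kQ$ is an admissible ideal, $A=kQ/I$. $A$ is monomial if $I$ is generated by a set of paths. Arrows are composed left to right: for arrows $x\xrightarrow{\alpha}y\xrightarrow{\beta}z$ the composition is $\alpha\beta$; $s,t$ denote start and end vertex of an arrow. Modules are finite-dimensional right $A$-modules. Let $0\to A_A\to I^0\to I^1\to\cdots$ be a minimal injective resolution of the regular module. For $n\ge 1$, $A$ is $n$-Gorenstein if $\operatorname{pdim} I^i\le i$ for all $0\le i<n$. $A$ is Auslander-Gorenstein if it is $n$-Gorenstein for all $n\ge1$ and $\operatorname{idim}A_A<\infty$. A string algebra is a monomial algebra $A=kQ/I$ such that $Q$ is biserial (every vertex has at most 2 incoming and at most 2 outgoing arrows) and (1) for any arrows $a_1\neq a_2$ and $b$ with $t(a_1)=t(a_2)=s(b)$ we have $|\{a_1b,a_2b\}\cap I|\ge 1$; (2) for any arrows $a$ and $b_1\ne b_2$ with $t(a)=s(b_1)=s(b_2)$ we have $|\{ab_1,ab_2\}\cap I|\ge1$. *)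

theory Defs
  imports
    "HOL-Algebra.QuotRing"
    "HOL-Algebra.Ideal_Product"
    "HOL-Algebra.Module"
    "HOL-Library.Extended_Nat"
    "Graph_Theory.Arc_Walk"
begin

section \<open>Quivers, path algebras and bound quiver algebras\<close>

text \<open>
  A finite quiver is a \<^locale>\<open>fin_digraph\<close> (loops and parallel arrows are allowed);
  \<^const>\<open>tail\<close> and \<^const>\<open>head\<close> are the start and the end vertex of an arrow.
  A path is a pair of its start vertex and its list of arrows, so that \<open>(v, [])\<close> is the
  trivial path at \<open>v\<close>.  Arrows are listed from left to right, in the order of composition.
\<close>

definition paths :: "('v, 'e) pre_digraph \<Rightarrow> ('v \<times> 'e list) set" where
  "paths Q = {(u, p). \<exists>v. pre_digraph.awalk Q u p v}"

text \<open>
  An element of \<open>kQ\<close> is its finitely supported family of coefficients.  A path of length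
  \<open>n\<close> factors in exactly \<open>n + 1\<close> ways as a product of two paths, which gives the
  convolution formula for the multiplication.

  Algebras over a field \<open>k\<close> are records of type \<open>('k, 'a) module\<close>: the ring operations together
  with the action of the scalars.
\<close>

definition path_algebra ::
    "('v, 'e) pre_digraph \<Rightarrow> ('k::field, 'v \<times> 'e list \<Rightarrow> 'k) module" where
  "path_algebra Q =
    \<lparr>carrier = {f. finite {q. f q \<noteq> 0} \<and> {q. f q \<noteq> 0} \<subseteq> paths Q},
     mult = (\<lambda>f g (u, p). \<Sum>i\<le>length p.
               f (u, take i p) * g (pre_digraph.awlast Q u (take i p), drop i p)),
     one = (\<lambda>(u, p). if u \<in> verts Q \<and> p = [] then 1 else 0),
     zero = (\<lambda>_. 0),
     add = (\<lambda>f g q. f q + g q),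
     smult = (\<lambda>c f q. c * f q)\<rparr>"

definition path_elt :: "'v \<times> 'e list \<Rightarrow> ('v \<times> 'e list \<Rightarrow> 'k::field)" where
  "path_elt p = (\<lambda>q. if q = p then 1 else 0)"

definition arrow_elt ::
    "('v, 'e) pre_digraph \<Rightarrow> 'e \<Rightarrow> ('v \<times> 'e list \<Rightarrow> 'k::field)" where
  "arrow_elt Q a = path_elt (tail Q a, [a])"

definition arrow_ideal ::
    "('v, 'e) pre_digraph \<Rightarrow> ('v \<times> 'e list \<Rightarrow> 'k::field) set" where
  "arrow_ideal Q = Idl\<^bsub>path_algebra Q\<^esub> (arrow_elt Q ` arcs Q)"

definition admissible_ideal ::
    "('v, 'e) pre_digraph \<Rightarrow> ('v \<times> 'e list \<Rightarrow> 'k::field) set \<Rightarrow> bool" where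
  "admissible_ideal Q I \<longleftrightarrow>
     ideal I (path_algebra Q) \<and>
     I \<subseteq> arrow_ideal Q [^]\<^bsub>ideals_set (path_algebra Q)\<^esub> (2::nat) \<and>
     (\<exists>m\<ge>2. arrow_ideal Q [^]\<^bsub>ideals_set (path_algebra Q)\<^esub> (m::nat) \<subseteq> I)"

definition bound_quiver_algebra ::
    "('v, 'e) pre_digraph \<Rightarrow> ('v \<times> 'e list \<Rightarrow> 'k::field) set
      \<Rightarrow> ('k, ('v \<times> 'e list \<Rightarrow> 'k) set) module" where
  "bound_quiver_algebra Q I =
    \<lparr>carrier = carrier (path_algebra Q Quot I),
     mult = mult (path_algebra Q Quot I),
     one = one (path_algebra Q Quot I),
     zero = zero (path_algebra Q Quot I),
     add = add (path_algebra Q Quot I),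
     smult = (\<lambda>c X. \<Union>x\<in>X. I +>\<^bsub>path_algebra Q\<^esub> (c \<odot>\<^bsub>path_algebra Q\<^esub> x))\<rparr>"

definition monomial_algebra ::
    "('v, 'e) pre_digraph \<Rightarrow> ('v \<times> 'e list \<Rightarrow> 'k::field) set \<Rightarrow> bool" where
  "monomial_algebra Q I \<longleftrightarrow>
     fin_digraph Q \<and> admissible_ideal Q I \<and>
     (\<exists>S \<subseteq> paths Q. I = Idl\<^bsub>path_algebra Q\<^esub> (path_elt ` S))"

definition biserial_quiver :: "('v, 'e) pre_digraph \<Rightarrow> bool" where
  "biserial_quiver Q \<longleftrightarrow> (\<forall>v\<in>verts Q. in_degree Q v \<le> 2 \<and> out_degree Q v \<le> 2)"

definition string_algebra ::
    "('v, 'e) pre_digraph \<Rightarrow> ('v \<times> 'e list \<Rightarrow> 'k::field) set \<Rightarrow> bool" where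
  "string_algebra Q I \<longleftrightarrow>
     monomial_algebra Q I \<and> biserial_quiver Q \<and>
     (\<forall>a1\<in>arcs Q. \<forall>a2\<in>arcs Q. \<forall>b\<in>arcs Q.
        a1 \<noteq> a2 \<and> head Q a1 = head Q a2 \<and> head Q a2 = tail Q b \<longrightarrow>
        card ({arrow_elt Q a1 \<otimes>\<^bsub>path_algebra Q\<^esub> arrow_elt Q b,
               arrow_elt Q a2 \<otimes>\<^bsub>path_algebra Q\<^esub> arrow_elt Q b} \<inter> I) \<ge> 1) \<and>
     (\<forall>a\<in>arcs Q. \<forall>b1\<in>arcs Q. \<forall>b2\<in>arcs Q.
        b1 \<noteq> b2 \<and> head Q a = tail Q b1 \<and> tail Q b1 = tail Q b2 \<longrightarrow>
        card ({arrow_elt Q a \<otimes>\<^bsub>path_algebra Q\<^esub> arrow_elt Q b1,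
               arrow_elt Q a \<otimes>\<^bsub>path_algebra Q\<^esub> arrow_elt Q b2} \<inter> I) \<ge> 1)"


section \<open>Finite-dimensional right modules\<close>

text \<open>
  The library locale for modules needs a commutative ring.  Right modules reuse its record
  type, with \<open>a \<odot>\<^bsub>M\<^esub> x\<close> standing for the right action \<open>x \<cdot> a\<close>; note the order of the
  factors in \<open>smult_assoc\<close>.
\<close>

locale right_module = R?: ring R + M?: abelian_group M
  for R :: "('a, 'r) ring_scheme" (structure) and M :: "('a, 'm) module" (structure) +
  assumes smult_closed:
      "\<lbrakk>a \<in> carrier R; x \<in> carrier M\<rbrakk> \<Longrightarrow> a \<odot>\<^bsub>M\<^esub> x \<in> carrier M"
    and smult_l_distr:
      "\<lbrakk>a \<in> carrier R; b \<in> carrier R; x \<in> carrier M\<rbrakk> \<Longrightarrow>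
       (a \<oplus>\<^bsub>R\<^esub> b) \<odot>\<^bsub>M\<^esub> x = a \<odot>\<^bsub>M\<^esub> x \<oplus>\<^bsub>M\<^esub> b \<odot>\<^bsub>M\<^esub> x"
    and smult_r_distr:
      "\<lbrakk>a \<in> carrier R; x \<in> carrier M; y \<in> carrier M\<rbrakk> \<Longrightarrow>
       a \<odot>\<^bsub>M\<^esub> (x \<oplus>\<^bsub>M\<^esub> y) = a \<odot>\<^bsub>M\<^esub> x \<oplus>\<^bsub>M\<^esub> a \<odot>\<^bsub>M\<^esub> y"
    and smult_assoc:
      "\<lbrakk>a \<in> carrier R; b \<in> carrier R; x \<in> carrier M\<rbrakk> \<Longrightarrow>
       (a \<otimes>\<^bsub>R\<^esub> b) \<odot>\<^bsub>M\<^esub> x = b \<odot>\<^bsub>M\<^esub> (a \<odot>\<^bsub>M\<^esub> x)"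
    and smult_one:
      "x \<in> carrier M \<Longrightarrow> \<one>\<^bsub>R\<^esub> \<odot>\<^bsub>M\<^esub> x = x"

definition regular_module :: "('k, 'a) module \<Rightarrow> ('a, 'a) module" where
  "regular_module A =
    \<lparr>carrier = carrier A, mult = mult A, one = one A, zero = zero A, add = add A,
     smult = (\<lambda>a x. x \<otimes>\<^bsub>A\<^esub> a)\<rparr>"

text \<open>A scalar \<open>c\<close> acts on an \<open>A\<close>-module as the element \<open>c \<cdot> 1\<close> of \<open>A\<close>.\<close>

definition finite_dimensional :: "('k::field, 'a) module \<Rightarrow> ('a, 'm) module \<Rightarrow> bool" where
  "finite_dimensional A M \<longleftrightarrow>
     (\<exists>B. finite B \<and> B \<subseteq> carrier M \<and>
        (\<forall>x\<in>carrier M. \<exists>c :: 'm \<Rightarrow> 'k.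
           x = (\<Oplus>\<^bsub>M\<^esub>b\<in>B. (c b \<odot>\<^bsub>A\<^esub> \<one>\<^bsub>A\<^esub>) \<odot>\<^bsub>M\<^esub> b)))"

definition fd_right_module :: "('k::field, 'a) module \<Rightarrow> ('a, 'm) module \<Rightarrow> bool" where
  "fd_right_module A M \<longleftrightarrow> right_module A M \<and> finite_dimensional A M"

text \<open>
  Quantification over finite-dimensional modules needs a fixed type of elements.  Every
  such module is isomorphic to one whose carrier is a subset of \<open>nat \<Rightarrow> 'k\<close> (namely
  \<open>k\<^sup>d\<close>, as the sequences that vanish from position \<open>d\<close> on).
\<close>

type_synonym ('k, 'a) std_module = "('a, nat \<Rightarrow> 'k) module"

definition right_module_hom ::
    "('k, 'a) module \<Rightarrow> ('a, 'm) module \<Rightarrow> ('a, 'n) module \<Rightarrow> ('m \<Rightarrow> 'n) set" where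
  "right_module_hom A M N =
     {f \<in> hom (add_monoid M) (add_monoid N).
        \<forall>a\<in>carrier A. \<forall>x\<in>carrier M. f (a \<odot>\<^bsub>M\<^esub> x) = a \<odot>\<^bsub>N\<^esub> f x}"

definition zero_module :: "('a, 'm) module \<Rightarrow> bool" where
  "zero_module M \<longleftrightarrow> carrier M = {\<zero>\<^bsub>M\<^esub>}"

definition essential_submodule :: "('k, 'a) module \<Rightarrow> 'm set \<Rightarrow> ('a, 'm) module \<Rightarrow> bool" where
  "essential_submodule A H M \<longleftrightarrow>
     submodule H A M \<and>
     (\<forall>U. submodule U A M \<and> U \<noteq> {\<zero>\<^bsub>M\<^esub>} \<longrightarrow> U \<inter> H \<noteq> {\<zero>\<^bsub>M\<^esub>})"

definition projective_module :: "('k::field, 'a) module \<Rightarrow> ('a, 'm) module \<Rightarrow> bool" where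
  "projective_module A P \<longleftrightarrow>
     fd_right_module A P \<and>
     (\<forall>(M :: ('k, 'a) std_module) (N :: ('k, 'a) std_module) g f.
        fd_right_module A M \<and> fd_right_module A N \<and>
        g \<in> right_module_hom A M N \<and> g ` carrier M = carrier N \<and>
        f \<in> right_module_hom A P N \<longrightarrow>
        (\<exists>h\<in>right_module_hom A P M. \<forall>x\<in>carrier P. g (h x) = f x))"

definition injective_module :: "('k::field, 'a) module \<Rightarrow> ('a, 'm) module \<Rightarrow> bool" where
  "injective_module A E \<longleftrightarrow>
     fd_right_module A E \<and>
     (\<forall>(M :: ('k, 'a) std_module) (N :: ('k, 'a) std_module) g f.
        fd_right_module A M \<and> fd_right_module A N \<and>
        g \<in> right_module_hom A M N \<and> inj_on g (carrier M) \<and>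
        f \<in> right_module_hom A M E \<longrightarrow>
        (\<exists>h\<in>right_module_hom A N E. \<forall>x\<in>carrier M. h (g x) = f x))"


section \<open>Resolutions and homological dimensions\<close>

text \<open>\<open>\<cdots> \<rightarrow> P 2 \<rightarrow> P 1 \<rightarrow> P 0 \<rightarrow> M \<rightarrow> 0\<close> with \<open>d i : P (i + 1) \<rightarrow> P i\<close> and \<open>\<epsilon> : P 0 \<rightarrow> M\<close>\<close>

definition projective_resolution ::
    "('k::field, 'a) module \<Rightarrow> ('a, 'm) module \<Rightarrow> (nat \<Rightarrow> ('k, 'a) std_module)
      \<Rightarrow> (nat \<Rightarrow> (nat \<Rightarrow> 'k) \<Rightarrow> (nat \<Rightarrow> 'k)) \<Rightarrow> ((nat \<Rightarrow> 'k) \<Rightarrow> 'm) \<Rightarrow> bool" where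
  "projective_resolution A M P d \<epsilon> \<longleftrightarrow>
     (\<forall>i. projective_module A (P i)) \<and>
     (\<forall>i. d i \<in> right_module_hom A (P (Suc i)) (P i)) \<and>
     \<epsilon> \<in> right_module_hom A (P 0) M \<and>
     \<epsilon> ` carrier (P 0) = carrier M \<and>
     d 0 ` carrier (P (Suc 0)) = a_kernel (P 0) M \<epsilon> \<and>
     (\<forall>i. d (Suc i) ` carrier (P (Suc (Suc i))) = a_kernel (P (Suc i)) (P i) (d i))"

text \<open>\<open>0 \<rightarrow> M \<rightarrow> E 0 \<rightarrow> E 1 \<rightarrow> E 2 \<rightarrow> \<cdots>\<close> with \<open>\<eta> : M \<rightarrow> E 0\<close> and \<open>d i : E i \<rightarrow> E (i + 1)\<close>\<close>

definition injective_resolution ::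
    "('k::field, 'a) module \<Rightarrow> ('a, 'm) module \<Rightarrow> (nat \<Rightarrow> ('k, 'a) std_module)
      \<Rightarrow> (nat \<Rightarrow> (nat \<Rightarrow> 'k) \<Rightarrow> (nat \<Rightarrow> 'k)) \<Rightarrow> ('m \<Rightarrow> (nat \<Rightarrow> 'k)) \<Rightarrow> bool" where
  "injective_resolution A M E d \<eta> \<longleftrightarrow>
     (\<forall>i. injective_module A (E i)) \<and>
     (\<forall>i. d i \<in> right_module_hom A (E i) (E (Suc i))) \<and>
     \<eta> \<in> right_module_hom A M (E 0) \<and>
     inj_on \<eta> (carrier M) \<and>
     \<eta> ` carrier M = a_kernel (E 0) (E (Suc 0)) (d 0) \<and>
     (\<forall>i. d i ` carrier (E i) = a_kernel (E (Suc i)) (E (Suc (Suc i))) (d (Suc i)))"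

text \<open>
  Minimality: every \<open>E i\<close> is an injective envelope of the image of the map into it.
\<close>

definition minimal_injective_resolution ::
    "('k::field, 'a) module \<Rightarrow> ('a, 'm) module \<Rightarrow> (nat \<Rightarrow> ('k, 'a) std_module)
      \<Rightarrow> (nat \<Rightarrow> (nat \<Rightarrow> 'k) \<Rightarrow> (nat \<Rightarrow> 'k)) \<Rightarrow> ('m \<Rightarrow> (nat \<Rightarrow> 'k)) \<Rightarrow> bool" where
  "minimal_injective_resolution A M E d \<eta> \<longleftrightarrow>
     injective_resolution A M E d \<eta> \<and>
     essential_submodule A (\<eta> ` carrier M) (E 0) \<and>
     (\<forall>i. essential_submodule A (d i ` carrier (E i)) (E (Suc i)))"

text \<open>
  The infimum of the lengths of resolutions, which is \<open>\<infinity>\<close> if there is no finite one.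
  The zero module gets dimension \<open>0\<close>.
\<close>

definition pdim :: "('k::field, 'a) module \<Rightarrow> ('a, 'm) module \<Rightarrow> enat" where
  "pdim A M = Inf {enat n | n. \<exists>P d \<epsilon>. projective_resolution A M P d \<epsilon> \<and>
                                        (\<forall>i>n. zero_module (P i))}"

definition idim :: "('k::field, 'a) module \<Rightarrow> ('a, 'm) module \<Rightarrow> enat" where
  "idim A M = Inf {enat n | n. \<exists>E d \<eta>. injective_resolution A M E d \<eta> \<and>
                                        (\<forall>i>n. zero_module (E i))}"

text \<open>
  Minimal injective resolutions exist and are unique up to isomorphism, so it does not
  matter which one is taken.
\<close>

definition n_Gorenstein :: "nat \<Rightarrow> ('k::field, 'a) module \<Rightarrow> bool" where
  "n_Gorenstein n A \<longleftrightarrow>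
     n \<ge> 1 \<and>
     (\<exists>E d \<eta>. minimal_injective_resolution A (regular_module A) E d \<eta> \<and>
        (\<forall>i<n. pdim A (E i) \<le> enat i))"

definition Auslander_Gorenstein :: "('k::field, 'a) module \<Rightarrow> bool" where
  "Auslander_Gorenstein A \<longleftrightarrow>
     (\<forall>n\<ge>1. n_Gorenstein n A) \<and> idim A (regular_module A) < \<infinity>"


section \<open>The records defined above are rings and modules\<close>

lemma awlast_take_take:
  "j \<le> i \<Longrightarrow> i \<le> length p \<Longrightarrow>
   pre_digraph.awlast Q (pre_digraph.awlast Q u (take j p)) (take (i - j) (drop j p)) =
   pre_digraph.awlast Q u (take i p)"
proof -
  assume ji: "j \<le> i" "i \<le> length p"
  have lst: "pre_digraph.awlast Q u q = (if q = [] then u else head Q (last q))" for u q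
    by (simp add: pre_digraph.awalk_verts_conv)
  have "take i p = take j p @ take (i - j) (drop j p)"
    using ji by (metis le_add_diff_inverse take_add)
  then show ?thesis by (simp add: lst)
qed

lemma paths_append:
  assumes "wf_digraph Q" "(u, take i p) \<in> paths Q"
    "(pre_digraph.awlast Q u (take i p), drop i p) \<in> paths Q"
  shows "(u, p) \<in> paths Q"
proof -
  interpret wf_digraph Q by fact
  from assms obtain v w where *: "awalk u (take i p) v" "awalk (awlast u (take i p)) (drop i p) w"
    unfolding paths_def by auto
  then have "v = awlast u (take i p)" by auto
  with * have "awalk u (take i p @ drop i p) w" using awalk_appendI by blast
  then show ?thesis unfolding paths_def by auto
qed

lemma path_algebra_mult_closed:
  assumes Q: "wf_digraph Q" and f: "f \<in> carrier (path_algebra Q)" and g: "g \<in> carrier (path_algebra Q)"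
  shows "f \<otimes>\<^bsub>path_algebra Q\<^esub> g \<in> carrier (path_algebra Q)"
proof -
  let ?h = "f \<otimes>\<^bsub>path_algebra Q\<^esub> g"
  have *: "(u, p) \<in> (\<lambda>((u, p), (w, q)). (u, p @ q)) ` ({q. f q \<noteq> 0} \<times> {q. g q \<noteq> 0}) \<and> (u, p) \<in> paths Q"
    if "?h (u, p) \<noteq> 0" for u p
  proof -
    from that obtain i where "f (u, take i p) * g (pre_digraph.awlast Q u (take i p), drop i p) \<noteq> 0"
      by (auto simp: path_algebra_def elim: sum.not_neutral_contains_not_neutral)
    then have nz: "f (u, take i p) \<noteq> 0" "g (pre_digraph.awlast Q u (take i p), drop i p) \<noteq> 0" by auto
    moreover have "(u, p) \<in> paths Q"
      using f g nz by (intro paths_append[OF Q, of u i p]) (auto simp: path_algebra_def)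
    ultimately show ?thesis
      by (force intro!: image_eqI[of _ _ "((u, take i p), (pre_digraph.awlast Q u (take i p), drop i p))"])
  qed
  have "finite ({q. f q \<noteq> 0} \<times> {q. g q \<noteq> 0})"
    using f g by (auto simp: path_algebra_def)
  then have "finite {q. ?h q \<noteq> 0}"
    by (rule finite_surj[of _ _ "\<lambda>((u, p), (w, q)). (u, p @ q)"]) (use * in auto)
  moreover have "{q. ?h q \<noteq> 0} \<subseteq> paths Q" using * by auto
  ultimately show ?thesis by (simp add: path_algebra_def)
qed

lemma ring_path_algebra:
  fixes Q :: "('v, 'e) pre_digraph"
  assumes Q: "fin_digraph Q"
  shows "ring (path_algebra Q :: ('k::field, 'v \<times> 'e list \<Rightarrow> 'k) module)"
proof -
  interpret fin_digraph Q by fact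
  let ?R = "path_algebra Q :: ('k, 'v \<times> 'e list \<Rightarrow> 'k) module"
  have car: "f \<in> carrier ?R \<longleftrightarrow> finite {q. f q \<noteq> 0} \<and> {q. f q \<noteq> 0} \<subseteq> paths Q" for f :: "'v \<times> 'e list \<Rightarrow> 'k"
    by (simp add: path_algebra_def)
  have add_closed: "(\<lambda>q. f q + g q) \<in> carrier ?R" if "f \<in> carrier ?R" "g \<in> carrier ?R"
    for f g :: "'v \<times> 'e list \<Rightarrow> 'k"
  proof -
    have "{q. f q + g q \<noteq> 0} \<subseteq> {q. f q \<noteq> 0} \<union> {q. g q \<noteq> 0}" by auto
    with that show ?thesis unfolding car by (meson finite_Un finite_subset le_sup_iff order_trans)
  qed
  show ?thesis
  proof (rule ringI)
    show "abelian_group ?R"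
    proof (rule abelian_groupI)
      fix f :: "'v \<times> 'e list \<Rightarrow> 'k" assume "f \<in> carrier ?R"
      then have "(\<lambda>q. - f q) \<in> carrier ?R" by (simp add: car)
      then show "\<exists>y\<in>carrier ?R. y \<oplus>\<^bsub>?R\<^esub> f = \<zero>\<^bsub>?R\<^esub>"
        by (rule bexI[rotated]) (simp add: path_algebra_def)
    qed (use add_closed in \<open>auto simp: path_algebra_def add_ac\<close>)
    show "Group.monoid ?R"
    proof (rule Group.monoidI)
      fix f g :: "'v \<times> 'e list \<Rightarrow> 'k" assume "f \<in> carrier ?R" "g \<in> carrier ?R"
      then show "f \<otimes>\<^bsub>?R\<^esub> g \<in> carrier ?R"
        by (rule path_algebra_mult_closed[OF wf_digraph])
    next
      have "{q. one ?R q \<noteq> (0::'k)} \<subseteq> (\<lambda>v. (v, [])) ` verts Q"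
        by (auto simp: path_algebra_def split: if_splits)
      moreover have "(\<lambda>v. (v, [])) ` verts Q \<subseteq> paths Q"
        by (auto simp: paths_def awalk_def)
      ultimately show "\<one>\<^bsub>?R\<^esub> \<in> carrier ?R"
        by (auto simp: car intro: finite_subset)
    next
      fix f g h :: "'v \<times> 'e list \<Rightarrow> 'k"
      show "f \<otimes>\<^bsub>?R\<^esub> g \<otimes>\<^bsub>?R\<^esub> h = f \<otimes>\<^bsub>?R\<^esub> (g \<otimes>\<^bsub>?R\<^esub> h)"
      proof
        fix q :: "'v \<times> 'e list"
        obtain u p where q: "q = (u, p)" by fastforce
        let ?t = "\<lambda>j i. f (u, take j p) * g (awlast u (take j p), take (i - j) (drop j p)) *
                   h (awlast u (take i p), drop i p)"
        have end_eq: "awlast (awlast u (take j p)) (take i (drop j p)) = awlast u (take (i + j) p)"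
          if "j \<le> length p" "i \<le> length p - j" for i j
          using awlast_take_take[of j "i + j" p Q u] that by simp
        have "(f \<otimes>\<^bsub>?R\<^esub> g \<otimes>\<^bsub>?R\<^esub> h) q = (\<Sum>i\<le>length p. \<Sum>j\<le>i. ?t j i)"
          by (auto simp: path_algebra_def q sum_distrib_right min_def drop_take
                intro!: sum.cong)
        also have "\<dots> = (\<Sum>j\<le>length p. \<Sum>i=j..length p. ?t j i)"
          unfolding sum.Sigma[OF finite_atMost ballI[OF finite_atMost]]
            sum.Sigma[OF finite_atMost ballI[OF finite_atLeastAtMost]]
          by (rule sum.reindex_bij_witness[of _ "\<lambda>(a, b). (b, a)" "\<lambda>(a, b). (b, a)"]) auto
        also have "\<dots> = (\<Sum>j\<le>length p. \<Sum>i\<le>length p - j. ?t j (i + j))"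
        proof (rule sum.cong[OF refl])
          fix j assume "j \<in> {..length p}"
          then show "(\<Sum>i=j..length p. ?t j i) = (\<Sum>i\<le>length p - j. ?t j (i + j))"
            by (intro sum.reindex_bij_witness[of _ "\<lambda>i. i + j" "\<lambda>i. i - j"]) auto
        qed
        also have "\<dots> = (f \<otimes>\<^bsub>?R\<^esub> (g \<otimes>\<^bsub>?R\<^esub> h)) q"
          by (auto simp: path_algebra_def q sum_distrib_left mult.assoc
                end_eq add.commute intro!: sum.cong)
        finally show "(f \<otimes>\<^bsub>?R\<^esub> g \<otimes>\<^bsub>?R\<^esub> h) q = (f \<otimes>\<^bsub>?R\<^esub> (g \<otimes>\<^bsub>?R\<^esub> h)) q" .
      qed
    next
      fix f :: "'v \<times> 'e list \<Rightarrow> 'k" assume f: "f \<in> carrier ?R"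
      show "\<one>\<^bsub>?R\<^esub> \<otimes>\<^bsub>?R\<^esub> f = f"
      proof
        fix q :: "'v \<times> 'e list"
        obtain u p where q: "q = (u, p)" by fastforce
        have "(\<one>\<^bsub>?R\<^esub> \<otimes>\<^bsub>?R\<^esub> f) q = (\<Sum>i\<le>length p.
            (if u \<in> verts Q \<and> take i p = [] then 1 else 0) * f (awlast u (take i p), drop i p))"
          unfolding path_algebra_def q by (simp del: take_eq_Nil)
        also have "\<dots> = (\<Sum>i\<le>length p. if i = 0 then (if u \<in> verts Q then f q else 0) else 0)"
          by (intro sum.cong refl) (auto simp: q)
        also have "\<dots> = f q" using f by (auto simp: car q paths_def awalk_def)
        finally show "(\<one>\<^bsub>?R\<^esub> \<otimes>\<^bsub>?R\<^esub> f) q = f q" .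
      qed
      show "f \<otimes>\<^bsub>?R\<^esub> \<one>\<^bsub>?R\<^esub> = f"
      proof
        fix q :: "'v \<times> 'e list"
        obtain u p where q: "q = (u, p)" by fastforce
        have *: "awlast u p \<in> verts Q" if "f q \<noteq> 0"
        proof -
          from that f obtain v where "awalk u p v" by (auto simp: car q paths_def)
          then show ?thesis by auto
        qed
        have "(f \<otimes>\<^bsub>?R\<^esub> \<one>\<^bsub>?R\<^esub>) q = (\<Sum>i\<le>length p.
            f (u, take i p) * (if awlast u (take i p) \<in> verts Q \<and> drop i p = [] then 1 else 0))"
          unfolding path_algebra_def q by (simp del: drop_eq_Nil)
        also have "\<dots> = (\<Sum>i\<le>length p. if i = length p then (if awlast u p \<in> verts Q then f q else 0) else 0)"
          by (intro sum.cong refl) (auto simp: q)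
        also have "\<dots> = f q" using * by auto
        finally show "(f \<otimes>\<^bsub>?R\<^esub> \<one>\<^bsub>?R\<^esub>) q = f q" .
      qed
    qed
  qed (auto simp: path_algebra_def fun_eq_iff sum.distrib algebra_simps)
qed

lemma ring_bound_quiver_algebra:
  assumes "ideal I (path_algebra Q)"
  shows "ring (bound_quiver_algebra Q I)"
proof -
  have "ring (path_algebra Q Quot I)" using assms by (rule ideal.quotient_is_ring)
  then interpret R: ring "path_algebra Q Quot I" .
  show ?thesis
    by (intro ringI abelian_groupI Group.monoidI)
       (auto simp: bound_quiver_algebra_def R.a_ac R.m_assoc R.l_distr R.r_distr intro: R.add.l_inv_ex)
qed

lemma right_module_regular:
  assumes "ring A"
  shows "right_module A (regular_module A)"
proof -
  interpret ring A by fact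
  have "abelian_group (regular_module A)"
    by (rule abelian_groupI) (auto simp: regular_module_def a_ac)
  moreover note ring_axioms
  ultimately show ?thesis
    by (auto simp: right_module_def right_module_axioms_def regular_module_def r_distr l_distr m_assoc)
qed

end

theory Submission
  imports Defs "HOL-Library.Sublist"
begin

text \<open>
  Write \<open>I\<^sup>0 \<rightarrow> I\<^sup>1\<close> for the start of the minimal injective resolution of \<open>A\<close>.  A monomial algebra
  has a basis of paths, and its injective modules are described by the paths that end in a given
  vertex.  Since \<open>I\<^sup>0\<close> is projective, a right-maximal path has a unique left-maximal extension, and
  a path that is maximal on both sides is the only right-maximal path with its start vertex.

  If two arrows \<open>b\<^sub>1 \<noteq> b\<^sub>2\<close> start in \<open>y\<close>, then \<open>I\<^sup>1\<close> has a nonzero socle element at \<open>y\<close>: the map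
  on the radical that fixes \<open>b\<^sub>1\<close> and kills \<open>b\<^sub>2\<close> extends to \<open>I\<^sup>0\<close>, but not to \<open>A\<close>.  Because
  \<open>pdim I\<^sup>1 \<le> 1\<close>, the difference of two left-maximal paths into \<open>y\<close> at the point where they branch
  is a part of a basis of a projective syzygy, so it has no annihilator: for every nonzero
  continuation, one of the two products is nonzero.  Comparing this with the uniqueness of
  left-maximal extensions leaves exactly two arrows into \<open>y\<close>, two arrows out of \<open>y\<close>, and two
  nonzero compositions that form a matching.  At the remaining vertices at most one arrow ends.
\<close>

section \<open>Nonzero paths\<close>

text \<open>Neither I^0 nor I^1 is computed. Injectivity enters only as an extension property: a
  socle element at \<open>y\<close> is the image of the functional dual to the trivial path, and an
  extension to Hom_k(A, k) supplies for every nonzero path into \<open>y\<close> an element that the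
  path sends to it. Projectivity enters through lifting and the dual basis lemma: elements are
  detected, and their radical parts read off, by maps to \<open>A\<close>, where the last arrow of a
  basis path is visible. A syzygy with an annihilator lies in the radical of \<open>P1\<close>;
  splitting off its last arrow corrects a lift in \<open>P0\<close> until that arrow kills it, and
  the socle element becomes zero.

  The obstacle is that the two left-maximal paths might share a suffix, so that they branch before
  they reach \<open>y\<close>. A shared last arrow \<open>a\<close> would be cancellable from both
  sides; then the start of \<open>a\<close> carries a socle element of I^1 too, and a second syzygy
  argument shows that nonzero paths on the two sides of \<open>a\<close> compose to nonzero paths,
  against uniqueness. The last two assumptions of \<open>gorenstein_paths\<close> exist for this
  step.\<close>

definition target :: "('v, 'e) pre_digraph \<Rightarrow> 'v \<Rightarrow> 'e list \<Rightarrow> 'v" where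
  "target Q u p = (if p = [] then u else head Q (last p))"

lemma target_Nil [simp]: "target Q u [] = u"
  and target_Cons [simp]: "target Q u (a # p) = target Q (head Q a) p"
  and target_append [simp]: "target Q u (p @ q) = target Q (target Q u p) q"
  by (auto simp: target_def)

lemma awlast_eq_target: "pre_digraph.awlast Q u p = target Q u p"
  by (simp add: target_def pre_digraph.awalk_verts_conv)

lemma suffix_branching:
  assumes "\<not> suffix xs ys" "\<not> suffix ys xs"
  obtains w1 d1 w2 d2 s where "d1 \<noteq> d2" "xs = w1 @ d1 # s" "ys = w2 @ d2 # s"
proof -
  have "rev xs \<parallel> rev ys" using assms by (simp add: suffix_to_prefix parallel_def)
  then obtain as b bs c cs where "b \<noteq> c" "rev xs = as @ b # bs" "rev ys = as @ c # cs"
    using parallel_decomp by blast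
  then have "b \<noteq> c" "xs = rev bs @ b # rev as" "ys = rev cs @ c # rev as"
    by (metis append.assoc append_Cons append_Nil rev.simps(2) rev_append rev_rev_ident)+
  then show ?thesis using that by blast
qed

lemma greatest_nat_exists:
  fixes P :: "nat \<Rightarrow> bool"
  assumes "P k" "\<And>n. P n \<Longrightarrow> n \<le> m"
  obtains n where "P n" "\<And>k. P k \<Longrightarrow> k \<le> n"
  using GreatestI_nat[of P k m] Greatest_le_nat[of P _ m] assms by blast

text \<open>Models the paths outside a monomial ideal: closed under subpaths because the complement
  is an ideal, containing the arrows because an admissible ideal lies in the square of the arrow
  ideal, and finite because such an ideal contains a power of the arrow ideal.\<close>

locale nonzero_paths = fin_digraph Q for Q :: "('v, 'e) pre_digraph" +
  fixes N :: "('v \<times> 'e list) set"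
  assumes N_paths: "N \<subseteq> paths Q"
    and finite_N: "finite N"
    and trivial_in_N: "u \<in> verts Q \<Longrightarrow> (u, []) \<in> N"
    and arrow_in_N: "a \<in> arcs Q \<Longrightarrow> (tail Q a, [a]) \<in> N"
    and N_prefix: "(u, p @ q) \<in> N \<Longrightarrow> (u, p) \<in> N"
    and N_suffix: "(u, p @ q) \<in> N \<Longrightarrow> (target Q u p, q) \<in> N"
begin

definition rmax :: "'v \<Rightarrow> 'e list \<Rightarrow> bool" where
  "rmax u p \<longleftrightarrow> (u, p) \<in> N \<and> (\<forall>b. (u, p @ [b]) \<notin> N)"

definition lmax :: "'v \<Rightarrow> 'e list \<Rightarrow> bool" where
  "lmax u p \<longleftrightarrow> (u, p) \<in> N \<and> (\<forall>d\<in>arcs Q. head Q d = u \<longrightarrow> (tail Q d, d # p) \<notin> N)"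

lemma N_Cons: "(u, a # p) \<in> N \<Longrightarrow> u = tail Q a \<and> a \<in> arcs Q \<and> (head Q a, p) \<in> N"
  using N_paths N_suffix[of u "[a]" p] by (fastforce simp: paths_def awalk_def)

lemma N_arcs: "(u, p) \<in> N \<Longrightarrow> set p \<subseteq> arcs Q"
  using N_paths by (fastforce simp: paths_def awalk_def)

lemma N_verts: "(u, p) \<in> N \<Longrightarrow> u \<in> verts Q"
  using N_paths by (fastforce simp: paths_def awalk_def)

lemma N_target: "(u, p) \<in> N \<Longrightarrow> target Q u p \<in> verts Q"
  using N_suffix[of u p "[]"] N_verts by auto

text \<open>A nonempty \<open>u\<close> fixes its start vertex through its first arrow; for empty
  \<open>u\<close> the equality of targets does.\<close>

lemma N_start_unique:
  assumes "(x, w @ u) \<in> N" "(x', u) \<in> N" "target Q x (w @ u) = target Q x' u"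
  shows "target Q x w = x'"
  using assms N_suffix[OF assms(1)] by (cases u) (auto dest: N_Cons)

lemma N_bounded: obtains m where "\<And>u p. (u, p) \<in> N \<Longrightarrow> length p \<le> m"
proof
  fix u p assume "(u, p) \<in> N"
  then show "length p \<le> Max (insert 0 ((\<lambda>(u, p). length p) ` N))"
    using finite_N by (intro Max_ge) (auto intro: image_eqI[of _ _ "(u, p)"])
qed

lemma rmax_extension:
  assumes "(u, p) \<in> N" obtains v where "rmax u (p @ v)"
proof -
  obtain m where m: "\<And>u p. (u, p) \<in> N \<Longrightarrow> length p \<le> m" using N_bounded by blast
  let ?P = "\<lambda>n. \<exists>v. (u, p @ v) \<in> N \<and> length v = n"
  have "?P 0" using assms by auto
  moreover have "\<And>n. ?P n \<Longrightarrow> n \<le> m" using m by fastforce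
  ultimately obtain n where n: "?P n" "\<And>k. ?P k \<Longrightarrow> k \<le> n"
    using greatest_nat_exists[of ?P 0 m] by blast
  then obtain v where v: "(u, p @ v) \<in> N" "length v = n" by blast
  have "(u, (p @ v) @ [b]) \<notin> N" for b
  proof
    assume "(u, (p @ v) @ [b]) \<in> N"
    then have "?P (Suc n)" using v(2) by (intro exI[of _ "v @ [b]"]) auto
    then show False using n(2) by fastforce
  qed
  then show ?thesis using that v(1) unfolding rmax_def by blast
qed

lemma lmax_extension:
  assumes "(u, p) \<in> N" obtains x w where "lmax x (w @ p)" "target Q x w = u"
proof -
  obtain m where m: "\<And>u p. (u, p) \<in> N \<Longrightarrow> length p \<le> m" using N_bounded by blast
  let ?P = "\<lambda>n. \<exists>x w. (x, w @ p) \<in> N \<and> target Q x w = u \<and> length w = n"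
  have "?P 0" using assms by (intro exI[of _ u] exI[of _ "[]"]) auto
  moreover have "\<And>n. ?P n \<Longrightarrow> n \<le> m" using m by fastforce
  ultimately obtain n where n: "?P n" "\<And>k. ?P k \<Longrightarrow> k \<le> n"
    using greatest_nat_exists[of ?P 0 m] by blast
  then obtain x w where w: "(x, w @ p) \<in> N" "target Q x w = u" "length w = n" by blast
  have "(tail Q d, d # w @ p) \<notin> N" if "head Q d = x" for d
  proof
    assume "(tail Q d, d # w @ p) \<in> N"
    with that w have "?P (Suc n)"
      by (intro exI[of _ "tail Q d"] exI[of _ "d # w"]) auto
    then show False using n(2) by fastforce
  qed
  then show ?thesis using that w unfolding lmax_def by blast
qed

lemma rmax_append:
  assumes "rmax (target Q x u) p" "(x, u @ p) \<in> N" shows "rmax x (u @ p)"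
  using assms N_suffix unfolding rmax_def by (metis append.assoc)

text \<open>
  \<open>socle_cond y\<close> is what a nonzero element of the socle of \<open>I\<^sup>1\<close> at \<open>y\<close> implies if
  \<open>pdim I\<^sup>1 \<le> 1\<close>: the relations between left-maximal paths ending in \<open>y\<close> generate free
  modules.
\<close>

definition socle_cond :: "'v \<Rightarrow> bool" where
  "socle_cond y \<longleftrightarrow> (\<forall>x1 x2 w1 w2 d1 d2 s q. d1 \<noteq> d2 \<longrightarrow>
     (x1, w1 @ d1 # s) \<in> N \<longrightarrow> (x2, w2 @ d2 # s) \<in> N \<longrightarrow>
     target Q x1 (w1 @ d1 # s) = y \<longrightarrow> target Q x2 (w2 @ d2 # s) = y \<longrightarrow>
     (head Q d1, q) \<in> N \<longrightarrow>
     (x1, w1 @ d1 # q) \<in> N \<or> (x2, w2 @ d2 # q) \<in> N)"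

lemma socle_condD:
  assumes "socle_cond y" "d1 \<noteq> d2" "(x1, w1 @ d1 # s) \<in> N" "(x2, w2 @ d2 # s) \<in> N"
    "target Q x1 (w1 @ d1 # s) = y" "target Q x2 (w2 @ d2 # s) = y" "(head Q d1, q) \<in> N"
  shows "(x1, w1 @ d1 # q) \<in> N \<or> (x2, w2 @ d2 # q) \<in> N"
  using assms unfolding socle_cond_def by blast

text \<open>The order of the two choices matters: \<open>b # p\<close> is right-maximal on its own,
  which is stronger than right-maximality of the whole path, and only then is it extended to the
  left. By \<open>rmax_append\<close> the whole path is maximal on both sides.\<close>

definition bimax :: "'e \<Rightarrow> 'e list \<Rightarrow> 'v \<Rightarrow> 'e list \<Rightarrow> bool" where
  "bimax b p x u \<longleftrightarrow> rmax (tail Q b) (b # p) \<and> lmax x (u @ b # p) \<and> target Q x u = tail Q b"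

lemma bimax_N: "bimax b p x u \<Longrightarrow> (x, u @ b # p) \<in> N"
  by (simp add: bimax_def lmax_def)

lemma bimax_N': "bimax b p x u \<Longrightarrow> (x, u) \<in> N"
  using bimax_N N_prefix by blast

lemma bimax_exists:
  assumes "b \<in> arcs Q" obtains p x u where "bimax b p x u"
proof -
  obtain p where "rmax (tail Q b) ([b] @ p)" using rmax_extension arrow_in_N assms by metis
  moreover from this obtain x u where "lmax x (u @ b # p)" "target Q x u = tail Q b"
    using lmax_extension[of "tail Q b" "b # p"] by (auto simp: rmax_def)
  ultimately show ?thesis using that unfolding bimax_def by auto
qed

lemma bimax_extends:
  assumes "rmax u p" "p \<noteq> []" obtains b p' x w where "p = b # p'" "u = tail Q b" "bimax b p' x w"
proof -
  from assms obtain b p' where p: "p = b # p'" by (cases p) auto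
  with assms have u: "u = tail Q b" using N_Cons by (auto simp: rmax_def)
  obtain x w where "lmax x (w @ b # p')" "target Q x w = tail Q b"
    using lmax_extension[of u p] assms p u by (auto simp: rmax_def)
  with assms p u show ?thesis using that unfolding bimax_def by auto
qed

end

text \<open>The first two assumptions express that I^0 is projective, the other three that I^1 has
  projective dimension at most one. \<open>socle_cond_in\<close> and \<open>arrow_free\<close>
  concern an arrow that can be put in front of every nonzero path from its end; they exclude a
  common last arrow in \<open>bimax_last_distinct\<close>.\<close>

locale gorenstein_paths = nonzero_paths +
  assumes rmax_coherent: "\<lbrakk>rmax u p; (x1, d1 # s) \<in> N; (x2, d2 # s) \<in> N;
      target Q x1 (d1 # s) = target Q u p; target Q x2 (d2 # s) = target Q u p\<rbrakk> \<Longrightarrow> d1 = d2"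
    and bimax_uniserial: "\<lbrakk>rmax x (r @ b # s); lmax x (r @ b # s); (x, r @ [b']) \<in> N\<rbrakk> \<Longrightarrow> b' = b"
    and socle_cond_out: "\<lbrakk>b1 \<in> arcs Q; b2 \<in> arcs Q; b1 \<noteq> b2; tail Q b1 = y; tail Q b2 = y\<rbrakk> \<Longrightarrow> socle_cond y"
    and socle_cond_in: "\<lbrakk>a \<in> arcs Q; \<And>v. (head Q a, v) \<in> N \<Longrightarrow> (tail Q a, a # v) \<in> N\<rbrakk> \<Longrightarrow> socle_cond (tail Q a)"
    and arrow_free: "\<lbrakk>a \<in> arcs Q; \<And>v. (head Q a, v) \<in> N \<Longrightarrow> (tail Q a, a # v) \<in> N;
      \<And>x c. \<lbrakk>(x, c) \<in> N; target Q x c = tail Q a\<rbrakk> \<Longrightarrow> (x, c @ [a]) \<in> N;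
      (x, c) \<in> N; target Q x c = tail Q a; (head Q a, v) \<in> N\<rbrakk> \<Longrightarrow> (x, c @ a # v) \<in> N"
begin

section \<open>Two-sided maximal paths and branching vertices\<close>

lemma bimax_next:
  assumes "bimax b p x u" "(x, u @ b' # q) \<in> N" shows "b' = b"
proof -
  have "rmax x (u @ b # p)" using assms(1) by (intro rmax_append) (auto simp: bimax_def lmax_def)
  moreover have "(x, u @ [b']) \<in> N" using assms(2) N_prefix[of x "u @ [b']" q] by simp
  ultimately show ?thesis using assms(1) bimax_uniserial unfolding bimax_def by blast
qed

text \<open>A left extension of \<open>b # p\<close> cannot be longer than \<open>u\<close>, by
  left-maximality. It cannot branch off from \<open>u\<close> either: two different arrows would
  precede the same path into the end of a right-maximal path, against
  \<open>rmax_coherent\<close>.\<close>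

lemma bimax_suffix:
  assumes f: "bimax b p x u" and n: "(x', u' @ b # p) \<in> N"
  shows "suffix u' u"
proof (rule ccontr)
  assume *: "\<not> suffix u' u"
  have t: "target Q x' u' = tail Q b" using N_suffix[OF n] N_Cons by blast
  show False
  proof (cases "suffix u u'")
    case True
    then obtain w where w: "u' = w @ u" by (auto simp: suffix_def)
    with * have "w \<noteq> []" by auto
    then obtain w' d where w': "w = w' @ [d]" by (metis append_butlast_last_id)
    have "(target Q x' w', d # u @ b # p) \<in> N"
      using N_suffix[of x' w' "d # u @ b # p"] n w w' by simp
    moreover have "head Q d = x"
      using N_start_unique[of x' w "u @ b # p" x] n w w' bimax_N[OF f] by simp
    ultimately show False using f N_Cons unfolding bimax_def lmax_def by metis
  next
    case False
    then obtain w1 d1 w2 d2 s where s: "d1 \<noteq> d2" "u' = w1 @ d1 # s" "u = w2 @ d2 # s"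
      using * suffix_branching by metis
    have "rmax x (u @ b # p)" using f by (intro rmax_append) (auto simp: bimax_def lmax_def)
    moreover have "(target Q x' w1, d1 # s @ b # p) \<in> N" "(target Q x w2, d2 # s @ b # p) \<in> N"
      using N_suffix[of x' w1 "d1 # s @ b # p"] N_suffix[of x w2 "d2 # s @ b # p"] n bimax_N[OF f] s by auto
    ultimately show False using rmax_coherent[of x "u @ b # p" _ d1 "s @ b # p" _ d2] s by auto
  qed
qed

text \<open>If \<open>u1\<close> were the end of \<open>u2\<close>, the second path would continue
  \<open>u1\<close> by \<open>b2\<close>, whereas \<open>bimax_next\<close> allows \<open>b1\<close>
  only.\<close>

lemma bimax_not_suffix:
  assumes "bimax b1 p1 x1 u1" "bimax b2 p2 x2 u2" "b1 \<noteq> b2" "tail Q b1 = tail Q b2"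
  shows "\<not> suffix u1 u2"
proof
  assume "suffix u1 u2"
  then obtain w where w: "u2 = w @ u1" by (auto simp: suffix_def)
  have "target Q x2 w = x1"
    using N_start_unique[of x2 w u1 x1] bimax_N'[OF assms(1)] bimax_N'[OF assms(2)] assms w
    by (auto simp: bimax_def)
  then have "(x1, u1 @ b2 # p2) \<in> N"
    using N_suffix[of x2 w "u1 @ b2 # p2"] bimax_N[OF assms(2)] w by simp
  then show False using bimax_next assms by blast
qed

text \<open>The path \<open>c\<close> is compared with the left part of the first bimaximal path,
  without its last arrow \<open>a\<close>. If the two branch, their common end lies within
  \<open>s\<close> because of \<open>nc\<close>, and there \<open>socle_cond\<close> offers a
  continuation taken from the second path. The first path cannot accept it, since \<open>b2\<close>
  does not continue that path, so \<open>c\<close> does.\<close>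

lemma arrow_right_faithful:
  assumes sc: "socle_cond (tail Q a)"
    and f1: "bimax b1 p1 x1 (w1 @ d1 # s @ [a])"
    and f2: "bimax b2 p2 x2 (w2 @ d2 # s @ [a])" and b: "b1 \<noteq> b2"
    and c: "(xc, c) \<in> N" "target Q xc c = tail Q a" and nc: "\<not> suffix (d1 # s) c"
  shows "(xc, c @ [a]) \<in> N"
proof (cases "suffix c (w1 @ d1 # s)")
  case True
  then obtain v where v: "w1 @ d1 # s = v @ c" by (auto simp: suffix_def)
  have "w1 @ d1 # s @ [a] = v @ c @ [a]" using v by (metis append.assoc append_Cons)
  with bimax_N'[OF f1] have n1: "(x1, v @ c @ [a]) \<in> N" by simp
  then have "(x1, v @ c) \<in> N" using N_prefix[of x1 "v @ c" "[a]"] by simp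
  moreover have "target Q x1 (v @ c) = tail Q a"
    using N_suffix[of x1 "v @ c" "[a]"] n1 N_Cons by fastforce
  ultimately have "target Q x1 v = xc" using N_start_unique[of x1 v c xc] c by simp
  then show ?thesis using N_suffix[OF n1] by simp
next
  case False
  moreover have "\<not> suffix (w1 @ d1 # s) c"
  proof
    assume "suffix (w1 @ d1 # s) c"
    moreover have "suffix (d1 # s) (w1 @ d1 # s)" by (rule suffixI) simp
    ultimately show False using nc suffix_order.trans by blast
  qed
  ultimately obtain w3 d3 w4 d4 t where t: "d3 \<noteq> d4" "c = w3 @ d3 # t" "w1 @ d1 # s = w4 @ d4 # t"
    by (rule suffix_branching)
  have st: "suffix t s"
  proof (rule ccontr)
    assume "\<not> suffix t s"
    moreover have "suffix t (w1 @ d1 # s)" using t(3) by (simp add: suffix_def)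
    moreover have "suffix (d1 # s) (w1 @ d1 # s)" by (simp add: suffix_def)
    ultimately have "suffix (d1 # s) t"
      using suffix_same_cases[of t "w1 @ d1 # s" "d1 # s"] suffix_Cons[of t d1 s] by auto
    then have "suffix (d1 # s) c" using t(2) by (auto simp: suffix_def)
    with nc show False by simp
  qed
  then obtain s1 where s1: "s = s1 @ t" by (auto simp: suffix_def)
  \<comment> \<open>The left part of the second bimaximal path also ends in \<open>t @ [a]\<close>,
    so this is a nonzero continuation from the branching point.\<close>
  let ?q = "t @ a # b2 # p2"
  have "(x2, (w2 @ d2 # s1) @ ?q) \<in> N" using bimax_N[OF f2] s1 by simp
  from N_suffix[OF this] obtain z where z: "(z, ?q) \<in> N" by blast
  have wt: "w1 @ d1 # s @ v = w4 @ d4 # t @ v" for v using arg_cong[OF t(3), of "\<lambda>l. l @ v"] by simp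
  have n4: "(x1, (w4 @ [d4]) @ t @ [a]) \<in> N" using bimax_N'[OF f1] wt by simp
  have hd4: "(head Q d4, t @ [a]) \<in> N" using N_suffix[OF n4] by simp
  have n4': "(x1, w4 @ d4 # t) \<in> N" using N_prefix[of x1 "w4 @ d4 # t" "[a]"] n4 by simp
  have t4: "target Q x1 (w4 @ d4 # t) = tail Q a" using N_suffix[of x1 "w4 @ d4 # t" "[a]"] n4 N_Cons by fastforce
  have "(head Q d3, t) \<in> N" "target Q (head Q d3) t = tail Q a"
    using N_suffix[of xc "w3 @ [d3]" t] c t(2) by auto
  moreover have "z = tail Q (hd (t @ [a]))" using z by (cases t) (auto dest: N_Cons)
  ultimately have "(head Q d3, ?q) \<in> N"
    using z by (cases t) (auto dest: N_Cons)
  from socle_condD[OF sc t(1) _ n4' _ t4 this] c t(2)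
  have "(xc, w3 @ d3 # ?q) \<in> N \<or> (x1, w4 @ d4 # ?q) \<in> N" by auto
  then show ?thesis
  proof
    assume "(xc, w3 @ d3 # ?q) \<in> N"
    then show ?thesis using N_prefix[of xc "c @ [a]" "b2 # p2"] t(2) by simp
  next
    assume "(x1, w4 @ d4 # ?q) \<in> N"
    moreover have "w4 @ d4 # ?q = (w1 @ d1 # s @ [a]) @ b2 # p2" using wt by simp
    ultimately show ?thesis using bimax_next[OF f1, of b2 p2] b by simp
  qed
qed

text \<open>Moves the branching of the two left parts to the vertex \<open>y\<close> itself, so that
  \<open>branching_vertex\<close> can use \<open>socle_cond\<close> with
  \<open>s = []\<close>.\<close>

lemma bimax_last_distinct:
  assumes f1: "bimax b1 p1 x1 u1" and f2: "bimax b2 p2 x2 u2"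
    and b: "b1 \<noteq> b2" "tail Q b1 = y" "tail Q b2 = y" "b1 \<in> arcs Q" "b2 \<in> arcs Q"
  obtains w1 d1 w2 d2 where "d1 \<noteq> d2" "u1 = w1 @ [d1]" "u2 = w2 @ [d2]"
proof -
  have "\<not> suffix u1 u2" "\<not> suffix u2 u1" using bimax_not_suffix assms by metis+
  then obtain w1 d1 w2 d2 s where s: "d1 \<noteq> d2" "u1 = w1 @ d1 # s" "u2 = w2 @ d2 # s"
    using suffix_branching by metis
  txt \<open>Multiplication by a common last arrow would be injective on both sides, so that
    \<open>arrow_free\<close> extends \<open>u1\<close> by \<open>b2\<close>.\<close>
  have "s = []"
  proof (rule ccontr)
    assume "s \<noteq> []"
    then obtain s' a where s': "s = s' @ [a]" by (metis append_butlast_last_id)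
    have sc: "socle_cond y" using socle_cond_out b by metis
    have t1: "target Q x1 u1 = y" and t2: "target Q x2 u2 = y" using f1 f2 b by (auto simp: bimax_def)
    have n1: "(x1, u1) \<in> N" and n2: "(x2, u2) \<in> N" using f1 f2 bimax_N' by auto
    have ya: "head Q a = y" using t1 s s' by simp
    have a: "a \<in> arcs Q" using N_arcs[OF n1] s s' by auto
    \<comment> \<open>Complete \<open>v\<close> to a right-maximal path and this one to a bimaximal
      path; the claim follows once its left part \<open>u3\<close> is known to end in
      \<open>a\<close>.\<close>
    have left: "(tail Q a, a # v) \<in> N" if v: "(head Q a, v) \<in> N" for v
    proof -
      obtain v' where v': "rmax y (v @ v')" using rmax_extension v ya by metis
      have "v @ v' \<noteq> []" using v' arrow_in_N[OF b(4)] b(2) unfolding rmax_def by (metis append_Nil)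
      then obtain b3 p3 x3 u3 where b3: "v @ v' = b3 # p3" "y = tail Q b3" "bimax b3 p3 x3 u3"
        using bimax_extends[OF v'] by metis
      \<comment> \<open>The empty list is a suffix of both \<open>u1\<close> and \<open>u2\<close>,
        and \<open>b3\<close> differs from \<open>b1\<close> or from \<open>b2\<close>.\<close>
      have "u3 \<noteq> []" using bimax_not_suffix[OF b3(3) f1] bimax_not_suffix[OF b3(3) f2] b b3(2) by force
      then obtain t a3 where u3: "u3 = t @ [a3]" by (metis append_butlast_last_id)
      have "a3 = a"
      proof (rule ccontr)
        assume ne: "a3 \<noteq> a"
        have h3: "head Q a3 = y" using b3 u3 by (simp add: bimax_def)
        \<comment> \<open>The continuation \<open>b2 # p2\<close> cannot follow \<open>u1\<close>,
          so it follows \<open>u3\<close>; then \<open>bimax_suffix\<close> makes \<open>u3\<close>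
          a suffix of \<open>u2\<close>, whose last arrow is \<open>a\<close>.\<close>
        have "(x3, t @ a3 # b2 # p2) \<in> N \<or> (x1, (w1 @ d1 # s') @ a # b2 # p2) \<in> N"
          using socle_condD[OF sc ne, of x3 t "[]" x1 "w1 @ d1 # s'" "b2 # p2"]
            bimax_N'[OF b3(3)] n1 u3 s s' h3 ya f2 b by (auto simp: bimax_def rmax_def)
        moreover have "(x1, u1 @ b2 # p2) \<notin> N" using bimax_next[OF f1] b by blast
        ultimately have "(x3, (t @ [a3]) @ b2 # p2) \<in> N" using s s' by auto
        from bimax_suffix[OF f2 this] show False using s s' ne by (simp add: suffix_def)
      qed
      then have "(x3, t @ (a # v) @ v') \<in> N" using bimax_N[OF b3(3)] u3 b3(1) by simp
      from N_prefix[OF N_suffix[OF this]] have "(target Q x3 t, a # v) \<in> N" .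
      with N_Cons[OF this] show ?thesis by simp
    qed
    have sca: "socle_cond (tail Q a)" using socle_cond_in a left by blast
    \<comment> \<open>No \<open>c\<close> ends in both \<open>d1 # s'\<close> and
      \<open>d2 # s'\<close>, so one of the two orderings of the bimaximal paths meets the
      hypothesis \<open>nc\<close> of \<open>arrow_right_faithful\<close>.\<close>
    have right: "(x, c @ [a]) \<in> N" if "(x, c) \<in> N" "target Q x c = tail Q a" for x c
    proof (cases "suffix (d1 # s') c")
      case False
      then show ?thesis using arrow_right_faithful[OF sca, of b1 p1 x1 w1 d1 s' b2 p2 x2 w2 d2] f1 f2 s s' b that
        by auto
    next
      case True
      with s(1) have "\<not> suffix (d2 # s') c" by (auto simp: suffix_def)
      then show ?thesis using arrow_right_faithful[OF sca, of b2 p2 x2 w2 d2 s' b1 p1 x1 w1 d1] f1 f2 s s' b that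
        by auto
    qed
    have e1: "(x1, (w1 @ d1 # s') @ [a]) \<in> N" using n1 s s' by simp
    have "(x1, (w1 @ d1 # s') @ a # [b2]) \<in> N"
    proof (rule arrow_free[OF a left right])
      show "(x1, w1 @ d1 # s') \<in> N" using N_prefix[OF e1] .
      show "target Q x1 (w1 @ d1 # s') = tail Q a" using N_suffix[OF e1] N_Cons by blast
      show "(head Q a, [b2]) \<in> N" using arrow_in_N[of b2] b ya by simp
    qed
    then show False using bimax_next[OF f1, of b2 "[]"] s s' b by simp
  qed
  with s that show ?thesis by blast
qed

text \<open>\<open>d1\<close> and \<open>d2\<close> are the last arrows of the left parts of
  bimaximal paths through \<open>b1\<close> and \<open>b2\<close>. By \<open>bimax_next\<close> only
  \<open>b1\<close> can follow the one left part and only \<open>b2\<close> the other, so each use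
  of \<open>socle_cond\<close> leaves at most one alternative.\<close>

lemma branching_vertex:
  assumes b: "b1 \<noteq> b2" "tail Q b1 = y" "tail Q b2 = y" "b1 \<in> arcs Q" "b2 \<in> arcs Q"
  obtains d1 d2 u1 u2 where "d1 \<noteq> d2"
    "\<And>d. \<lbrakk>d \<in> arcs Q; head Q d = y\<rbrakk> \<Longrightarrow> d = d1 \<or> d = d2"
    "\<And>b. \<lbrakk>b \<in> arcs Q; tail Q b = y\<rbrakk> \<Longrightarrow> b = b1 \<or> b = b2"
    "(tail Q d1, [d1, b2]) \<notin> N" "(tail Q d2, [d2, b1]) \<notin> N"
    "\<And>x c. (x, c @ [d1]) \<in> N \<Longrightarrow> suffix (c @ [d1]) u1"
    "\<And>x c. (x, c @ [d2]) \<in> N \<Longrightarrow> suffix (c @ [d2]) u2"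
proof -
  obtain p1 x1 u1 where f1: "bimax b1 p1 x1 u1" using bimax_exists b by metis
  obtain p2 x2 u2 where f2: "bimax b2 p2 x2 u2" using bimax_exists b by metis
  obtain w1 d1 w2 d2 where d: "d1 \<noteq> d2" "u1 = w1 @ [d1]" "u2 = w2 @ [d2]"
    using bimax_last_distinct[OF f1 f2 b] by metis
  have sc: "socle_cond y" using socle_cond_out b by metis
  have n1: "(x1, w1 @ d1 # []) \<in> N" and n2: "(x2, w2 @ d2 # []) \<in> N" using f1 f2 bimax_N' d by auto
  have t1: "target Q x1 (w1 @ d1 # []) = y" and t2: "target Q x2 (w2 @ d2 # []) = y"
    using f1 f2 b d by (auto simp: bimax_def)
  have h: "head Q d1 = y" "head Q d2 = y" using t1 t2 by auto
  have q1: "(y, b1 # p1) \<in> N" and q2: "(y, b2 # p2) \<in> N" using f1 f2 b by (auto simp: bimax_def rmax_def)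
  have no1: "b' = b1" if "(x1, w1 @ d1 # b' # q) \<in> N" for b' q using bimax_next[OF f1, of b' q] that d by simp
  have no2: "b' = b2" if "(x2, w2 @ d2 # b' # q) \<in> N" for b' q using bimax_next[OF f2, of b' q] that d by simp
  \<comment> \<open>A further incoming arrow is compared with \<open>d2\<close>: as
    \<open>b1 # p1\<close> cannot follow \<open>w2 @ [d2]\<close>, it follows \<open>d'\<close>, and
    \<open>bimax_suffix\<close> makes \<open>d'\<close> the last arrow of \<open>u1\<close>.\<close>
  have "d' = d1 \<or> d' = d2" if "d' \<in> arcs Q" "head Q d' = y" for d'
  proof (rule disjCI)
    assume "d' \<noteq> d2"
    from socle_condD[OF sc this _ n2 _ t2, of "tail Q d'" "[]" "b1 # p1"] arrow_in_N that q1 no2 b(1)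
    have "(tail Q d', [d'] @ b1 # p1) \<in> N" by auto
    from bimax_suffix[OF f1 this] show "d' = d1" using d by (simp add: suffix_def)
  qed
  moreover have "b = b1 \<or> b = b2" if b: "b \<in> arcs Q" "tail Q b = y" for b
  proof -
    obtain p x u where f: "bimax b p x u" using bimax_exists b by metis
    then have "(head Q d1, b # p) \<in> N" using b h by (auto simp: bimax_def rmax_def)
    from socle_condD[OF sc d(1) n1 n2 t1 t2 this] no1 no2 show ?thesis by blast
  qed
  moreover have "(tail Q d1, [d1, b2]) \<notin> N"
  proof
    assume "(tail Q d1, [d1, b2]) \<in> N"
    then obtain v where v: "rmax (tail Q d1) ([d1, b2] @ v)" using rmax_extension by metis
    then have v': "(head Q d1, b2 # v) \<in> N" using N_Cons by (auto simp: rmax_def)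
    \<comment> \<open>Now \<open>d1\<close> and \<open>d2\<close> both precede
      \<open>b2 # v\<close>, and \<open>d1 # b2 # v\<close> is right-maximal, so
      \<open>rmax_coherent\<close> identifies the two arrows.\<close>
    from socle_condD[OF sc d(1) n1 n2 t1 t2 this] no1 b(1) have "(x2, w2 @ d2 # b2 # v) \<in> N" by auto
    from N_suffix[OF this] have "d2 = d1"
      using rmax_coherent[OF v, of _ d2 "b2 # v" "tail Q d1" d1] v h by (auto simp: rmax_def)
    with d show False by simp
  qed
  moreover have "(tail Q d2, [d2, b1]) \<notin> N"
  proof
    assume "(tail Q d2, [d2, b1]) \<in> N"
    then obtain v where v: "rmax (tail Q d2) ([d2, b1] @ v)" using rmax_extension by metis
    then have "(tail Q d2, d2 # b1 # v) \<in> N" by (simp add: rmax_def)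
    from N_Cons[OF this] have v': "(head Q d1, b1 # v) \<in> N" using h by simp
    from socle_condD[OF sc d(1) n1 n2 t1 t2 this] no2 b(1) have "(x1, w1 @ d1 # b1 # v) \<in> N" by auto
    from N_suffix[OF this] have "d1 = d2"
      using rmax_coherent[OF v, of _ d1 "b1 # v" "tail Q d2" d2] v h by (auto simp: rmax_def)
    with d show False by simp
  qed
  moreover have "suffix (c @ [d1]) u1" if "(x, c @ [d1]) \<in> N" for x c
  proof -
    from socle_condD[OF sc d(1) that n2 _ t2, of "b1 # p1"] h q1 no2 b(1)
    have "(x, (c @ [d1]) @ b1 # p1) \<in> N" by auto
    from bimax_suffix[OF f1 this] show ?thesis .
  qed
  moreover have "suffix (c @ [d2]) u2" if "(x, c @ [d2]) \<in> N" for x c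
  proof -
    from socle_condD[OF sc d(1)[symmetric] that n1 _ t1, of "b2 # p2"] h q2 no1 b(1)
    have "(x, (c @ [d2]) @ b2 # p2) \<in> N" by auto
    from bimax_suffix[OF f2 this] show ?thesis .
  qed
  ultimately show ?thesis by (rule that[OF d(1)])
qed

section \<open>The conditions of a string algebra\<close>

lemma string_out:
  assumes "b1 \<noteq> b2" "head Q a = tail Q b1" "tail Q b1 = tail Q b2"
    "a \<in> arcs Q" "b1 \<in> arcs Q" "b2 \<in> arcs Q"
  shows "(tail Q a, [a, b1]) \<notin> N \<or> (tail Q a, [a, b2]) \<notin> N"
  using branching_vertex[of b1 b2 "head Q a"] assms by metis

text \<open>Both compositions are extended to right-maximal paths. If one extension is a prefix of
  the other, \<open>rmax_coherent\<close> identifies \<open>a1\<close> and \<open>a2\<close>;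
  otherwise they part at a branching vertex, where all nonzero paths with the same last arrow are
  suffixes of a single path.\<close>

lemma string_in:
  assumes a: "a1 \<noteq> a2"
  shows "(tail Q a1, [a1, b]) \<notin> N \<or> (tail Q a2, [a2, b]) \<notin> N"
proof (rule ccontr)
  assume "\<not> ?thesis"
  then obtain v1 v2 where v: "rmax (tail Q a1) ([a1, b] @ v1)" "rmax (tail Q a2) ([a2, b] @ v2)"
    using rmax_extension by metis
  then have n: "(tail Q a1, a1 # b # v1) \<in> N" "(tail Q a2, a2 # b # v2) \<in> N" by (auto simp: rmax_def)
  then have "head Q a1 = tail Q b" "head Q a2 = tail Q b" using N_Cons by blast+
  then have h: "head Q a1 = head Q a2" by simp
  show False
  proof (cases "prefix v1 v2 \<or> prefix v2 v1")
    case True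
    then show False
    proof
      assume "prefix v1 v2"
      then obtain t where "v2 = v1 @ t" by (auto simp: prefix_def)
      with n have "(tail Q a2, a2 # b # v1) \<in> N" using N_prefix[of "tail Q a2" "a2 # b # v1" t] by simp
      then show False using rmax_coherent[OF v(1), of "tail Q a2" a2 "b # v1" "tail Q a1" a1] n a h by simp
    next
      assume "prefix v2 v1"
      then obtain t where "v1 = v2 @ t" by (auto simp: prefix_def)
      with n have "(tail Q a1, a1 # b # v2) \<in> N" using N_prefix[of "tail Q a1" "a1 # b # v2" t] by simp
      then show False using rmax_coherent[OF v(2), of "tail Q a2" a2 "b # v2" "tail Q a1" a1] n a h by simp
    qed
  next
    case False
    then obtain r e1 t1 e2 t2 where r: "e1 \<noteq> e2" "v1 = r @ e1 # t1" "v2 = r @ e2 # t2"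
      using parallel_decomp[of v1 v2] by (auto simp: parallel_def)
    let ?y = "target Q (tail Q a1) (a1 # b # r)"
    have e: "(?y, e1 # t1) \<in> N" "(?y, e2 # t2) \<in> N"
      using N_suffix[of "tail Q a1" "a1 # b # r" "e1 # t1"] N_suffix[of "tail Q a2" "a2 # b # r" "e2 # t2"] n r h by auto
    then have e': "tail Q e1 = ?y" "tail Q e2 = ?y" "e1 \<in> arcs Q" "e2 \<in> arcs Q" using N_Cons by metis+
    \<comment> \<open>The list \<open>b # r\<close> is nonempty, so the last arrow
      \<open>\<alpha>\<close> before the branching vertex is common to both paths.\<close>
    obtain r' \<alpha> where r': "b # r = r' @ [\<alpha>]" by (metis append_butlast_last_id list.distinct(1))
    have r1: "(tail Q a1, (a1 # r') @ [\<alpha>]) \<in> N" "(tail Q a2, (a2 # r') @ [\<alpha>]) \<in> N"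
      using n r N_prefix[of "tail Q a1" "a1 # b # r" "e1 # t1"] N_prefix[of "tail Q a2" "a2 # b # r" "e2 # t2"]
      unfolding r'[symmetric] by (auto simp flip: r')
    have \<alpha>: "\<alpha> \<in> arcs Q" "head Q \<alpha> = ?y"
      using N_arcs[OF r1(1)] r' target_append[of Q "tail Q a1" "a1 # r'" "[\<alpha>]"] by auto
    obtain d1 d2 u1 u2 where
      "\<alpha> = d1 \<or> \<alpha> = d2"
      "\<And>x c. (x, c @ [d1]) \<in> N \<Longrightarrow> suffix (c @ [d1]) u1"
      "\<And>x c. (x, c @ [d2]) \<in> N \<Longrightarrow> suffix (c @ [d2]) u2"
      using branching_vertex[OF r(1) e'] \<alpha> by metis
    then obtain u where "suffix ((a1 # r') @ [\<alpha>]) u" "suffix ((a2 # r') @ [\<alpha>]) u"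
      using r1 by blast
    \<comment> \<open>Two suffixes of equal length of one list coincide, which would give
      \<open>a1 = a2\<close>.\<close>
    then show False using a by (auto simp: suffix_def)
  qed
qed

lemma no_three_out:
  assumes "b1 \<in> arcs Q" "b2 \<in> arcs Q" "b3 \<in> arcs Q" "tail Q b1 = y" "tail Q b2 = y" "tail Q b3 = y"
    "b1 \<noteq> b2" "b1 \<noteq> b3" "b2 \<noteq> b3"
  shows False
  using branching_vertex[of b1 b2 y] assms by metis

lemma no_three_in:
  assumes a: "a1 \<in> arcs Q" "a2 \<in> arcs Q" "a3 \<in> arcs Q" "head Q a1 = y" "head Q a2 = y" "head Q a3 = y"
    "a1 \<noteq> a2" "a1 \<noteq> a3" "a2 \<noteq> a3"
  shows False
proof (cases "\<exists>b1 b2. b1 \<in> arcs Q \<and> b2 \<in> arcs Q \<and> tail Q b1 = y \<and> tail Q b2 = y \<and> b1 \<noteq> b2")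
  case True
  then obtain b1 b2 where "b1 \<noteq> b2" "tail Q b1 = y" "tail Q b2 = y" "b1 \<in> arcs Q" "b2 \<in> arcs Q"
    by blast
  then obtain d1 d2 where "\<And>d. \<lbrakk>d \<in> arcs Q; head Q d = y\<rbrakk> \<Longrightarrow> d = d1 \<or> d = d2"
    by (rule branching_vertex) blast
  then show False using a by metis
next
  case False
  \<comment> \<open>A right-maximal arrow into \<open>y\<close> would force \<open>a1 = a2\<close>
    by \<open>rmax_coherent\<close>. So every arrow into \<open>y\<close> can be continued, and in
    the present case always by the same arrow.\<close>
  have not_rmax: "\<not> rmax (tail Q a) [a]" if "a \<in> arcs Q" "head Q a = y" for a
    using rmax_coherent[of "tail Q a" "[a]" "tail Q a1" a1 "[]" "tail Q a2" a2] a that arrow_in_N by auto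
  have "\<exists>b. (tail Q a, [a, b]) \<in> N" if "a \<in> arcs Q" "head Q a = y" for a
    using not_rmax[OF that] that arrow_in_N by (auto simp: rmax_def)
  then obtain b1 b2 where b: "(tail Q a1, [a1, b1]) \<in> N" "(tail Q a2, [a2, b2]) \<in> N" using a by metis
  then have "tail Q b1 = y" "tail Q b2 = y" "b1 \<in> arcs Q" "b2 \<in> arcs Q" using N_Cons a by metis+
  with False have "b1 = b2" by blast
  with b string_in a show False by blast
qed

lemma biserial: "biserial_quiver Q"
proof -
  have *: "card S \<le> 2" if "\<And>a b c. \<lbrakk>a \<in> S; b \<in> S; c \<in> S; a \<noteq> b; a \<noteq> c; b \<noteq> c\<rbrakk> \<Longrightarrow> False" for S :: "'b set"
  proof (rule ccontr)
    assume "\<not> card S \<le> 2"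
    then have "3 \<le> card S" by simp
    then obtain T where "T \<subseteq> S" "card T = 3" by (meson obtain_subset_with_card_n)
    then show False using that unfolding card_3_iff by auto
  qed
  show ?thesis unfolding biserial_quiver_def in_degree_def out_degree_def
    by (intro ballI conjI; rule *)
      (auto simp: in_arcs_def out_arcs_def intro: no_three_in no_three_out)
qed

end

section \<open>Right modules\<close>

context right_module
begin

lemma smult_zero_left: "x \<in> carrier M \<Longrightarrow> \<zero>\<^bsub>R\<^esub> \<odot>\<^bsub>M\<^esub> x = \<zero>\<^bsub>M\<^esub>"
  using smult_l_distr[of "\<zero>\<^bsub>R\<^esub>" "\<zero>\<^bsub>R\<^esub>" x] smult_closed[of "\<zero>\<^bsub>R\<^esub>" x]
  by (simp add: M.add.l_cancel_one')

lemma smult_zero_right: "a \<in> carrier R \<Longrightarrow> a \<odot>\<^bsub>M\<^esub> \<zero>\<^bsub>M\<^esub> = \<zero>\<^bsub>M\<^esub>"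
  using smult_r_distr[of a "\<zero>\<^bsub>M\<^esub>" "\<zero>\<^bsub>M\<^esub>"] smult_closed[of a "\<zero>\<^bsub>M\<^esub>"]
  by (simp add: M.add.l_cancel_one')

lemma smult_minus_right:
  assumes "a \<in> carrier R" "x \<in> carrier M" "y \<in> carrier M"
  shows "a \<odot>\<^bsub>M\<^esub> (x \<ominus>\<^bsub>M\<^esub> y) = a \<odot>\<^bsub>M\<^esub> x \<ominus>\<^bsub>M\<^esub> a \<odot>\<^bsub>M\<^esub> y"
proof -
  have "a \<odot>\<^bsub>M\<^esub> (x \<ominus>\<^bsub>M\<^esub> y) \<oplus>\<^bsub>M\<^esub> a \<odot>\<^bsub>M\<^esub> y = a \<odot>\<^bsub>M\<^esub> x"
    using assms smult_r_distr[of a "x \<ominus>\<^bsub>M\<^esub> y" y] by (simp add: M.minus_eq M.a_assoc M.l_neg)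
  then have "a \<odot>\<^bsub>M\<^esub> x \<ominus>\<^bsub>M\<^esub> a \<odot>\<^bsub>M\<^esub> y = a \<odot>\<^bsub>M\<^esub> (x \<ominus>\<^bsub>M\<^esub> y) \<oplus>\<^bsub>M\<^esub> a \<odot>\<^bsub>M\<^esub> y \<ominus>\<^bsub>M\<^esub> a \<odot>\<^bsub>M\<^esub> y" by simp
  then show ?thesis using assms smult_closed by (simp add: M.minus_eq M.a_assoc M.r_neg)
qed

lemma finsum_smult_left:
  assumes "finite S" "\<And>i. i \<in> S \<Longrightarrow> g i \<in> carrier R" "x \<in> carrier M"
  shows "(\<Oplus>\<^bsub>R\<^esub>i\<in>S. g i) \<odot>\<^bsub>M\<^esub> x = (\<Oplus>\<^bsub>M\<^esub>i\<in>S. g i \<odot>\<^bsub>M\<^esub> x)"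
  using assms
proof (induction S rule: finite_induct)
  case empty
  then show ?case by (simp add: smult_zero_left)
next
  case (insert i S)
  have "g \<in> S \<rightarrow> carrier R" "g i \<in> carrier R"
    "(\<lambda>i. g i \<odot>\<^bsub>M\<^esub> x) \<in> S \<rightarrow> carrier M" "g i \<odot>\<^bsub>M\<^esub> x \<in> carrier M"
    using insert.prems smult_closed by auto
  with insert show ?case by (simp add: smult_l_distr)
qed

end

lemma right_module_abelian_group: "right_module A M \<Longrightarrow> abelian_group M"
  by (simp add: right_module_def)

lemma right_module_homI:
  assumes "\<And>x. x \<in> carrier M \<Longrightarrow> f x \<in> carrier N"
    and "\<And>x y. \<lbrakk>x \<in> carrier M; y \<in> carrier M\<rbrakk> \<Longrightarrow> f (x \<oplus>\<^bsub>M\<^esub> y) = f x \<oplus>\<^bsub>N\<^esub> f y"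
    and "\<And>a x. \<lbrakk>a \<in> carrier A; x \<in> carrier M\<rbrakk> \<Longrightarrow> f (a \<odot>\<^bsub>M\<^esub> x) = a \<odot>\<^bsub>N\<^esub> f x"
  shows "f \<in> right_module_hom A M N"
  using assms by (auto simp: right_module_hom_def hom_def)

lemma right_module_homD:
  assumes "f \<in> right_module_hom A M N"
  shows "\<And>x. x \<in> carrier M \<Longrightarrow> f x \<in> carrier N"
    and "\<And>x y. \<lbrakk>x \<in> carrier M; y \<in> carrier M\<rbrakk> \<Longrightarrow> f (x \<oplus>\<^bsub>M\<^esub> y) = f x \<oplus>\<^bsub>N\<^esub> f y"
    and "\<And>a x. \<lbrakk>a \<in> carrier A; x \<in> carrier M\<rbrakk> \<Longrightarrow> f (a \<odot>\<^bsub>M\<^esub> x) = a \<odot>\<^bsub>N\<^esub> f x"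
  using assms by (auto simp: right_module_hom_def hom_def)

lemma right_module_hom_compose:
  assumes "f \<in> right_module_hom A M N" "g \<in> right_module_hom A N L"
  shows "(\<lambda>x. g (f x)) \<in> right_module_hom A M L"
  using right_module_homD[OF assms(1)] right_module_homD[OF assms(2)] by (intro right_module_homI) auto

lemma right_module_hom_zero:
  assumes "f \<in> right_module_hom A M N" "abelian_group M" "abelian_group N"
  shows "f \<zero>\<^bsub>M\<^esub> = \<zero>\<^bsub>N\<^esub>"
proof -
  interpret M: abelian_group M by fact
  interpret N: abelian_group N by fact
  show ?thesis
    using right_module_homD(1)[OF assms(1), of "\<zero>\<^bsub>M\<^esub>"] right_module_homD(2)[OF assms(1), of "\<zero>\<^bsub>M\<^esub>" "\<zero>\<^bsub>M\<^esub>"]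
    by (simp add: N.add.l_cancel_one')
qed

lemma right_module_hom_minus:
  assumes f: "f \<in> right_module_hom A M N" and "abelian_group M" "abelian_group N"
    and xy: "x \<in> carrier M" "y \<in> carrier M"
  shows "f (x \<ominus>\<^bsub>M\<^esub> y) = f x \<ominus>\<^bsub>N\<^esub> f y"
proof -
  interpret M: abelian_group M by fact
  interpret N: abelian_group N by fact
  have "f (x \<ominus>\<^bsub>M\<^esub> y) \<oplus>\<^bsub>N\<^esub> f y = f x"
    using right_module_homD(2)[OF f, of "x \<ominus>\<^bsub>M\<^esub> y" y] xy by (simp add: M.minus_eq M.a_assoc M.l_neg)
  then have "f x \<ominus>\<^bsub>N\<^esub> f y = f (x \<ominus>\<^bsub>M\<^esub> y) \<oplus>\<^bsub>N\<^esub> f y \<ominus>\<^bsub>N\<^esub> f y" by simp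
  then show ?thesis using xy right_module_homD(1)[OF f] by (simp add: N.minus_eq N.a_assoc N.r_neg)
qed

lemma right_module_hom_finsum:
  assumes f: "f \<in> right_module_hom A M N" and "abelian_group M" "abelian_group N"
    and "finite S" "\<And>i. i \<in> S \<Longrightarrow> g i \<in> carrier M"
  shows "f (\<Oplus>\<^bsub>M\<^esub>i\<in>S. g i) = (\<Oplus>\<^bsub>N\<^esub>i\<in>S. f (g i))"
proof -
  interpret M: abelian_group M by fact
  interpret N: abelian_group N by fact
  from assms(4,5) show ?thesis
  proof (induction S rule: finite_induct)
    case empty
    then show ?case using right_module_hom_zero[OF f assms(2,3)] by simp
  next
    case (insert i S)
    have "g \<in> S \<rightarrow> carrier M" "g i \<in> carrier M"
      "(\<lambda>i. f (g i)) \<in> S \<rightarrow> carrier N" "f (g i) \<in> carrier N"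
      using insert.prems right_module_homD(1)[OF f] by auto
    with insert show ?case by (simp add: right_module_homD(2)[OF f])
  qed
qed

text \<open>\<open>\<kappa>\<close> gives coordinates and \<open>\<beta>\<close> the corresponding
  basis. A vector equals the combination of the \<open>\<beta> r\<close> with its own coordinates
  because \<open>\<kappa>\<close> separates vectors.\<close>

lemma finite_dimensional_coordinatesI:
  fixes A :: "('k::field, 'a) module" and \<kappa> :: "'m \<Rightarrow> 'x \<Rightarrow> 'k"
  assumes M: "right_module A M" and X: "finite X"
    and scal: "\<And>c. c \<odot>\<^bsub>A\<^esub> \<one>\<^bsub>A\<^esub> \<in> carrier A"
    and supp: "\<And>m r. \<lbrakk>m \<in> carrier M; r \<notin> X\<rbrakk> \<Longrightarrow> \<kappa> m r = 0"
    and inj: "\<And>m n. \<lbrakk>m \<in> carrier M; n \<in> carrier M; \<kappa> m = \<kappa> n\<rbrakk> \<Longrightarrow> m = n"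
    and basis: "\<And>r. r \<in> X \<Longrightarrow> \<beta> r \<in> carrier M \<and> \<kappa> (\<beta> r) = (\<lambda>s. if s = r then 1 else 0)"
    and add: "\<And>m n r. \<lbrakk>m \<in> carrier M; n \<in> carrier M\<rbrakk> \<Longrightarrow> \<kappa> (m \<oplus>\<^bsub>M\<^esub> n) r = \<kappa> m r + \<kappa> n r"
    and smult: "\<And>c m r. m \<in> carrier M \<Longrightarrow> \<kappa> ((c \<odot>\<^bsub>A\<^esub> \<one>\<^bsub>A\<^esub>) \<odot>\<^bsub>M\<^esub> m) r = c * \<kappa> m r"
  shows "finite_dimensional A M"
proof -
  interpret right_module A M by fact
  have zero: "\<kappa> \<zero>\<^bsub>M\<^esub> r = 0" for r
  proof -
    have "\<kappa> \<zero>\<^bsub>M\<^esub> r = \<kappa> \<zero>\<^bsub>M\<^esub> r + \<kappa> \<zero>\<^bsub>M\<^esub> r" using add[of "\<zero>\<^bsub>M\<^esub>" "\<zero>\<^bsub>M\<^esub>" r] by (simp only: M.zero_closed M.l_zero)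
    then show ?thesis by (simp only: add_cancel_right_right)
  qed
  have sum: "\<kappa> (\<Oplus>\<^bsub>M\<^esub>i\<in>S. g i) r = (\<Sum>i\<in>S. \<kappa> (g i) r)"
    if "finite S" "\<And>i. i \<in> S \<Longrightarrow> g i \<in> carrier M" for S :: "'m set" and g r
    using that
  proof (induction S rule: finite_induct)
    case empty
    then show ?case by (simp add: zero)
  next
    case (insert i S)
    then have "g \<in> S \<rightarrow> carrier M" "g i \<in> carrier M" by auto
    with insert show ?case by (simp add: add)
  qed
  have inj\<beta>: "inj_on \<beta> X"
  proof (rule inj_onI)
    fix r s assume "r \<in> X" "s \<in> X" "\<beta> r = \<beta> s"
    then have "(\<lambda>t. if t = r then 1 else 0 :: 'k) r = (\<lambda>t. if t = s then 1 else 0) r" using basis by metis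
    then show "r = s" by (simp split: if_splits)
  qed
  have "\<exists>c. x = (\<Oplus>\<^bsub>M\<^esub>b\<in>\<beta> ` X. (c b \<odot>\<^bsub>A\<^esub> \<one>\<^bsub>A\<^esub>) \<odot>\<^bsub>M\<^esub> b)" if x: "x \<in> carrier M" for x
  proof
    \<comment> \<open>The coefficients in \<open>finite_dimensional\<close> are indexed by vectors
      and not by elements of \<open>X\<close>, hence the inverse of \<open>\<beta>\<close>.\<close>
    let ?c = "\<lambda>b. \<kappa> x (inv_into X \<beta> b)"
    have *: "(?c b \<odot>\<^bsub>A\<^esub> \<one>\<^bsub>A\<^esub>) \<odot>\<^bsub>M\<^esub> b \<in> carrier M" if "b \<in> \<beta> ` X" for b
      using that basis scal smult_closed by auto
    show "x = (\<Oplus>\<^bsub>M\<^esub>b\<in>\<beta> ` X. (?c b \<odot>\<^bsub>A\<^esub> \<one>\<^bsub>A\<^esub>) \<odot>\<^bsub>M\<^esub> b)"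
    proof (rule inj[OF x])
      show "(\<Oplus>\<^bsub>M\<^esub>b\<in>\<beta> ` X. (?c b \<odot>\<^bsub>A\<^esub> \<one>\<^bsub>A\<^esub>) \<odot>\<^bsub>M\<^esub> b) \<in> carrier M" using * by (intro M.finsum_closed) auto
      show "\<kappa> x = \<kappa> (\<Oplus>\<^bsub>M\<^esub>b\<in>\<beta> ` X. (?c b \<odot>\<^bsub>A\<^esub> \<one>\<^bsub>A\<^esub>) \<odot>\<^bsub>M\<^esub> b)"
      proof
        fix r
        have "\<kappa> (\<Oplus>\<^bsub>M\<^esub>b\<in>\<beta> ` X. (?c b \<odot>\<^bsub>A\<^esub> \<one>\<^bsub>A\<^esub>) \<odot>\<^bsub>M\<^esub> b) r = (\<Sum>b\<in>\<beta> ` X. \<kappa> ((?c b \<odot>\<^bsub>A\<^esub> \<one>\<^bsub>A\<^esub>) \<odot>\<^bsub>M\<^esub> b) r)"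
          using * X by (intro sum) auto
        also have "\<dots> = (\<Sum>b\<in>\<beta> ` X. ?c b * \<kappa> b r)" using basis by (intro sum.cong) (auto simp: smult)
        also have "\<dots> = (\<Sum>s\<in>X. \<kappa> x s * (if r = s then 1 else 0))"
          using basis by (simp add: sum.reindex[OF inj\<beta>] inv_into_f_f[OF inj\<beta>])
        also have "\<dots> = \<kappa> x r" using supp[OF x, of r] X by (simp add: if_distrib sum.delta' cong: if_cong)
        finally show "\<kappa> x r = \<kappa> (\<Oplus>\<^bsub>M\<^esub>b\<in>\<beta> ` X. (?c b \<odot>\<^bsub>A\<^esub> \<one>\<^bsub>A\<^esub>) \<odot>\<^bsub>M\<^esub> b) r" by simp
      qed
    qed
  qed
  then show ?thesis unfolding finite_dimensional_def using X basis by (intro exI[of _ "\<beta> ` X"]) auto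
qed

section \<open>Change of the carrier type\<close>

lemma finite_dimensional_iso:
  assumes M: "right_module A M" and N: "right_module A N"
    and scal: "\<And>c. c \<odot>\<^bsub>A\<^esub> \<one>\<^bsub>A\<^esub> \<in> carrier A"
    and f: "f \<in> right_module_hom A M N" "inj_on f (carrier M)" "f ` carrier M = carrier N"
    and fd: "finite_dimensional A M"
  shows "finite_dimensional A N"
proof -
  interpret M: right_module A M by fact
  interpret N: right_module A N by fact
  note fD = right_module_homD[OF f(1)]
  obtain B where B: "finite B" "B \<subseteq> carrier M"
    "\<And>x. x \<in> carrier M \<Longrightarrow> \<exists>c. x = (\<Oplus>\<^bsub>M\<^esub>b\<in>B. (c b \<odot>\<^bsub>A\<^esub> \<one>\<^bsub>A\<^esub>) \<odot>\<^bsub>M\<^esub> b)"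
    using fd unfolding finite_dimensional_def by blast
  have injB: "inj_on f B" using f(2) B(2) inj_on_subset by blast
  have "\<exists>c. x = (\<Oplus>\<^bsub>N\<^esub>b\<in>f ` B. (c b \<odot>\<^bsub>A\<^esub> \<one>\<^bsub>A\<^esub>) \<odot>\<^bsub>N\<^esub> b)" if "x \<in> carrier N" for x
  proof -
    from that f(3) obtain m where m: "m \<in> carrier M" "x = f m" by blast
    obtain c where c: "m = (\<Oplus>\<^bsub>M\<^esub>b\<in>B. (c b \<odot>\<^bsub>A\<^esub> \<one>\<^bsub>A\<^esub>) \<odot>\<^bsub>M\<^esub> b)" using B(3) m(1) by blast
    have "x = (\<Oplus>\<^bsub>N\<^esub>b\<in>B. f ((c b \<odot>\<^bsub>A\<^esub> \<one>\<^bsub>A\<^esub>) \<odot>\<^bsub>M\<^esub> b))" unfolding m(2) c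
      using B scal M.smult_closed
      by (intro right_module_hom_finsum[OF f(1) M.M.abelian_group_axioms N.M.abelian_group_axioms]) auto
    also have "\<dots> = (\<Oplus>\<^bsub>N\<^esub>b\<in>B. (c (inv_into B f (f b)) \<odot>\<^bsub>A\<^esub> \<one>\<^bsub>A\<^esub>) \<odot>\<^bsub>N\<^esub> f b)"
      using B(2) scal fD N.smult_closed by (intro N.M.finsum_cong') (auto simp: inv_into_f_f[OF injB])
    also have "\<dots> = (\<Oplus>\<^bsub>N\<^esub>b\<in>f ` B. (c (inv_into B f b) \<odot>\<^bsub>A\<^esub> \<one>\<^bsub>A\<^esub>) \<odot>\<^bsub>N\<^esub> b)"
      using B(2) scal fD N.smult_closed by (intro N.M.finsum_reindex[OF _ injB, symmetric]) auto
    finally show ?thesis by (intro exI[of _ "\<lambda>b. c (inv_into B f b)"])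
  qed
  then show ?thesis unfolding finite_dimensional_def using B fD by (intro exI[of _ "f ` B"]) auto
qed

text \<open>Carries a module into the type \<open>std_module\<close>, over which
  \<open>injective_module\<close> and \<open>projective_module\<close> quantify. The ring fields
  \<open>mult\<close> and \<open>one\<close> have no meaning in a module.\<close>

definition transport_module :: "('m \<Rightarrow> 'n) \<Rightarrow> ('a, 'm) module \<Rightarrow> ('a, 'n) module" where
  "transport_module \<phi> M =
    \<lparr>carrier = \<phi> ` carrier M, mult = undefined, one = undefined, zero = \<phi> \<zero>\<^bsub>M\<^esub>,
     add = (\<lambda>x y. \<phi> (inv_into (carrier M) \<phi> x \<oplus>\<^bsub>M\<^esub> inv_into (carrier M) \<phi> y)),
     smult = (\<lambda>a x. \<phi> (a \<odot>\<^bsub>M\<^esub> inv_into (carrier M) \<phi> x))\<rparr>"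

lemma right_module_transport:
  assumes M: "right_module A M" and \<phi>: "inj_on \<phi> (carrier M)"
  shows "right_module A (transport_module \<phi> M)"
    and "\<phi> \<in> right_module_hom A M (transport_module \<phi> M)"
    and "inv_into (carrier M) \<phi> \<in> right_module_hom A (transport_module \<phi> M) M"
proof -
  interpret right_module A M by fact
  note inv = inv_into_f_f[OF \<phi>]
  have "abelian_group (transport_module \<phi> M)"
  proof (rule abelian_groupI)
    fix x assume "x \<in> carrier (transport_module \<phi> M)"
    then obtain m where m: "m \<in> carrier M" "x = \<phi> m" by (auto simp: transport_module_def)
    then show "\<exists>y\<in>carrier (transport_module \<phi> M). y \<oplus>\<^bsub>transport_module \<phi> M\<^esub> x = \<zero>\<^bsub>transport_module \<phi> M\<^esub>"
      by (intro bexI[of _ "\<phi> (\<ominus>\<^bsub>M\<^esub> m)"]) (auto simp: transport_module_def inv M.l_neg)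
  qed (auto simp: transport_module_def inv M.a_ac)
  then show "right_module A (transport_module \<phi> M)"
    using R.ring_axioms
    by (auto simp: right_module_def right_module_axioms_def transport_module_def inv
        smult_closed smult_l_distr smult_r_distr smult_assoc smult_one)
  show "\<phi> \<in> right_module_hom A M (transport_module \<phi> M)"
    by (rule right_module_homI) (auto simp: transport_module_def inv)
  show "inv_into (carrier M) \<phi> \<in> right_module_hom A (transport_module \<phi> M) M"
    by (rule right_module_homI) (auto simp: transport_module_def inv smult_closed)
qed

text \<open>The coefficients picked by \<open>SOME\<close> may fail to be linear in
  \<open>x\<close>. They determine \<open>x\<close>, and \<open>transport_module\<close> carries the
  structure along any injection.\<close>

lemma finite_dimensional_embedding:
  fixes A :: "('k::field, 'a) module" and M :: "('a, 'm) module"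
  assumes M: "right_module A M" "finite_dimensional A M"
    and scal: "\<And>c. c \<odot>\<^bsub>A\<^esub> \<one>\<^bsub>A\<^esub> \<in> carrier A"
  obtains \<phi> :: "'m \<Rightarrow> nat \<Rightarrow> 'k" where "inj_on \<phi> (carrier M)"
proof -
  interpret right_module A M by fact
  obtain B where B: "finite B" "B \<subseteq> carrier M"
    "\<And>x. x \<in> carrier M \<Longrightarrow> \<exists>c :: 'm \<Rightarrow> 'k. x = (\<Oplus>\<^bsub>M\<^esub>b\<in>B. (c b \<odot>\<^bsub>A\<^esub> \<one>\<^bsub>A\<^esub>) \<odot>\<^bsub>M\<^esub> b)"
    using M(2) unfolding finite_dimensional_def by blast
  define c :: "'m \<Rightarrow> 'm \<Rightarrow> 'k" where
    "c x = (SOME c. x = (\<Oplus>\<^bsub>M\<^esub>b\<in>B. (c b \<odot>\<^bsub>A\<^esub> \<one>\<^bsub>A\<^esub>) \<odot>\<^bsub>M\<^esub> b))" for x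
  have c: "x = (\<Oplus>\<^bsub>M\<^esub>b\<in>B. (c x b \<odot>\<^bsub>A\<^esub> \<one>\<^bsub>A\<^esub>) \<odot>\<^bsub>M\<^esub> b)" if "x \<in> carrier M" for x
    unfolding c_def by (rule someI_ex[OF B(3)[OF that]])
  obtain e :: "'m \<Rightarrow> nat" where e: "inj_on e B"
    using finite_imp_inj_to_nat_seg[OF B(1)] by blast
  have "inj_on (\<lambda>x i. if i \<in> e ` B then c x (inv_into B e i) else 0) (carrier M)"
  proof (rule inj_onI)
    fix x y assume xy: "x \<in> carrier M" "y \<in> carrier M"
      "(\<lambda>i. if i \<in> e ` B then c x (inv_into B e i) else 0) = (\<lambda>i. if i \<in> e ` B then c y (inv_into B e i) else 0)"
    have "c x b = c y b" if "b \<in> B" for b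
      using fun_cong[OF xy(3), of "e b"] that e by simp
    then have "(\<Oplus>\<^bsub>M\<^esub>b\<in>B. (c x b \<odot>\<^bsub>A\<^esub> \<one>\<^bsub>A\<^esub>) \<odot>\<^bsub>M\<^esub> b) = (\<Oplus>\<^bsub>M\<^esub>b\<in>B. (c y b \<odot>\<^bsub>A\<^esub> \<one>\<^bsub>A\<^esub>) \<odot>\<^bsub>M\<^esub> b)"
      using B(2) scal smult_closed by (intro M.finsum_cong') auto
    then show "x = y" using c[OF xy(1)] c[OF xy(2)] by simp
  qed
  then show ?thesis by (rule that)
qed

lemma std_module_copy:
  fixes A :: "('k::field, 'a) module" and M :: "('a, 'm) module"
  assumes M: "fd_right_module A M" and scal: "\<And>c. c \<odot>\<^bsub>A\<^esub> \<one>\<^bsub>A\<^esub> \<in> carrier A"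
  obtains M' :: "('k, 'a) std_module" and \<phi> \<psi> where "fd_right_module A M'"
    "\<phi> \<in> right_module_hom A M M'" "\<psi> \<in> right_module_hom A M' M"
    "\<And>x. x \<in> carrier M \<Longrightarrow> \<psi> (\<phi> x) = x" "\<And>x. x \<in> carrier M' \<Longrightarrow> \<phi> (\<psi> x) = x"
proof -
  obtain \<phi> :: "'m \<Rightarrow> nat \<Rightarrow> 'k" where \<phi>: "inj_on \<phi> (carrier M)"
    using finite_dimensional_embedding[of A M] M scal by (auto simp: fd_right_module_def)
  have rM: "right_module A M" and fM: "finite_dimensional A M" using M by (auto simp: fd_right_module_def)
  note t = right_module_transport[OF rM \<phi>]
  have "\<phi> ` carrier M = carrier (transport_module \<phi> M)" by (simp add: transport_module_def)
  from finite_dimensional_iso[OF rM t(1) scal t(2) \<phi> this fM]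
  have "fd_right_module A (transport_module \<phi> M)" using t(1) by (simp add: fd_right_module_def)
  then show ?thesis by (rule that[OF _ t(2,3)]) (auto simp: transport_module_def \<phi>)
qed

text \<open>Conjugation with standard copies of \<open>M\<close> and \<open>N\<close> frees the
  extension property from the type fixed in its definition.\<close>

lemma injective_extend:
  fixes A :: "('k::field, 'a) module" and M :: "('a, 'm) module" and N :: "('a, 'n) module"
  assumes E: "injective_module A E" and scal: "\<And>c. c \<odot>\<^bsub>A\<^esub> \<one>\<^bsub>A\<^esub> \<in> carrier A"
    and M: "fd_right_module A M" and N: "fd_right_module A N"
    and g: "g \<in> right_module_hom A M N" "inj_on g (carrier M)" and f: "f \<in> right_module_hom A M E"
  obtains h where "h \<in> right_module_hom A N E" "\<And>x. x \<in> carrier M \<Longrightarrow> h (g x) = f x"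
proof -
  obtain M' :: "('k, 'a) std_module" and \<phi> \<psi> where M': "fd_right_module A M'"
    "\<phi> \<in> right_module_hom A M M'" "\<psi> \<in> right_module_hom A M' M"
    "\<And>x. x \<in> carrier M \<Longrightarrow> \<psi> (\<phi> x) = x" "\<And>x. x \<in> carrier M' \<Longrightarrow> \<phi> (\<psi> x) = x"
    using std_module_copy[OF M scal] by metis
  obtain N' :: "('k, 'a) std_module" and \<phi>' \<psi>' where N': "fd_right_module A N'"
    "\<phi>' \<in> right_module_hom A N N'" "\<psi>' \<in> right_module_hom A N' N"
    "\<And>x. x \<in> carrier N \<Longrightarrow> \<psi>' (\<phi>' x) = x" "\<And>x. x \<in> carrier N' \<Longrightarrow> \<phi>' (\<psi>' x) = x"
    using std_module_copy[OF N scal] by metis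
  let ?g = "\<lambda>x. \<phi>' (g (\<psi> x))"
  have "?g \<in> right_module_hom A M' N'"
    using right_module_hom_compose[OF right_module_hom_compose[OF M'(3) g(1)] N'(2)] .
  moreover have "inj_on ?g (carrier M')"
  proof (rule inj_onI)
    fix x y assume xy: "x \<in> carrier M'" "y \<in> carrier M'" "?g x = ?g y"
    then have "g (\<psi> x) = g (\<psi> y)"
      using N'(4) right_module_homD(1)[OF g(1)] right_module_homD(1)[OF M'(3)] by metis
    then have "\<psi> x = \<psi> y" using g(2) right_module_homD(1)[OF M'(3)] xy by (simp add: inj_on_def)
    then show "x = y" using M'(5) xy by metis
  qed
  ultimately obtain h where h: "h \<in> right_module_hom A N' E" "\<And>x. x \<in> carrier M' \<Longrightarrow> h (?g x) = f (\<psi> x)"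
    using E M'(1) N'(1) right_module_hom_compose[OF M'(3) f] unfolding injective_module_def by metis
  show ?thesis
  proof (rule that[OF right_module_hom_compose[OF N'(2) h(1)]])
    fix x assume "x \<in> carrier M"
    then show "h (\<phi>' (g x)) = f x" using h(2)[of "\<phi> x"] M'(4) right_module_homD(1)[OF M'(2)] by simp
  qed
qed

text \<open>The lifting property for the identity of \<open>P\<close>, again through a standard copy
  of \<open>M\<close>.\<close>

lemma projective_split:
  fixes A :: "('k::field, 'a) module" and P :: "('k, 'a) std_module" and M :: "('a, 'm) module"
  assumes P: "projective_module A P" and scal: "\<And>c. c \<odot>\<^bsub>A\<^esub> \<one>\<^bsub>A\<^esub> \<in> carrier A"
    and M: "fd_right_module A M" and g: "g \<in> right_module_hom A M P" "g ` carrier M = carrier P"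
  obtains h where "h \<in> right_module_hom A P M" "\<And>x. x \<in> carrier P \<Longrightarrow> g (h x) = x"
proof -
  obtain M' :: "('k, 'a) std_module" and \<phi> \<psi> where M': "fd_right_module A M'"
    "\<phi> \<in> right_module_hom A M M'" "\<psi> \<in> right_module_hom A M' M"
    "\<And>x. x \<in> carrier M \<Longrightarrow> \<psi> (\<phi> x) = x" "\<And>x. x \<in> carrier M' \<Longrightarrow> \<phi> (\<psi> x) = x"
    using std_module_copy[OF M scal] by metis
  have "(\<lambda>x. g (\<psi> x)) ` carrier M' = carrier P"
  proof -
    have "\<psi> ` carrier M' = carrier M"
      using right_module_homD(1)[OF M'(2)] right_module_homD(1)[OF M'(3)] M'(4) by force
    then show ?thesis using g(2) by (metis image_image)
  qed
  moreover have "(\<lambda>x. x) \<in> right_module_hom A P P" by (rule right_module_homI) auto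
  ultimately obtain h where h: "h \<in> right_module_hom A P M'" "\<And>x. x \<in> carrier P \<Longrightarrow> g (\<psi> (h x)) = x"
    using P M'(1) right_module_hom_compose[OF M'(3) g(1)] unfolding projective_module_def by metis
  then show ?thesis using that[OF right_module_hom_compose[OF h(1) M'(3)]] by blast
qed

section \<open>Algebras with a basis of paths\<close>

lemma (in right_module) finsum_smult_right:
  assumes "finite S" "\<And>i. i \<in> S \<Longrightarrow> g i \<in> carrier M" "a \<in> carrier R"
  shows "a \<odot>\<^bsub>M\<^esub> (\<Oplus>\<^bsub>M\<^esub>i\<in>S. g i) = (\<Oplus>\<^bsub>M\<^esub>i\<in>S. a \<odot>\<^bsub>M\<^esub> g i)"
  using assms
proof (induction S rule: finite_induct)
  case empty
  then show ?case by (simp add: smult_zero_right)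
next
  case (insert i S)
  have "g \<in> S \<rightarrow> carrier M" "g i \<in> carrier M"
    "(\<lambda>i. a \<odot>\<^bsub>M\<^esub> g i) \<in> S \<rightarrow> carrier M" "a \<odot>\<^bsub>M\<^esub> g i \<in> carrier M"
    using insert.prems smult_closed by auto
  with insert show ?case by (simp add: smult_r_distr)
qed

text \<open>Negatives in \<open>H\<close> come from the action of minus one.\<close>

lemma (in right_module) right_module_restrict:
  assumes "H \<subseteq> carrier M" "\<zero>\<^bsub>M\<^esub> \<in> H" "\<And>x y. \<lbrakk>x \<in> H; y \<in> H\<rbrakk> \<Longrightarrow> x \<oplus>\<^bsub>M\<^esub> y \<in> H"
    and sm: "\<And>a x. \<lbrakk>a \<in> carrier R; x \<in> H\<rbrakk> \<Longrightarrow> a \<odot>\<^bsub>M\<^esub> x \<in> H"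
  shows "right_module R (M\<lparr>carrier := H\<rparr>)"
proof -
  have H: "x \<in> carrier M" if "x \<in> H" for x using that assms(1) by blast
  have "abelian_group (M\<lparr>carrier := H\<rparr>)"
  proof (rule abelian_groupI)
    fix x assume "x \<in> carrier (M\<lparr>carrier := H\<rparr>)"
    then have x: "x \<in> H" by simp
    have "(\<ominus>\<^bsub>R\<^esub> \<one>\<^bsub>R\<^esub>) \<odot>\<^bsub>M\<^esub> x \<oplus>\<^bsub>M\<^esub> x = (\<ominus>\<^bsub>R\<^esub> \<one>\<^bsub>R\<^esub>) \<odot>\<^bsub>M\<^esub> x \<oplus>\<^bsub>M\<^esub> \<one>\<^bsub>R\<^esub> \<odot>\<^bsub>M\<^esub> x"
      using smult_one H[OF x] by simp
    also have "\<dots> = \<zero>\<^bsub>M\<^esub>"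
      using smult_l_distr[of "\<ominus>\<^bsub>R\<^esub> \<one>\<^bsub>R\<^esub>" "\<one>\<^bsub>R\<^esub>" x] H[OF x] by (simp add: smult_zero_left R.l_neg)
    finally show "\<exists>y\<in>carrier (M\<lparr>carrier := H\<rparr>). y \<oplus>\<^bsub>M\<lparr>carrier := H\<rparr>\<^esub> x = \<zero>\<^bsub>M\<lparr>carrier := H\<rparr>\<^esub>"
      using sm[of "\<ominus>\<^bsub>R\<^esub> \<one>\<^bsub>R\<^esub>" x] x by (intro bexI[of _ "(\<ominus>\<^bsub>R\<^esub> \<one>\<^bsub>R\<^esub>) \<odot>\<^bsub>M\<^esub> x"]) auto
  qed (use assms H in \<open>auto simp: M.a_ac\<close>)
  then show ?thesis
    using R.ring_axioms H sm
    by (auto simp: right_module_def right_module_axioms_def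
        smult_closed smult_l_distr smult_r_distr smult_assoc smult_one)
qed

lemma regular_module_simps [simp]:
  "carrier (regular_module A) = carrier A" "add (regular_module A) = add A"
  "zero (regular_module A) = zero A" "a \<odot>\<^bsub>regular_module A\<^esub> x = x \<otimes>\<^bsub>A\<^esub> a"
  by (auto simp: regular_module_def)

text \<open>
  \<open>cf x r\<close> is the coefficient of \<open>x\<close> at the basis path \<open>r\<close>; the structure constants are
  those of a monomial algebra whose nonzero paths are the elements of \<open>N\<close>.
\<close>

locale path_basis_algebra = nonzero_paths Q N
  for Q :: "('v, 'e) pre_digraph" and N :: "('v \<times> 'e list) set" +
  fixes A :: "('k::field, 'a) module" and cf :: "'a \<Rightarrow> 'v \<times> 'e list \<Rightarrow> 'k"
  assumes ring_A: "ring A"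
    and cf_support: "\<lbrakk>x \<in> carrier A; r \<notin> N\<rbrakk> \<Longrightarrow> cf x r = 0"
    and cf_inj: "\<lbrakk>x \<in> carrier A; y \<in> carrier A; cf x = cf y\<rbrakk> \<Longrightarrow> x = y"
    and cf_surj: "(\<And>r. r \<notin> N \<Longrightarrow> f r = 0) \<Longrightarrow> \<exists>x\<in>carrier A. cf x = f"
    and cf_add: "\<lbrakk>x \<in> carrier A; y \<in> carrier A\<rbrakk> \<Longrightarrow> cf (x \<oplus>\<^bsub>A\<^esub> y) r = cf x r + cf y r"
    and cf_mult: "\<lbrakk>x \<in> carrier A; y \<in> carrier A; (u, p) \<in> N\<rbrakk> \<Longrightarrow> cf (x \<otimes>\<^bsub>A\<^esub> y) (u, p) =
        (\<Sum>i\<le>length p. cf x (u, take i p) * cf y (target Q u (take i p), drop i p))"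
    and cf_one: "cf \<one>\<^bsub>A\<^esub> (u, p) = (if u \<in> verts Q \<and> p = [] then 1 else 0)"
    and scalar_closed: "c \<odot>\<^bsub>A\<^esub> \<one>\<^bsub>A\<^esub> \<in> carrier A"
    and cf_scalar: "cf (c \<odot>\<^bsub>A\<^esub> \<one>\<^bsub>A\<^esub>) r = c * cf \<one>\<^bsub>A\<^esub> r"
begin

sublocale A: ring A by (rule ring_A)

abbreviation scalar :: "'k \<Rightarrow> 'a" where "scalar c \<equiv> c \<odot>\<^bsub>A\<^esub> \<one>\<^bsub>A\<^esub>"

lemma right_module_A: "right_module A (regular_module A)"
  by (rule right_module_regular[OF ring_A])

lemma finsum_regular_module:
  assumes "finite S" "\<And>i. i \<in> S \<Longrightarrow> g i \<in> carrier A"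
  shows "(\<Oplus>\<^bsub>regular_module A\<^esub>i\<in>S. g i) = (\<Oplus>\<^bsub>A\<^esub>i\<in>S. g i)"
proof -
  interpret R: right_module A "regular_module A" by (rule right_module_A)
  from assms show ?thesis
  proof (induction S rule: finite_induct)
    case empty
    then show ?case by simp
  next
    case (insert i S)
    then have "g \<in> S \<rightarrow> carrier A" "g i \<in> carrier A" by auto
    with insert show ?case by simp
  qed
qed

lemma cf_eqI:
  assumes "x \<in> carrier A" "y \<in> carrier A" "\<And>u p. (u, p) \<in> N \<Longrightarrow> cf x (u, p) = cf y (u, p)"
  shows "x = y"
proof (rule cf_inj[OF assms(1,2)], rule ext)
  fix r show "cf x r = cf y r"
    using assms cf_support by (cases r; cases "r \<in> N") auto
qed

lemma cf_zero: "cf \<zero>\<^bsub>A\<^esub> r = 0"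
proof -
  have "cf \<zero>\<^bsub>A\<^esub> r = cf \<zero>\<^bsub>A\<^esub> r + cf \<zero>\<^bsub>A\<^esub> r" using cf_add[of "\<zero>\<^bsub>A\<^esub>" "\<zero>\<^bsub>A\<^esub>" r] by (simp only: A.zero_closed A.l_zero)
  then show ?thesis by (simp only: add_cancel_right_right)
qed

lemma cf_finsum:
  assumes "finite S" "\<And>i. i \<in> S \<Longrightarrow> g i \<in> carrier A"
  shows "cf (\<Oplus>\<^bsub>A\<^esub>i\<in>S. g i) r = (\<Sum>i\<in>S. cf (g i) r)"
  using assms
proof (induction S rule: finite_induct)
  case empty
  then show ?case by (simp add: cf_zero)
next
  case (insert i S)
  then have "g \<in> S \<rightarrow> carrier A" "g i \<in> carrier A" by auto
  with insert show ?case by (simp add: cf_add)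
qed

lemma cf_minus:
  assumes "x \<in> carrier A" "y \<in> carrier A"
  shows "cf (x \<ominus>\<^bsub>A\<^esub> y) r = cf x r - cf y r"
  using cf_add[of "x \<ominus>\<^bsub>A\<^esub> y" y r] assms by (simp add: A.minus_eq A.a_assoc A.l_neg)

definition elt :: "('v \<times> 'e list \<Rightarrow> 'k) \<Rightarrow> 'a" where
  "elt f = (SOME x. x \<in> carrier A \<and> cf x = f)"

lemma elt:
  assumes "\<And>r. r \<notin> N \<Longrightarrow> f r = 0"
  shows "elt f \<in> carrier A" "cf (elt f) = f"
proof -
  have "elt f \<in> carrier A \<and> cf (elt f) = f"
    unfolding elt_def by (rule someI_ex[of "\<lambda>x. x \<in> carrier A \<and> cf x = f"])
      (use cf_surj[of f, OF assms] in auto)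
  then show "elt f \<in> carrier A" "cf (elt f) = f" by auto
qed

definition pe :: "'v \<Rightarrow> 'e list \<Rightarrow> 'a" where
  "pe u p = elt (\<lambda>s. if s = (u, p) \<and> (u, p) \<in> N then 1 else 0)"

lemma pe_closed [simp]: "pe u p \<in> carrier A"
  and cf_pe: "cf (pe u p) s = (if s = (u, p) \<and> (u, p) \<in> N then 1 else 0)"
proof -
  have *: "(if s = (u, p) \<and> (u, p) \<in> N then 1 else 0) = 0" if "s \<notin> N" for s using that by auto
  show "pe u p \<in> carrier A" unfolding pe_def by (rule elt) (rule *)
  show "cf (pe u p) s = (if s = (u, p) \<and> (u, p) \<in> N then 1 else 0)"
    unfolding pe_def by (subst elt(2)) (rule *, auto)
qed

lemma pe_zero: "(u, p) \<notin> N \<Longrightarrow> pe u p = \<zero>\<^bsub>A\<^esub>"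
  by (rule cf_eqI) (auto simp: cf_pe cf_zero)

text \<open>Of all factorizations only the one that cuts after \<open>p\<close> contributes.
  Together with \<open>cf_mult_pe_nonzero\<close> this lets products with paths be recognized by
  their ends, on which all later comparisons of arrows rest.\<close>

lemma cf_mult_pe:
  assumes x: "x \<in> carrier A" and "(u, p @ q) \<in> N"
  shows "cf (x \<otimes>\<^bsub>A\<^esub> pe (target Q u p) q) (u, p @ q) = cf x (u, p)"
proof -
  have n: "(target Q u p, q) \<in> N" using N_suffix assms by blast
  have "cf (x \<otimes>\<^bsub>A\<^esub> pe (target Q u p) q) (u, p @ q) =
      (\<Sum>i\<le>length (p @ q). if i = length p then cf x (u, take i (p @ q)) else 0)"
    unfolding cf_mult[OF x pe_closed assms(2)]
  proof (intro sum.cong refl)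
    fix i assume i: "i \<in> {..length (p @ q)}"
    have "i = length p" if "drop i (p @ q) = q"
    proof -
      have "length (p @ q) - i = length q" using arg_cong[OF that, of length] by (simp only: length_drop)
      with i show ?thesis by simp
    qed
    then show "cf x (u, take i (p @ q)) * cf (pe (target Q u p) q) (target Q u (take i (p @ q)), drop i (p @ q)) =
        (if i = length p then cf x (u, take i (p @ q)) else 0)"
      using n by (auto simp: cf_pe)
  qed
  then show ?thesis by simp
qed

lemma cf_mult_pe_nonzero:
  assumes x: "x \<in> carrier A" and nz: "cf (x \<otimes>\<^bsub>A\<^esub> pe v q) (u, r) \<noteq> 0"
  obtains p where "r = p @ q" "target Q u p = v" "(u, p @ q) \<in> N" "cf x (u, p) \<noteq> 0"
proof -
  have N: "(u, r) \<in> N" using nz cf_support x pe_closed A.m_closed by blast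
  obtain i where "i \<le> length r" "cf x (u, take i r) * cf (pe v q) (target Q u (take i r), drop i r) \<noteq> 0"
    using nz unfolding cf_mult[OF x pe_closed N] by (auto elim: sum.not_neutral_contains_not_neutral)
  then have i: "cf x (u, take i r) \<noteq> 0" "target Q u (take i r) = v" "drop i r = q"
    by (auto simp: cf_pe split: if_splits)
  then have "r = take i r @ q" using append_take_drop_id[of i r] by simp
  then show ?thesis using that[of "take i r"] i N by simp
qed

lemma pe_mult: "pe u p \<otimes>\<^bsub>A\<^esub> pe v q = (if v = target Q u p then pe u (p @ q) else \<zero>\<^bsub>A\<^esub>)"
proof (rule cf_eqI)
  fix w r assume "(w, r) \<in> N"
  show "cf (pe u p \<otimes>\<^bsub>A\<^esub> pe v q) (w, r) = cf (if v = target Q u p then pe u (p @ q) else \<zero>\<^bsub>A\<^esub>) (w, r)"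
  proof (cases "w = u \<and> r = p @ q \<and> v = target Q u p")
    case True
    then show ?thesis using \<open>(w, r) \<in> N\<close> cf_mult_pe[of "pe u p" u p q] N_prefix by (auto simp: cf_pe)
  next
    case False
    have "cf (pe u p \<otimes>\<^bsub>A\<^esub> pe v q) (w, r) = 0"
    proof (rule ccontr)
      assume "cf (pe u p \<otimes>\<^bsub>A\<^esub> pe v q) (w, r) \<noteq> 0"
      then obtain p' where "r = p' @ q" "target Q w p' = v" "cf (pe u p) (w, p') \<noteq> 0"
        using cf_mult_pe_nonzero[OF pe_closed] by metis
      then show False using False by (auto simp: cf_pe split: if_splits)
    qed
    then show ?thesis using False by (auto simp: cf_pe cf_zero)
  qed
qed auto

lemma cf_mult_scalar:
  assumes x: "x \<in> carrier A"
  shows "cf (x \<otimes>\<^bsub>A\<^esub> scalar c) r = c * cf x r"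
proof (cases "r \<in> N")
  case True
  obtain u p where r: "r = (u, p)" by fastforce
  have "cf (x \<otimes>\<^bsub>A\<^esub> scalar c) (u, p) = (\<Sum>i\<le>length p. if i = length p then c * cf x (u, take i p) else 0)"
    unfolding cf_mult[OF x scalar_closed True[unfolded r]]
    using N_target True[unfolded r] by (intro sum.cong refl) (auto simp: cf_scalar cf_one)
  then show ?thesis by (simp add: r)
next
  case False
  then show ?thesis using cf_support[of _ r] x scalar_closed by simp
qed

lemma cf_scalar_mult:
  assumes x: "x \<in> carrier A"
  shows "cf (scalar c \<otimes>\<^bsub>A\<^esub> x) r = c * cf x r"
proof (cases "r \<in> N")
  case True
  obtain u p where r: "r = (u, p)" by fastforce
  have "cf (scalar c \<otimes>\<^bsub>A\<^esub> x) (u, p) = (\<Sum>i\<le>length p. if i = 0 then c * cf x (u, p) else 0)"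
    unfolding cf_mult[OF scalar_closed x True[unfolded r]]
    using N_verts True[unfolded r] by (intro sum.cong refl) (auto simp: cf_scalar cf_one)
  then show ?thesis by (simp add: r)
next
  case False
  then show ?thesis using cf_support[of _ r] x scalar_closed by simp
qed

lemma scalar_add: "scalar (c + d) = scalar c \<oplus>\<^bsub>A\<^esub> scalar d"
  by (rule cf_eqI) (auto simp: scalar_closed cf_add cf_scalar algebra_simps)

lemma scalar_one: "scalar 1 = \<one>\<^bsub>A\<^esub>"
  by (rule cf_eqI) (auto simp: scalar_closed cf_scalar)

lemma expansion:
  assumes x: "x \<in> carrier A"
  shows "x = (\<Oplus>\<^bsub>A\<^esub>r\<in>N. pe (fst r) (snd r) \<otimes>\<^bsub>A\<^esub> scalar (cf x r))"
proof (rule cf_eqI[OF x])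
  show "(\<Oplus>\<^bsub>A\<^esub>r\<in>N. pe (fst r) (snd r) \<otimes>\<^bsub>A\<^esub> scalar (cf x r)) \<in> carrier A"
    by (intro A.finsum_closed) (auto simp: scalar_closed)
  fix u p assume "(u, p) \<in> N"
  then show "cf x (u, p) = cf (\<Oplus>\<^bsub>A\<^esub>r\<in>N. pe (fst r) (snd r) \<otimes>\<^bsub>A\<^esub> scalar (cf x r)) (u, p)"
    using finite_N
    by (subst cf_finsum) (auto simp: scalar_closed cf_mult_scalar cf_pe if_distrib cong: if_cong)
qed

lemma cf_mult_expansion:
  assumes x: "x \<in> carrier A" and a: "a \<in> carrier A"
  shows "cf (a \<otimes>\<^bsub>A\<^esub> x) s = (\<Sum>r\<in>N. cf x r * cf (a \<otimes>\<^bsub>A\<^esub> pe (fst r) (snd r)) s)"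
proof -
  have "a \<otimes>\<^bsub>A\<^esub> x = (\<Oplus>\<^bsub>A\<^esub>r\<in>N. a \<otimes>\<^bsub>A\<^esub> (pe (fst r) (snd r) \<otimes>\<^bsub>A\<^esub> scalar (cf x r)))"
    using A.finsum_rdistr[OF finite_N a, of "\<lambda>r. pe (fst r) (snd r) \<otimes>\<^bsub>A\<^esub> scalar (cf x r)"]
      expansion[OF x] by (simp add: scalar_closed)
  then show ?thesis using finite_N a
    by (simp add: cf_finsum scalar_closed cf_mult_scalar A.m_assoc[symmetric])
qed

section \<open>The dual of the regular module and dual families of paths\<close>

definition dual_eval :: "('v \<times> 'e list \<Rightarrow> 'k) \<Rightarrow> 'a \<Rightarrow> 'k" where
  "dual_eval f x = (\<Sum>s\<in>N. f s * cf x s)"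

text \<open>The injective cogenerator \<open>Hom\<^sub>k(A, k)\<close>, with functionals given by their values on \<open>N\<close>.\<close>

definition dual_module :: "('a, 'v \<times> 'e list \<Rightarrow> 'k) module" where
  "dual_module =
    \<lparr>carrier = {f. \<forall>r. r \<notin> N \<longrightarrow> f r = 0}, mult = undefined, one = undefined, zero = (\<lambda>_. 0),
     add = (\<lambda>f g r. f r + g r),
     smult = (\<lambda>a f r. if r \<in> N then dual_eval f (a \<otimes>\<^bsub>A\<^esub> pe (fst r) (snd r)) else 0)\<rparr>"

text \<open>The usual right action \<open>(f a)(x) = f (a x)\<close> on functionals, which
  \<open>dual_module\<close> prescribes on basis paths only.\<close>

lemma dual_eval_smult:
  assumes "x \<in> carrier A" "a \<in> carrier A"
  shows "dual_eval (a \<odot>\<^bsub>dual_module\<^esub> f) x = dual_eval f (a \<otimes>\<^bsub>A\<^esub> x)"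
proof -
  have "dual_eval (a \<odot>\<^bsub>dual_module\<^esub> f) x =
      (\<Sum>r\<in>N. \<Sum>s\<in>N. f s * cf (a \<otimes>\<^bsub>A\<^esub> pe (fst r) (snd r)) s * cf x r)"
    by (simp add: dual_eval_def dual_module_def sum_distrib_right cong: sum.cong)
  also have "\<dots> = (\<Sum>s\<in>N. \<Sum>r\<in>N. f s * cf (a \<otimes>\<^bsub>A\<^esub> pe (fst r) (snd r)) s * cf x r)"
    by (rule sum.swap)
  also have "\<dots> = dual_eval f (a \<otimes>\<^bsub>A\<^esub> x)"
    unfolding dual_eval_def cf_mult_expansion[OF assms] sum_distrib_left
    by (intro sum.cong refl) (simp add: mult_ac)
  finally show ?thesis .
qed

lemma dual_eval_pe: "(u, p) \<in> N \<Longrightarrow> dual_eval f (pe u p) = f (u, p)"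
  using finite_N by (simp add: dual_eval_def cf_pe if_distrib cong: if_cong)

lemma right_module_dual: "right_module A dual_module"
proof -
  have "abelian_group dual_module"
  proof (rule abelian_groupI)
    fix f assume "f \<in> carrier dual_module"
    then show "\<exists>g\<in>carrier dual_module. g \<oplus>\<^bsub>dual_module\<^esub> f = \<zero>\<^bsub>dual_module\<^esub>"
      by (intro bexI[of _ "\<lambda>r. - f r"]) (auto simp: dual_module_def)
  qed (auto simp: dual_module_def add_ac)
  moreover have "(a \<otimes>\<^bsub>A\<^esub> b) \<odot>\<^bsub>dual_module\<^esub> f = b \<odot>\<^bsub>dual_module\<^esub> (a \<odot>\<^bsub>dual_module\<^esub> f)"
    if "a \<in> carrier A" "b \<in> carrier A" for a b f
  proof
    fix r show "((a \<otimes>\<^bsub>A\<^esub> b) \<odot>\<^bsub>dual_module\<^esub> f) r = (b \<odot>\<^bsub>dual_module\<^esub> (a \<odot>\<^bsub>dual_module\<^esub> f)) r"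
      using dual_eval_smult[of "b \<otimes>\<^bsub>A\<^esub> pe (fst r) (snd r)" a f] that
      by (simp add: dual_module_def A.m_assoc)
  qed
  moreover have "\<one>\<^bsub>A\<^esub> \<odot>\<^bsub>dual_module\<^esub> f = f" if "f \<in> carrier dual_module" for f
    using that by (auto simp: dual_module_def fun_eq_iff dual_eval_pe)
  ultimately show ?thesis
    using ring_A by (auto simp: right_module_def right_module_axioms_def dual_module_def dual_eval_def
        fun_eq_iff A.l_distr cf_add algebra_simps sum.distrib)
qed

lemma dual_scalar:
  assumes "f \<in> carrier dual_module" shows "(scalar c \<odot>\<^bsub>dual_module\<^esub> f) r = c * f r"
proof -
  have "dual_eval f (scalar c \<otimes>\<^bsub>A\<^esub> x) = c * dual_eval f x" if "x \<in> carrier A" for x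
    using that by (simp add: dual_eval_def cf_scalar_mult sum_distrib_left mult_ac)
  then show ?thesis using assms by (cases r) (auto simp: dual_module_def dual_eval_pe)
qed

lemma fd_dual: "fd_right_module A dual_module"
  unfolding fd_right_module_def
  by (intro conjI right_module_dual
      finite_dimensional_coordinatesI[where \<kappa> = "\<lambda>f. f" and X = N and \<beta> = "\<lambda>r s. if s = r then 1 else 0"])
    (auto simp: right_module_dual finite_N scalar_closed dual_scalar, auto simp: dual_module_def)

text \<open>For a vertex \<open>y\<close> this is the simple submodule at \<open>y\<close>, spanned
  by the functional dual to the trivial path.\<close>

definition dual_socle :: "'v \<Rightarrow> ('a, 'v \<times> 'e list \<Rightarrow> 'k) module" where
  "dual_socle y = dual_module\<lparr>carrier := {f. \<forall>r. r \<noteq> (y, []) \<longrightarrow> f r = 0}\<rparr>"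

lemma dual_socle_subset:
  assumes "y \<in> verts Q" shows "carrier (dual_socle y) \<subseteq> carrier dual_module"
proof
  fix f assume f: "f \<in> carrier (dual_socle y)"
  have "f r = 0" if "r \<notin> N" for r
  proof -
    have "r \<noteq> (y, [])" using that trivial_in_N assms by blast
    then show ?thesis using f by (cases r) (simp add: dual_socle_def)
  qed
  then show "f \<in> carrier dual_module" by (simp add: dual_module_def)
qed

lemma dual_socle_smult:
  assumes "y \<in> verts Q" "a \<in> carrier A" "f \<in> carrier (dual_socle y)"
  shows "(a \<odot>\<^bsub>dual_module\<^esub> f) r = (if r = (y, []) then cf a (y, []) * f (y, []) else 0)"
proof -
  obtain u p where r: "r = (u, p)" by fastforce
  have N: "(y, []) \<in> N" using trivial_in_N assms by blast
  have "dual_eval f x = f (y, []) * cf x (y, [])" for x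
  proof -
    have "dual_eval f x = (\<Sum>s\<in>N. if s = (y, []) then f (y, []) * cf x (y, []) else 0)"
      unfolding dual_eval_def using assms(3) by (intro sum.cong refl) (auto simp: dual_socle_def)
    then show ?thesis using finite_N N by simp
  qed
  moreover have "cf (a \<otimes>\<^bsub>A\<^esub> pe u p) (y, []) = (if r = (y, []) then cf a (y, []) else 0)"
  proof (cases "r = (y, [])")
    case True
    then show ?thesis using cf_mult_pe[OF assms(2), of y "[]" "[]"] N r by simp
  next
    case False
    then show ?thesis using cf_mult_pe_nonzero[OF assms(2), of u p y "[]"] r by force
  qed
  ultimately show ?thesis using N r by (auto simp: dual_module_def)
qed

lemma fd_dual_socle:
  assumes "y \<in> verts Q" shows "fd_right_module A (dual_socle y)"
proof -
  interpret D: right_module A dual_module by (rule right_module_dual)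
  have N: "(y, []) \<in> N" using trivial_in_N assms by blast
  have "right_module A (dual_socle y)" unfolding dual_socle_def
  proof (rule D.right_module_restrict)
    fix a and f :: "'v \<times> 'e list \<Rightarrow> 'k"
    assume "a \<in> carrier A" "f \<in> {f. \<forall>r. r \<noteq> (y, []) \<longrightarrow> f r = 0}"
    then show "a \<odot>\<^bsub>dual_module\<^esub> f \<in> {f. \<forall>r. r \<noteq> (y, []) \<longrightarrow> f r = 0}"
      using dual_socle_smult[OF assms, of a f] by (simp add: dual_socle_def)
  qed (use dual_socle_subset[OF assms] in \<open>auto simp: dual_module_def dual_socle_def\<close>)
  moreover from this have "finite_dimensional A (dual_socle y)"
  proof (rule finite_dimensional_coordinatesI[where \<kappa> = "\<lambda>f. f" and X = "{(y, [])}" and \<beta> = "\<lambda>r s. if s = r then 1 else 0"])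
    fix c f r assume "f \<in> carrier (dual_socle y)"
    then show "(scalar c \<odot>\<^bsub>dual_socle y\<^esub> f) r = c * f r"
      using dual_scalar[of f c r] dual_socle_subset[OF assms] by (auto simp: dual_socle_def)
  qed (auto simp: scalar_closed, auto simp: dual_socle_def dual_module_def)
  ultimately show ?thesis by (simp add: fd_right_module_def)
qed

text \<open>All basis paths except the trivial one at \<open>y\<close> kill \<open>\<sigma>\<close>:
  the other trivial paths are orthogonal to it, and a longer path begins with an arrow.\<close>

lemma socle_act:
  assumes "right_module A E" and y: "y \<in> verts Q" and \<sigma>: "\<sigma> \<in> carrier E" "pe y [] \<odot>\<^bsub>E\<^esub> \<sigma> = \<sigma>"
    and soc: "\<And>b. b \<in> arcs Q \<Longrightarrow> pe (tail Q b) [b] \<odot>\<^bsub>E\<^esub> \<sigma> = \<zero>\<^bsub>E\<^esub>"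
    and a: "a \<in> carrier A"
  shows "a \<odot>\<^bsub>E\<^esub> \<sigma> = scalar (cf a (y, [])) \<odot>\<^bsub>E\<^esub> \<sigma>"
proof -
  interpret E: right_module A E by fact
  have N: "(y, []) \<in> N" using trivial_in_N y by blast
  have zero: "pe u p \<odot>\<^bsub>E\<^esub> \<sigma> = \<zero>\<^bsub>E\<^esub>" if up: "(u, p) \<in> N" "(u, p) \<noteq> (y, [])" for u p
  proof (cases p)
    case Nil
    then have "pe u p \<odot>\<^bsub>E\<^esub> (pe y [] \<odot>\<^bsub>E\<^esub> \<sigma>) = \<zero>\<^bsub>A\<^esub> \<odot>\<^bsub>E\<^esub> \<sigma>"
      using up \<sigma>(1) E.smult_assoc[of "pe y []" "pe u p" \<sigma>] by (simp add: pe_mult)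
    then show ?thesis using \<sigma> E.smult_zero_left by simp
  next
    case (Cons b q)
    with up have b: "u = tail Q b" "b \<in> arcs Q" using N_Cons by blast+
    have "pe u p = pe u [b] \<otimes>\<^bsub>A\<^esub> pe (head Q b) q" using Cons by (simp add: pe_mult)
    then have "pe u p \<odot>\<^bsub>E\<^esub> \<sigma> = pe (head Q b) q \<odot>\<^bsub>E\<^esub> (pe u [b] \<odot>\<^bsub>E\<^esub> \<sigma>)"
      using \<sigma>(1) by (simp add: E.smult_assoc)
    then show ?thesis using soc b by (simp add: E.smult_zero_right)
  qed
  have "a \<odot>\<^bsub>E\<^esub> \<sigma> = (\<Oplus>\<^bsub>A\<^esub>r\<in>N. pe (fst r) (snd r) \<otimes>\<^bsub>A\<^esub> scalar (cf a r)) \<odot>\<^bsub>E\<^esub> \<sigma>"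
    using expansion[OF a] by simp
  also have "\<dots> = (\<Oplus>\<^bsub>E\<^esub>r\<in>N. (pe (fst r) (snd r) \<otimes>\<^bsub>A\<^esub> scalar (cf a r)) \<odot>\<^bsub>E\<^esub> \<sigma>)"
    using \<sigma> finite_N by (intro E.finsum_smult_left) (auto simp: scalar_closed)
  also have "\<dots> = (\<Oplus>\<^bsub>E\<^esub>r\<in>N. if (y, []) = r then scalar (cf a (y, [])) \<odot>\<^bsub>E\<^esub> \<sigma> else \<zero>\<^bsub>E\<^esub>)"
  proof (rule E.M.finsum_cong')
    fix r assume r: "r \<in> N"
    have "(pe (fst r) (snd r) \<otimes>\<^bsub>A\<^esub> scalar (cf a r)) \<odot>\<^bsub>E\<^esub> \<sigma> = scalar (cf a r) \<odot>\<^bsub>E\<^esub> (pe (fst r) (snd r) \<odot>\<^bsub>E\<^esub> \<sigma>)"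
      using \<sigma>(1) by (simp add: E.smult_assoc scalar_closed)
    then show "(pe (fst r) (snd r) \<otimes>\<^bsub>A\<^esub> scalar (cf a r)) \<odot>\<^bsub>E\<^esub> \<sigma> =
        (if (y, []) = r then scalar (cf a (y, [])) \<odot>\<^bsub>E\<^esub> \<sigma> else \<zero>\<^bsub>E\<^esub>)"
      using \<sigma> zero[of "fst r" "snd r"] r by (auto simp: E.smult_zero_right scalar_closed)
  qed (auto simp: \<sigma> scalar_closed E.smult_closed)
  also have "\<dots> = scalar (cf a (y, [])) \<odot>\<^bsub>E\<^esub> \<sigma>"
    using E.M.finsum_singleton[OF N finite_N, of "\<lambda>_. scalar (cf a (y, [])) \<odot>\<^bsub>E\<^esub> \<sigma>"]
    by (simp add: \<sigma> scalar_closed E.smult_closed)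
  finally show ?thesis .
qed

text \<open>
  \<open>\<xi> x c\<close> is the image of the functional dual to \<open>(x, c)\<close> under an extension to the dual module
  of the map that sends the functional dual to \<open>(y, [])\<close> to \<open>\<sigma>\<close>.
\<close>

lemma injective_dual_family:
  assumes E: "injective_module A E" and y: "y \<in> verts Q"
    and \<sigma>: "\<sigma> \<in> carrier E" "pe y [] \<odot>\<^bsub>E\<^esub> \<sigma> = \<sigma>"
    and soc: "\<And>b. b \<in> arcs Q \<Longrightarrow> pe (tail Q b) [b] \<odot>\<^bsub>E\<^esub> \<sigma> = \<zero>\<^bsub>E\<^esub>"
  obtains \<xi> where "\<And>x c. (x, c) \<in> N \<Longrightarrow> \<xi> x c \<in> carrier E"
    "\<And>x t s. (x, t @ s) \<in> N \<Longrightarrow> pe x t \<odot>\<^bsub>E\<^esub> \<xi> x (t @ s) = \<xi> (target Q x t) s"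
    "\<And>x c t. \<lbrakk>(x, c) \<in> N; \<not> prefix t c\<rbrakk> \<Longrightarrow> pe x t \<odot>\<^bsub>E\<^esub> \<xi> x c = \<zero>\<^bsub>E\<^esub>"
    "\<xi> y [] = \<sigma>"
proof -
  have rE: "right_module A E" using E by (simp add: injective_module_def fd_right_module_def)
  interpret E: right_module A E by (rule rE)
  interpret D: right_module A dual_module by (rule right_module_dual)
  have N: "(y, []) \<in> N" using trivial_in_N y by blast
  have DS: "carrier (dual_socle y) \<subseteq> carrier dual_module"
    by (rule dual_socle_subset[OF y])
  have ops: "f \<oplus>\<^bsub>dual_socle y\<^esub> g = f \<oplus>\<^bsub>dual_module\<^esub> g" "a \<odot>\<^bsub>dual_socle y\<^esub> f = a \<odot>\<^bsub>dual_module\<^esub> f" for f g a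
    by (auto simp: dual_socle_def)
  \<comment> \<open>By \<open>socle_act\<close> it is compatible with the action to send the
    functional dual to \<open>(y, [])\<close> to \<open>\<sigma>\<close>; this is the map that
    injectivity extends.\<close>
  have socle_map: "(\<lambda>f. scalar (f (y, [])) \<odot>\<^bsub>E\<^esub> \<sigma>) \<in> right_module_hom A (dual_socle y) E"
  proof (rule right_module_homI)
    fix f g
    show "scalar ((f \<oplus>\<^bsub>dual_socle y\<^esub> g) (y, [])) \<odot>\<^bsub>E\<^esub> \<sigma> =
      scalar (f (y, [])) \<odot>\<^bsub>E\<^esub> \<sigma> \<oplus>\<^bsub>E\<^esub> scalar (g (y, [])) \<odot>\<^bsub>E\<^esub> \<sigma>"
      using \<sigma> by (simp add: ops dual_module_def scalar_add E.smult_l_distr scalar_closed)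
  next
    fix a f assume a: "a \<in> carrier A" and f: "f \<in> carrier (dual_socle y)"
    have "a \<odot>\<^bsub>E\<^esub> (scalar (f (y, [])) \<odot>\<^bsub>E\<^esub> \<sigma>) = (scalar (f (y, [])) \<otimes>\<^bsub>A\<^esub> a) \<odot>\<^bsub>E\<^esub> \<sigma>"
      using a \<sigma> by (simp add: E.smult_assoc scalar_closed)
    also have "\<dots> = scalar (f (y, []) * cf a (y, [])) \<odot>\<^bsub>E\<^esub> \<sigma>"
      using socle_act[OF rE y \<sigma> soc, of "scalar (f (y, [])) \<otimes>\<^bsub>A\<^esub> a"] a
      by (simp add: cf_scalar_mult scalar_closed)
    finally show "scalar ((a \<odot>\<^bsub>dual_socle y\<^esub> f) (y, [])) \<odot>\<^bsub>E\<^esub> \<sigma> = a \<odot>\<^bsub>E\<^esub> (scalar (f (y, [])) \<odot>\<^bsub>E\<^esub> \<sigma>)"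
      using dual_socle_smult[OF y a f] by (simp add: ops mult.commute)
  qed (use \<sigma> in \<open>simp add: E.smult_closed scalar_closed\<close>)
  have "(\<lambda>f. f) \<in> right_module_hom A (dual_socle y) dual_module"
    using DS by (intro right_module_homI) (auto simp: ops)
  from injective_extend[OF E scalar_closed fd_dual_socle[OF y] fd_dual this inj_on_id2 socle_map]
  obtain h where h: "h \<in> right_module_hom A dual_module E"
    "\<And>f. f \<in> carrier (dual_socle y) \<Longrightarrow> h f = scalar (f (y, [])) \<odot>\<^bsub>E\<^esub> \<sigma>"
    by blast
  note hD = right_module_homD[OF h(1)]
  define ind :: "'v \<Rightarrow> 'e list \<Rightarrow> 'v \<times> 'e list \<Rightarrow> 'k" where "ind x c = (\<lambda>r. if r = (x, c) then 1 else 0)" for x c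
  have ind: "ind x c \<in> carrier dual_module" if "(x, c) \<in> N" for x c
    using that by (auto simp: ind_def dual_module_def)
  have ev: "dual_eval (ind x c) a = cf a (x, c)" if "(x, c) \<in> N" for x c a
    using that finite_N unfolding dual_eval_def ind_def by (simp add: if_distrib[of "\<lambda>v. v * _"] cong: if_cong)
  \<comment> \<open>A path \<open>t\<close> acts on the functional dual to \<open>c\<close> by
    cutting the prefix \<open>t\<close> off \<open>c\<close>; if \<open>t\<close> is not a prefix,
    the result is zero.\<close>
  have act: "(pe x t \<odot>\<^bsub>dual_module\<^esub> ind x c) (v, q) = (if v = target Q x t \<and> t @ q = c then 1 else 0)"
    if "(x, c) \<in> N" for x c t v q
    using that N_suffix by (auto simp: dual_module_def ev pe_mult cf_pe cf_zero)
  show ?thesis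
  proof (rule that[of "\<lambda>x c. h (ind x c)"])
    fix x c t s
    show "h (ind x c) \<in> carrier E" if "(x, c) \<in> N" using hD(1) ind that by blast
    show "pe x t \<odot>\<^bsub>E\<^esub> h (ind x (t @ s)) = h (ind (target Q x t) s)" if "(x, t @ s) \<in> N"
    proof -
      have "pe x t \<odot>\<^bsub>dual_module\<^esub> ind x (t @ s) = ind (target Q x t) s"
        using act[OF that] by (auto simp: ind_def fun_eq_iff)
      then show ?thesis using hD(3)[of "pe x t" "ind x (t @ s)"] ind that by simp
    qed
    show "pe x t \<odot>\<^bsub>E\<^esub> h (ind x c) = \<zero>\<^bsub>E\<^esub>" if "(x, c) \<in> N" "\<not> prefix t c"
    proof -
      have "pe x t \<odot>\<^bsub>dual_module\<^esub> ind x c = \<zero>\<^bsub>dual_module\<^esub>"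
        using act[OF that(1)] that(2) by (auto simp: prefix_def fun_eq_iff dual_module_def)
      then show ?thesis
        using hD(3)[of "pe x t" "ind x c"] ind that
          right_module_hom_zero[OF h(1) D.M.abelian_group_axioms E.M.abelian_group_axioms] by simp
    qed
    have "ind y [] \<in> carrier (dual_socle y)" by (simp add: ind_def dual_socle_def)
    from h(2)[OF this] show "h (ind y []) = \<sigma>"
      using \<sigma> by (simp add: ind_def scalar_one E.smult_one)
  qed
qed

section \<open>Maps out of the radical\<close>

definition radical_module :: "('a, 'a) module" where
  "radical_module = (regular_module A)\<lparr>carrier := {x \<in> carrier A. \<forall>u. cf x (u, []) = 0}\<rparr>"

lemma fd_radical: "fd_right_module A radical_module"
proof -
  interpret R: right_module A "regular_module A" by (rule right_module_A)
  have "right_module A radical_module" unfolding radical_module_def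
  proof (rule R.right_module_restrict)
    fix a x assume *: "a \<in> carrier A" "x \<in> {x \<in> carrier A. \<forall>u. cf x (u, []) = 0}"
    then have "cf (x \<otimes>\<^bsub>A\<^esub> a) (u, []) = 0" for u
      by (cases "(u, []) \<in> N") (auto simp: cf_mult cf_support)
    then show "a \<odot>\<^bsub>regular_module A\<^esub> x \<in> {x \<in> carrier A. \<forall>u. cf x (u, []) = 0}" using * by simp
  qed (auto simp: cf_zero cf_add)
  moreover from this have "finite_dimensional A radical_module"
  proof (rule finite_dimensional_coordinatesI[where \<kappa> = cf and X = "{r \<in> N. snd r \<noteq> []}" and \<beta> = "\<lambda>(u, p). pe u p"])
    show "finite {r \<in> N. snd r \<noteq> []}" using finite_N by simp
    fix m r assume "m \<in> carrier radical_module" "r \<notin> {r \<in> N. snd r \<noteq> []}"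
    then show "cf m r = 0" by (cases r) (auto simp: radical_module_def cf_support)
  qed (auto simp: radical_module_def scalar_closed cf_add cf_mult_scalar cf_pe cf_inj fun_eq_iff split: if_splits)
  ultimately show ?thesis by (simp add: fd_right_module_def)
qed

lemma pe_radical: "p \<noteq> [] \<Longrightarrow> pe u p \<in> carrier radical_module"
  by (auto simp: radical_module_def cf_pe)

lemma fd_regular: "fd_right_module A (regular_module A)"
  unfolding fd_right_module_def
  by (intro conjI right_module_A
      finite_dimensional_coordinatesI[where \<kappa> = cf and X = N and \<beta> = "\<lambda>(u, p). pe u p"])
    (auto simp: right_module_A finite_N scalar_closed cf_add cf_mult_scalar cf_pe cf_support cf_inj fun_eq_iff split: if_splits)

text \<open>As in Baer's criterion: an extension \<open>h\<close> of \<open>g\<close> to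
  \<open>A\<close> is determined by the image of one, since \<open>h a = h (1 a)\<close> is that
  image acted on by \<open>a\<close>.\<close>

lemma injective_radical_extend:
  assumes E: "injective_module A E" and g: "g \<in> right_module_hom A radical_module E"
  obtains z where "z \<in> carrier E" "\<And>a. a \<in> carrier radical_module \<Longrightarrow> a \<odot>\<^bsub>E\<^esub> z = g a"
proof -
  have rad: "carrier radical_module \<subseteq> carrier A" by (auto simp: radical_module_def)
  have "(\<lambda>x. x) \<in> right_module_hom A radical_module (regular_module A)"
    by (rule right_module_homI) (auto simp: radical_module_def)
  then obtain h where h: "h \<in> right_module_hom A (regular_module A) E"
    "\<And>x. x \<in> carrier radical_module \<Longrightarrow> h x = g x"
    using injective_extend[OF E scalar_closed fd_radical fd_regular _ _ g] by (metis inj_on_id2)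
  note hD = right_module_homD[OF h(1)]
  show ?thesis
  proof (rule that[of "h \<one>\<^bsub>A\<^esub>"])
    show "h \<one>\<^bsub>A\<^esub> \<in> carrier E" using hD(1) by simp
    fix a assume a: "a \<in> carrier radical_module"
    then show "a \<odot>\<^bsub>E\<^esub> h \<one>\<^bsub>A\<^esub> = g a" using hD(3)[of a "\<one>\<^bsub>A\<^esub>"] h(2)[OF a] rad by auto
  qed
qed

section \<open>Free modules, dual bases and the radical of a projective module\<close>

definition free_module :: "'b set \<Rightarrow> ('a, 'b \<Rightarrow> 'a) module" where
  "free_module B =
    \<lparr>carrier = {\<phi>. (\<forall>b. \<phi> b \<in> carrier A) \<and> (\<forall>b. b \<notin> B \<longrightarrow> \<phi> b = \<zero>\<^bsub>A\<^esub>)},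
     mult = undefined, one = undefined, zero = (\<lambda>_. \<zero>\<^bsub>A\<^esub>),
     add = (\<lambda>\<phi> \<psi> b. \<phi> b \<oplus>\<^bsub>A\<^esub> \<psi> b), smult = (\<lambda>a \<phi> b. \<phi> b \<otimes>\<^bsub>A\<^esub> a)\<rparr>"

lemma free_module_carrier: "\<phi> \<in> carrier (free_module B) \<Longrightarrow> \<phi> b \<in> carrier A"
  by (simp add: free_module_def)

lemma fd_free_module:
  assumes "finite B" shows "fd_right_module A (free_module B)"
proof -
  have "abelian_group (free_module B)"
  proof (rule abelian_groupI)
    fix f assume f: "f \<in> carrier (free_module B)"
    show "\<exists>g\<in>carrier (free_module B). g \<oplus>\<^bsub>free_module B\<^esub> f = \<zero>\<^bsub>free_module B\<^esub>"
    proof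
      show "(\<lambda>b. \<ominus>\<^bsub>A\<^esub> f b) \<oplus>\<^bsub>free_module B\<^esub> f = \<zero>\<^bsub>free_module B\<^esub>"
        using free_module_carrier[OF f] by (simp add: free_module_def A.l_neg)
    qed (use f in \<open>auto simp: free_module_def\<close>)
  qed (auto dest: free_module_carrier simp: free_module_def fun_eq_iff A.a_ac)
  then have rm: "right_module A (free_module B)"
    using ring_A free_module_carrier
    by (auto simp: right_module_def right_module_axioms_def free_module_def fun_eq_iff
        A.l_distr A.r_distr A.m_assoc)
  moreover have "finite_dimensional A (free_module B)"
  proof (rule finite_dimensional_coordinatesI[where \<kappa> = "\<lambda>\<phi> (b, r). cf (\<phi> b) r" and X = "B \<times> N"
          and \<beta> = "\<lambda>(b, u, p) b'. if b' = b then pe u p else \<zero>\<^bsub>A\<^esub>", OF rm])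
    fix \<phi> \<psi> assume *: "\<phi> \<in> carrier (free_module B)" "\<psi> \<in> carrier (free_module B)"
      "(\<lambda>(b, r). cf (\<phi> b) r) = (\<lambda>(b, r). cf (\<psi> b) r)"
    then have "cf (\<phi> b) = cf (\<psi> b)" for b by (auto simp: fun_eq_iff)
    then show "\<phi> = \<psi>" using *(1,2)[THEN free_module_carrier] cf_inj by blast
  next
    fix \<phi> \<psi> and r :: "'b \<times> 'v \<times> 'e list" assume *: "\<phi> \<in> carrier (free_module B)" "\<psi> \<in> carrier (free_module B)"
    then show "(case r of (b, r) \<Rightarrow> cf ((\<phi> \<oplus>\<^bsub>free_module B\<^esub> \<psi>) b) r) =
      (case r of (b, r) \<Rightarrow> cf (\<phi> b) r) + (case r of (b, r) \<Rightarrow> cf (\<psi> b) r)"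
      using *[THEN free_module_carrier] by (cases r) (auto simp: free_module_def cf_add)
  next
    fix c \<phi> and r :: "'b \<times> 'v \<times> 'e list" assume "\<phi> \<in> carrier (free_module B)"
    from free_module_carrier[OF this]
    show "(case r of (b, r) \<Rightarrow> cf ((scalar c \<odot>\<^bsub>free_module B\<^esub> \<phi>) b) r) =
      c * (case r of (b, r) \<Rightarrow> cf (\<phi> b) r)"
      by (cases r) (auto simp: free_module_def cf_mult_scalar)
  next
    fix \<phi> and r :: "'b \<times> 'v \<times> 'e list" assume "\<phi> \<in> carrier (free_module B)" "r \<notin> B \<times> N"
    then show "(case r of (b, r) \<Rightarrow> cf (\<phi> b) r) = 0"
      by (cases r) (auto simp: free_module_def cf_zero cf_support)
  qed (auto simp: assms finite_N scalar_closed free_module_def cf_pe cf_zero fun_eq_iff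
      if_distrib[of "\<lambda>x. cf x _"] cong: if_cong split: if_splits)
  ultimately show ?thesis by (simp add: fd_right_module_def)
qed

text \<open>The dual basis lemma: the \<open>f b\<close> are the coordinates of a section of a free
  cover of \<open>P\<close>.\<close>

lemma dual_basis:
  fixes P :: "('k, 'a) std_module"
  assumes P: "projective_module A P"
  obtains B f where "finite B" "B \<subseteq> carrier P"
    "\<And>b. f b \<in> right_module_hom A P (regular_module A)"
    "\<And>x. x \<in> carrier P \<Longrightarrow> x = (\<Oplus>\<^bsub>P\<^esub>b\<in>B. f b x \<odot>\<^bsub>P\<^esub> b)"
proof -
  have rP: "right_module A P" and "finite_dimensional A P"
    using P by (auto simp: projective_module_def fd_right_module_def)
  interpret P: right_module A P by (rule rP)
  from \<open>finite_dimensional A P\<close> obtain B where B: "finite B" "B \<subseteq> carrier P"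
    "\<And>x. x \<in> carrier P \<Longrightarrow> \<exists>c :: (nat \<Rightarrow> 'k) \<Rightarrow> 'k. x = (\<Oplus>\<^bsub>P\<^esub>b\<in>B. scalar (c b) \<odot>\<^bsub>P\<^esub> b)"
    unfolding finite_dimensional_def by blast
  \<comment> \<open>A spanning set over the field also generates over \<open>A\<close>, so this
    evaluation map is onto and splits.\<close>
  let ?F = "free_module B" and ?g = "\<lambda>\<phi>. \<Oplus>\<^bsub>P\<^esub>b\<in>B. \<phi> b \<odot>\<^bsub>P\<^esub> b"
  have FD: "\<phi> b \<odot>\<^bsub>P\<^esub> b \<in> carrier P" if "\<phi> \<in> carrier ?F" "b \<in> B" for \<phi> b
    using free_module_carrier[OF that(1)] that B(2) P.smult_closed by auto
  have g: "?g \<in> right_module_hom A ?F P"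
  proof (rule right_module_homI)
    fix \<phi> assume \<phi>: "\<phi> \<in> carrier ?F"
    then show "?g \<phi> \<in> carrier P" using FD by (intro P.M.finsum_closed) auto
    show "?g (a \<odot>\<^bsub>?F\<^esub> \<phi>) = a \<odot>\<^bsub>P\<^esub> ?g \<phi>" if "a \<in> carrier A" for a
    proof -
      have "a \<odot>\<^bsub>P\<^esub> ?g \<phi> = (\<Oplus>\<^bsub>P\<^esub>b\<in>B. a \<odot>\<^bsub>P\<^esub> (\<phi> b \<odot>\<^bsub>P\<^esub> b))"
        using FD[OF \<phi>] that B(1) by (intro P.finsum_smult_right) auto
      also have "\<dots> = ?g (a \<odot>\<^bsub>?F\<^esub> \<phi>)"
        using FD[OF \<phi>] free_module_carrier[OF \<phi>] that B(2)
        by (intro P.M.finsum_cong') (auto simp: free_module_def P.smult_assoc P.smult_closed subset_iff)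
      finally show ?thesis by simp
    qed
    fix \<psi> assume \<psi>: "\<psi> \<in> carrier ?F"
    have "?g (\<phi> \<oplus>\<^bsub>?F\<^esub> \<psi>) = (\<Oplus>\<^bsub>P\<^esub>b\<in>B. \<phi> b \<odot>\<^bsub>P\<^esub> b \<oplus>\<^bsub>P\<^esub> \<psi> b \<odot>\<^bsub>P\<^esub> b)"
      using FD[OF \<phi>] FD[OF \<psi>] free_module_carrier[OF \<phi>] free_module_carrier[OF \<psi>] B(2)
      by (intro P.M.finsum_cong') (auto simp: free_module_def P.smult_l_distr subset_iff)
    also have "\<dots> = ?g \<phi> \<oplus>\<^bsub>P\<^esub> ?g \<psi>" using FD[OF \<phi>] FD[OF \<psi>] by (intro P.M.finsum_addf) auto
    finally show "?g (\<phi> \<oplus>\<^bsub>?F\<^esub> \<psi>) = ?g \<phi> \<oplus>\<^bsub>P\<^esub> ?g \<psi>" .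
  qed
  moreover have "?g ` carrier ?F = carrier P"
  proof (intro equalityI subsetI)
    fix x assume "x \<in> ?g ` carrier ?F"
    then show "x \<in> carrier P" using right_module_homD(1)[OF g] by blast
  next
    fix x assume "x \<in> carrier P"
    then obtain c :: "(nat \<Rightarrow> 'k) \<Rightarrow> 'k" where c: "x = (\<Oplus>\<^bsub>P\<^esub>b\<in>B. scalar (c b) \<odot>\<^bsub>P\<^esub> b)" using B(3) by blast
    let ?\<phi> = "\<lambda>b. if b \<in> B then scalar (c b) else \<zero>\<^bsub>A\<^esub>"
    have "?\<phi> \<in> carrier ?F" by (auto simp: free_module_def scalar_closed)
    moreover have "x = ?g ?\<phi>" unfolding c
      using B(2) by (intro P.M.finsum_cong') (auto simp: scalar_closed P.smult_closed subset_iff)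
    ultimately show "x \<in> ?g ` carrier ?F" by (rule rev_image_eqI[where f = ?g])
  qed
  ultimately obtain h where h: "h \<in> right_module_hom A P ?F" "\<And>x. x \<in> carrier P \<Longrightarrow> ?g (h x) = x"
    by (rule projective_split[OF P scalar_closed fd_free_module[OF B(1)]]) blast
  note hD = right_module_homD[OF h(1)]
  show ?thesis
  proof (rule that[of B "\<lambda>b x. h x b", OF B(1,2)])
    fix b
    show "(\<lambda>x. h x b) \<in> right_module_hom A P (regular_module A)"
      using hD free_module_carrier[OF hD(1)] by (intro right_module_homI) (auto simp: free_module_def)
  qed (use h(2) in simp)
qed

text \<open>If all coordinates \<open>f b x\<close> were zero, so would be the dual basis expansion
  of \<open>x\<close>.\<close>

lemma projective_torsionless:
  fixes P :: "('k, 'a) std_module"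
  assumes P: "projective_module A P" and x: "x \<in> carrier P" "x \<noteq> \<zero>\<^bsub>P\<^esub>"
  obtains f where "f \<in> right_module_hom A P (regular_module A)" "f x \<noteq> \<zero>\<^bsub>A\<^esub>"
proof -
  interpret P: right_module A P using P by (auto simp: projective_module_def fd_right_module_def)
  obtain B f where B: "finite B" "B \<subseteq> carrier P"
    "\<And>b. f b \<in> right_module_hom A P (regular_module A)"
    "\<And>x. x \<in> carrier P \<Longrightarrow> x = (\<Oplus>\<^bsub>P\<^esub>b\<in>B. f b x \<odot>\<^bsub>P\<^esub> b)"
    by (rule dual_basis[OF P]) blast
  have "\<exists>b\<in>B. f b x \<noteq> \<zero>\<^bsub>A\<^esub>"
  proof (rule ccontr)
    assume "\<not> ?thesis"
    then have "(\<Oplus>\<^bsub>P\<^esub>b\<in>B. f b x \<odot>\<^bsub>P\<^esub> b) = (\<Oplus>\<^bsub>P\<^esub>b\<in>B. \<zero>\<^bsub>P\<^esub>)"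
      using B(2) by (intro P.M.finsum_cong') (auto simp: P.smult_zero_left subset_iff)
    then show False using B(4)[OF x(1)] x(2) P.M.finsum_zero by simp
  qed
  with B(3) that show ?thesis by blast
qed

text \<open>An element of the radical of \<open>P\<close> is a sum of products with arrows, and
  \<open>\<omega>'\<close> is the factor that belongs to the last arrow \<open>d\<close>. As
  \<open>P\<close> comes without a basis of paths, this is expressed through maps to
  \<open>A\<close> and coefficients at paths ending in \<open>d\<close>.\<close>

lemma projective_radical:
  fixes P :: "('k, 'a) std_module"
  assumes P: "projective_module A P" and \<omega>: "\<omega> \<in> carrier P"
    and rad: "\<And>f u. f \<in> right_module_hom A P (regular_module A) \<Longrightarrow> cf (f \<omega>) (u, []) = 0"
  obtains \<omega>' where "\<omega>' \<in> carrier P"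
    "\<And>f u p. f \<in> right_module_hom A P (regular_module A) \<Longrightarrow>
       cf (f \<omega>) (u, p @ [d]) = cf (f \<omega>' \<otimes>\<^bsub>A\<^esub> pe (tail Q d) [d]) (u, p @ [d])"
proof -
  interpret P: right_module A P using P by (auto simp: projective_module_def fd_right_module_def)
  interpret R: right_module A "regular_module A" by (rule right_module_A)
  obtain B f where B: "finite B" "B \<subseteq> carrier P"
    "\<And>b. f b \<in> right_module_hom A P (regular_module A)"
    "\<And>x. x \<in> carrier P \<Longrightarrow> x = (\<Oplus>\<^bsub>P\<^esub>b\<in>B. f b x \<odot>\<^bsub>P\<^esub> b)"
    by (rule dual_basis[OF P]) blast
  \<comment> \<open>Strips the last arrow \<open>d\<close> from the paths of
    \<open>f b \<omega>\<close> that end in it.\<close>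
  define quo where "quo b = elt (\<lambda>(u, p). if (u, p) \<in> N then cf (f b \<omega>) (u, p @ [d]) else 0)" for b
  have quo: "quo b \<in> carrier A"
    "(u, p) \<in> N \<Longrightarrow> cf (quo b) (u, p) = cf (f b \<omega>) (u, p @ [d])" for b u p
    using elt[of "\<lambda>(u, p). if (u, p) \<in> N then cf (f b \<omega>) (u, p @ [d]) else 0"] unfolding quo_def by auto
  have fA: "f b \<omega> \<in> carrier A" for b using right_module_homD(1)[OF B(3) \<omega>] by simp
  have quo_mult: "cf (a \<otimes>\<^bsub>A\<^esub> f b \<omega>) (u, p @ [d]) = cf ((a \<otimes>\<^bsub>A\<^esub> quo b) \<otimes>\<^bsub>A\<^esub> pe (tail Q d) [d]) (u, p @ [d])"
    if a: "a \<in> carrier A" for a b u p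
  proof (cases "(u, p @ [d]) \<in> N")
    case True
    then have p: "(u, p) \<in> N" "target Q u p = tail Q d"
      using N_prefix N_suffix N_Cons by blast+
    have "cf (a \<otimes>\<^bsub>A\<^esub> f b \<omega>) (u, p @ [d]) =
      (\<Sum>i\<le>Suc (length p). cf a (u, take i (p @ [d])) * cf (f b \<omega>) (target Q u (take i (p @ [d])), drop i (p @ [d])))"
      using cf_mult[OF a fA True] by simp
    \<comment> \<open>The summand for \<open>i = Suc (length p)\<close> contains a coefficient of
      \<open>f b \<omega>\<close> at a trivial path and vanishes by \<open>rad\<close>.\<close>
    also have "\<dots> = (\<Sum>i\<le>length p. cf a (u, take i p) * cf (f b \<omega>) (target Q u (take i p), drop i p @ [d]))"
      using rad[OF B(3)] by (simp add: sum.atMost_Suc)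
    also have "\<dots> = (\<Sum>i\<le>length p. cf a (u, take i p) * cf (quo b) (target Q u (take i p), drop i p))"
    proof (intro sum.cong refl)
      fix i
      have "(target Q u (take i p), drop i p) \<in> N" using N_suffix[of u "take i p" "drop i p"] p(1) by simp
      then show "cf a (u, take i p) * cf (f b \<omega>) (target Q u (take i p), drop i p @ [d]) =
        cf a (u, take i p) * cf (quo b) (target Q u (take i p), drop i p)" using quo(2) by simp
    qed
    also have "\<dots> = cf (a \<otimes>\<^bsub>A\<^esub> quo b) (u, p)" using cf_mult[OF a quo(1) p(1)] by simp
    also have "\<dots> = cf ((a \<otimes>\<^bsub>A\<^esub> quo b) \<otimes>\<^bsub>A\<^esub> pe (tail Q d) [d]) (u, p @ [d])"
      using cf_mult_pe[of "a \<otimes>\<^bsub>A\<^esub> quo b" u p "[d]"] a quo(1) True p(2) by simp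
    finally show ?thesis .
  next
    case False
    then show ?thesis using a quo(1) fA cf_support by simp
  qed
  show ?thesis
  proof (rule that[of "\<Oplus>\<^bsub>P\<^esub>b\<in>B. quo b \<odot>\<^bsub>P\<^esub> b"])
    show "(\<Oplus>\<^bsub>P\<^esub>b\<in>B. quo b \<odot>\<^bsub>P\<^esub> b) \<in> carrier P"
      using B(2) quo(1) P.smult_closed by (intro P.M.finsum_closed) auto
    fix h u p assume h: "h \<in> right_module_hom A P (regular_module A)"
    note hD = right_module_homD[OF h, simplified]
    have fin: "h (\<Oplus>\<^bsub>P\<^esub>b\<in>B. g b \<odot>\<^bsub>P\<^esub> b) = (\<Oplus>\<^bsub>A\<^esub>b\<in>B. h b \<otimes>\<^bsub>A\<^esub> g b)"
      if "\<And>b. g b \<in> carrier A" for g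
    proof -
      have "h (\<Oplus>\<^bsub>P\<^esub>b\<in>B. g b \<odot>\<^bsub>P\<^esub> b) = (\<Oplus>\<^bsub>regular_module A\<^esub>b\<in>B. h (g b \<odot>\<^bsub>P\<^esub> b))"
        using B(1,2) that P.smult_closed
        by (intro right_module_hom_finsum[OF h P.M.abelian_group_axioms R.M.abelian_group_axioms]) auto
      also have "\<dots> = (\<Oplus>\<^bsub>A\<^esub>b\<in>B. h (g b \<odot>\<^bsub>P\<^esub> b))"
        using B hD that P.smult_closed by (intro finsum_regular_module) auto
      also have "\<dots> = (\<Oplus>\<^bsub>A\<^esub>b\<in>B. h b \<otimes>\<^bsub>A\<^esub> g b)"
        using B(2) that hD by (intro A.finsum_cong') auto
      finally show ?thesis .
    qed
    have hb: "h b \<in> carrier A" if "b \<in> B" for b using hD(1) that B(2) by blast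
    have "cf (h \<omega>) (u, p @ [d]) = (\<Sum>b\<in>B. cf (h b \<otimes>\<^bsub>A\<^esub> f b \<omega>) (u, p @ [d]))"
      using B(4)[OF \<omega>] fin[of "\<lambda>b. f b \<omega>"] fA hb B(1) by (simp add: cf_finsum)
    also have "\<dots> = (\<Sum>b\<in>B. cf ((h b \<otimes>\<^bsub>A\<^esub> quo b) \<otimes>\<^bsub>A\<^esub> pe (tail Q d) [d]) (u, p @ [d]))"
      using quo_mult hb by (intro sum.cong) auto
    also have "\<dots> = cf ((\<Oplus>\<^bsub>A\<^esub>b\<in>B. h b \<otimes>\<^bsub>A\<^esub> quo b) \<otimes>\<^bsub>A\<^esub> pe (tail Q d) [d]) (u, p @ [d])"
      using hb quo(1) B(1) by (simp add: A.finsum_ldistr cf_finsum)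
    also have "\<dots> = cf (h (\<Oplus>\<^bsub>P\<^esub>b\<in>B. quo b \<odot>\<^bsub>P\<^esub> b) \<otimes>\<^bsub>A\<^esub> pe (tail Q d) [d]) (u, p @ [d])"
      using fin[of quo] quo(1) by simp
    finally show "cf (h \<omega>) (u, p @ [d]) = cf (h (\<Oplus>\<^bsub>P\<^esub>b\<in>B. quo b \<odot>\<^bsub>P\<^esub> b) \<otimes>\<^bsub>A\<^esub> pe (tail Q d) [d]) (u, p @ [d])" .
  qed
qed

end

section \<open>The first terms of the injective resolution\<close>

text \<open>The two bounds on projective dimensions in usable form: \<open>E0\<close> is itself
  projective, and \<open>P1\<close>, \<open>P0\<close>, \<open>E1\<close> form a short exact
  sequence.\<close>

locale gorenstein_resolution = path_basis_algebra Q N A cf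
  for Q :: "('v, 'e) pre_digraph" and N :: "('v \<times> 'e list) set"
    and A :: "('k::field, 'a) module" and cf :: "'a \<Rightarrow> 'v \<times> 'e list \<Rightarrow> 'k" +
  fixes E0 E1 P0 P1 :: "('k, 'a) std_module" and \<eta> :: "'a \<Rightarrow> nat \<Rightarrow> 'k"
    and d \<delta> \<epsilon> :: "(nat \<Rightarrow> 'k) \<Rightarrow> nat \<Rightarrow> 'k"
  assumes E0_injective: "injective_module A E0" and E1_injective: "injective_module A E1"
    and E0_projective: "projective_module A E0"
    and P0_projective: "projective_module A P0" and P1_projective: "projective_module A P1"
    and \<eta>_hom: "\<eta> \<in> right_module_hom A (regular_module A) E0" and \<eta>_inj: "inj_on \<eta> (carrier A)"
    and d_hom: "d \<in> right_module_hom A E0 E1" and \<eta>_image: "\<eta> ` carrier A = a_kernel E0 E1 d"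
    and \<delta>_hom: "\<delta> \<in> right_module_hom A P1 P0" and \<delta>_inj: "inj_on \<delta> (carrier P1)"
    and \<epsilon>_hom: "\<epsilon> \<in> right_module_hom A P0 E1" and \<epsilon>_surj: "\<epsilon> ` carrier P0 = carrier E1"
    and \<delta>_image: "\<delta> ` carrier P1 = a_kernel P0 E1 \<epsilon>"
begin

sublocale E0: right_module A E0
  using E0_injective by (simp add: injective_module_def fd_right_module_def)
sublocale E1: right_module A E1
  using E1_injective by (simp add: injective_module_def fd_right_module_def)
sublocale P0: right_module A P0
  using P0_projective by (simp add: projective_module_def fd_right_module_def)
sublocale P1: right_module A P1
  using P1_projective by (simp add: projective_module_def fd_right_module_def)

lemmas \<eta>D = right_module_homD[OF \<eta>_hom, simplified]
lemmas dD = right_module_homD[OF d_hom]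
lemmas \<delta>D = right_module_homD[OF \<delta>_hom]
lemmas \<epsilon>D = right_module_homD[OF \<epsilon>_hom]

lemma reg_group: "abelian_group (regular_module A)"
  by (rule right_module_abelian_group[OF right_module_A])

lemma \<eta>_zero: "\<eta> \<zero>\<^bsub>A\<^esub> = \<zero>\<^bsub>E0\<^esub>"
  using right_module_hom_zero[OF \<eta>_hom reg_group E0.M.abelian_group_axioms] by simp

lemma \<delta>_zero: "\<delta> \<zero>\<^bsub>P1\<^esub> = \<zero>\<^bsub>P0\<^esub>"
  by (rule right_module_hom_zero[OF \<delta>_hom P1.M.abelian_group_axioms P0.M.abelian_group_axioms])

lemma \<epsilon>_zero: "\<epsilon> \<zero>\<^bsub>P0\<^esub> = \<zero>\<^bsub>E1\<^esub>"
  by (rule right_module_hom_zero[OF \<epsilon>_hom P0.M.abelian_group_axioms E1.M.abelian_group_axioms])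

lemma \<epsilon>_\<delta>: "\<omega> \<in> carrier P1 \<Longrightarrow> \<epsilon> (\<delta> \<omega>) = \<zero>\<^bsub>E1\<^esub>"
  using \<delta>_image by (auto simp: a_kernel_def')

section \<open>Consequences of I^0 being projective\<close>

lemma nonzero_cf:
  assumes "x \<in> carrier A" "x \<noteq> \<zero>\<^bsub>A\<^esub>" obtains u p where "(u, p) \<in> N" "cf x (u, p) \<noteq> 0"
  using cf_eqI[OF assms(1) A.zero_closed] assms(2) cf_zero by metis

lemma pe_nonzero: "(u, p) \<in> N \<Longrightarrow> pe u p \<noteq> \<zero>\<^bsub>A\<^esub>"
  using cf_pe[of u p "(u, p)"] cf_zero by force

text \<open>A right-maximal path lies in the socle of \<open>A\<close>, so its image in the
  injective module \<open>E0\<close> has a dual family. Since \<open>E0\<close> is also projective,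
  some map to \<open>A\<close> does not kill that image, and it moves the family into
  \<open>A\<close>.\<close>

lemma socle_family:
  assumes p: "rmax u p"
  obtains \<zeta> where "\<And>x c. (x, c) \<in> N \<Longrightarrow> \<zeta> x c \<in> carrier A"
    "\<And>x t s. (x, t @ s) \<in> N \<Longrightarrow> \<zeta> x (t @ s) \<otimes>\<^bsub>A\<^esub> pe x t = \<zeta> (target Q x t) s"
    "\<And>x c t. \<lbrakk>(x, c) \<in> N; \<not> prefix t c\<rbrakk> \<Longrightarrow> \<zeta> x c \<otimes>\<^bsub>A\<^esub> pe x t = \<zero>\<^bsub>A\<^esub>"
    "\<zeta> (target Q u p) [] \<noteq> \<zero>\<^bsub>A\<^esub>"
proof -
  let ?y = "target Q u p" and ?\<sigma> = "\<eta> (pe u p)"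
  have N: "(u, p) \<in> N" and max: "\<And>b. (u, p @ [b]) \<notin> N" using p by (auto simp: rmax_def)
  have y: "?y \<in> verts Q" using N_target N by blast
  have \<sigma>: "?\<sigma> \<in> carrier E0" using \<eta>D(1) by simp
  have \<sigma>y: "pe ?y [] \<odot>\<^bsub>E0\<^esub> ?\<sigma> = ?\<sigma>" using \<eta>D(3)[of "pe ?y []" "pe u p"] by (simp add: pe_mult)
  have soc: "pe (tail Q b) [b] \<odot>\<^bsub>E0\<^esub> ?\<sigma> = \<zero>\<^bsub>E0\<^esub>" for b
  proof -
    have "pe u p \<otimes>\<^bsub>A\<^esub> pe (tail Q b) [b] = \<zero>\<^bsub>A\<^esub>" using max by (simp add: pe_mult pe_zero)
    then show ?thesis using \<eta>D(3)[of "pe (tail Q b) [b]" "pe u p"] by (simp add: \<eta>_zero)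
  qed
  have nz: "?\<sigma> \<noteq> \<zero>\<^bsub>E0\<^esub>"
    using inj_onD[OF \<eta>_inj, of "pe u p" "\<zero>\<^bsub>A\<^esub>"] \<eta>_zero pe_nonzero[OF N] by auto
  obtain \<xi> where \<xi>: "\<And>x c. (x, c) \<in> N \<Longrightarrow> \<xi> x c \<in> carrier E0"
    "\<And>x t s. (x, t @ s) \<in> N \<Longrightarrow> pe x t \<odot>\<^bsub>E0\<^esub> \<xi> x (t @ s) = \<xi> (target Q x t) s"
    "\<And>x c t. \<lbrakk>(x, c) \<in> N; \<not> prefix t c\<rbrakk> \<Longrightarrow> pe x t \<odot>\<^bsub>E0\<^esub> \<xi> x c = \<zero>\<^bsub>E0\<^esub>"
    "\<xi> ?y [] = ?\<sigma>"
    using injective_dual_family[OF E0_injective y \<sigma> \<sigma>y soc] by blast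
  obtain f where f: "f \<in> right_module_hom A E0 (regular_module A)" "f ?\<sigma> \<noteq> \<zero>\<^bsub>A\<^esub>"
    using projective_torsionless[OF E0_projective \<sigma> nz] by blast
  note fD = right_module_homD[OF f(1), simplified]
  have f0: "f \<zero>\<^bsub>E0\<^esub> = \<zero>\<^bsub>A\<^esub>"
    using right_module_hom_zero[OF f(1) E0.M.abelian_group_axioms reg_group] by simp
  show ?thesis
  proof (rule that[of "\<lambda>x c. f (\<xi> x c)"])
    fix x c t s
    show "f (\<xi> x c) \<in> carrier A" if "(x, c) \<in> N" using fD(1) \<xi>(1) that by blast
    show "f (\<xi> x (t @ s)) \<otimes>\<^bsub>A\<^esub> pe x t = f (\<xi> (target Q x t) s)" if "(x, t @ s) \<in> N"
      using fD(3)[of "pe x t" "\<xi> x (t @ s)"] \<xi>(1,2)[OF that] by simp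
    show "f (\<xi> x c) \<otimes>\<^bsub>A\<^esub> pe x t = \<zero>\<^bsub>A\<^esub>" if "(x, c) \<in> N" "\<not> prefix t c"
      using fD(3)[of "pe x t" "\<xi> x c"] \<xi>(1)[OF that(1)] \<xi>(3)[OF that] f0 by simp
  qed (use \<xi>(4) f(2) in simp)
qed

text \<open>The socle element \<open>?\<tau>\<close> is a left multiple of both paths, so every path
  occurring in it ends in \<open>d1 # s\<close> and in \<open>d2 # s\<close>.\<close>

lemma resolution_rmax_coherent:
  assumes p: "rmax u p" and n: "(x1, d1 # s) \<in> N" "(x2, d2 # s) \<in> N"
    and t: "target Q x1 (d1 # s) = target Q u p" "target Q x2 (d2 # s) = target Q u p"
  shows "d1 = d2"
proof -
  obtain \<zeta> where \<zeta>: "\<And>x c. (x, c) \<in> N \<Longrightarrow> \<zeta> x c \<in> carrier A"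
    "\<And>x t s. (x, t @ s) \<in> N \<Longrightarrow> \<zeta> x (t @ s) \<otimes>\<^bsub>A\<^esub> pe x t = \<zeta> (target Q x t) s"
    "\<zeta> (target Q u p) [] \<noteq> \<zero>\<^bsub>A\<^esub>"
    using socle_family[OF p] by metis
  let ?\<tau> = "\<zeta> (target Q u p) []"
  have e1: "\<zeta> x1 (d1 # s) \<otimes>\<^bsub>A\<^esub> pe x1 (d1 # s) = ?\<tau>" and e2: "\<zeta> x2 (d2 # s) \<otimes>\<^bsub>A\<^esub> pe x2 (d2 # s) = ?\<tau>"
    using \<zeta>(2)[of x1 "d1 # s" "[]"] \<zeta>(2)[of x2 "d2 # s" "[]"] n t by auto
  have "?\<tau> \<in> carrier A" using e1 \<zeta>(1) n by (metis A.m_closed pe_closed)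
  then obtain w r where wr: "cf ?\<tau> (w, r) \<noteq> 0" using nonzero_cf \<zeta>(3) by metis
  obtain p1 where "r = p1 @ d1 # s"
    using cf_mult_pe_nonzero[of "\<zeta> x1 (d1 # s)" x1 "d1 # s" w r] \<zeta>(1) n wr e1 by auto
  moreover obtain p2 where "r = p2 @ d2 # s"
    using cf_mult_pe_nonzero[of "\<zeta> x2 (d2 # s)" x2 "d2 # s" w r] \<zeta>(1) n wr e2 by auto
  ultimately show ?thesis by simp
qed

text \<open>Left-maximality forces the element \<open>\<alpha>\<close> that \<open>?q\<close> sends
  to the socle to have a nonzero coefficient at the trivial path. Hence the nonzero path
  \<open>r @ [b']\<close> does not kill it, whereas a dual family is killed by every path that is
  not a prefix.\<close>

lemma resolution_bimax_uniserial:
  assumes r: "rmax x (r @ b # s)" and l: "lmax x (r @ b # s)" and b': "(x, r @ [b']) \<in> N"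
  shows "b' = b"
proof (rule ccontr)
  assume "b' \<noteq> b"
  let ?q = "r @ b # s"
  obtain \<zeta> where \<zeta>: "\<And>x c. (x, c) \<in> N \<Longrightarrow> \<zeta> x c \<in> carrier A"
    "\<And>x t s. (x, t @ s) \<in> N \<Longrightarrow> \<zeta> x (t @ s) \<otimes>\<^bsub>A\<^esub> pe x t = \<zeta> (target Q x t) s"
    "\<And>x c t. \<lbrakk>(x, c) \<in> N; \<not> prefix t c\<rbrakk> \<Longrightarrow> \<zeta> x c \<otimes>\<^bsub>A\<^esub> pe x t = \<zero>\<^bsub>A\<^esub>"
    "\<zeta> (target Q x ?q) [] \<noteq> \<zero>\<^bsub>A\<^esub>"
    using socle_family[OF r] by metis
  have N: "(x, ?q) \<in> N" using r by (simp add: rmax_def)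
  define \<alpha> where "\<alpha> = \<zeta> x ?q"
  have \<alpha>: "\<alpha> \<in> carrier A" using \<zeta>(1) N by (simp add: \<alpha>_def)
  have "\<alpha> \<otimes>\<^bsub>A\<^esub> pe x ?q \<noteq> \<zero>\<^bsub>A\<^esub>" using \<zeta>(2)[of x ?q "[]"] \<zeta>(4) N by (simp add: \<alpha>_def)
  then obtain w t where "cf (\<alpha> \<otimes>\<^bsub>A\<^esub> pe x ?q) (w, t) \<noteq> 0"
    using nonzero_cf[OF A.m_closed[OF \<alpha> pe_closed]] by blast
  then obtain p where p: "target Q w p = x" "(w, p @ ?q) \<in> N" "cf \<alpha> (w, p) \<noteq> 0"
    using cf_mult_pe_nonzero[OF \<alpha>] by metis
  have "p = []"
  proof (rule ccontr)
    assume "p \<noteq> []"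
    then obtain p' e where e: "p = p' @ [e]" by (metis append_butlast_last_id)
    have "(target Q w p', e # ?q) \<in> N" using N_suffix[of w p' "e # ?q"] p(2) e by simp
    moreover from this have "target Q w p' = tail Q e" "e \<in> arcs Q" using N_Cons by blast+
    moreover have "head Q e = x" using p(1) e by simp
    ultimately show False using l by (auto simp: lmax_def)
  qed
  with p have nz: "cf \<alpha> (x, []) \<noteq> 0" by simp
  have "\<not> prefix (r @ [b']) ?q" using \<open>b' \<noteq> b\<close> by (simp add: prefix_def)
  then have "\<alpha> \<otimes>\<^bsub>A\<^esub> pe x (r @ [b']) = \<zero>\<^bsub>A\<^esub>" using \<zeta>(3)[OF N] by (simp add: \<alpha>_def)
  then show False using cf_mult_pe[OF \<alpha>, of x "[]" "r @ [b']"] b' nz by (simp add: cf_zero)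
qed

section \<open>Consequences of the bound on the projective dimension of I^1\<close>

lemma radical_left_closed:
  assumes "c \<in> carrier A" "a \<in> carrier radical_module"
  shows "c \<otimes>\<^bsub>A\<^esub> a \<in> carrier radical_module"
proof -
  have "cf (c \<otimes>\<^bsub>A\<^esub> a) (u, []) = 0" for u
    using assms by (cases "(u, []) \<in> N") (auto simp: radical_module_def cf_mult cf_support)
  then show ?thesis using assms by (auto simp: radical_module_def)
qed

text \<open>On the part at \<open>w\<close>, the map \<open>g\<close> represents an Ext^1 class of
  the simple module at \<open>w\<close> with values in \<open>A\<close>. In \<open>E0\<close> it
  becomes the action on an element \<open>?z\<close>, which the radical sends into the image of
  \<open>A\<close>; \<open>nonrep\<close> keeps \<open>?z\<close> itself outside that image.\<close>

lemma cosyzygy_socle: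
  assumes g: "g \<in> right_module_hom A radical_module (regular_module A)" and w: "w \<in> verts Q"
    and nonrep: "\<not> (\<exists>c\<in>carrier A. \<forall>a\<in>carrier radical_module. g (pe w [] \<otimes>\<^bsub>A\<^esub> a) = c \<otimes>\<^bsub>A\<^esub> a)"
  obtains \<sigma> where "\<sigma> \<in> carrier E1" "\<sigma> \<noteq> \<zero>\<^bsub>E1\<^esub>" "pe w [] \<odot>\<^bsub>E1\<^esub> \<sigma> = \<sigma>"
    "\<And>b. pe (tail Q b) [b] \<odot>\<^bsub>E1\<^esub> \<sigma> = \<zero>\<^bsub>E1\<^esub>"
proof -
  obtain z where z: "z \<in> carrier E0" "\<And>a. a \<in> carrier radical_module \<Longrightarrow> a \<odot>\<^bsub>E0\<^esub> z = \<eta> (g a)"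
    using injective_radical_extend[OF E0_injective right_module_hom_compose[OF g \<eta>_hom]] by blast
  let ?z = "pe w [] \<odot>\<^bsub>E0\<^esub> z"
  have zc: "?z \<in> carrier E0" using z(1) E0.smult_closed by simp
  have rad: "carrier radical_module \<subseteq> carrier A" by (auto simp: radical_module_def)
  have act: "a \<odot>\<^bsub>E0\<^esub> ?z = \<eta> (g (pe w [] \<otimes>\<^bsub>A\<^esub> a))" if "a \<in> carrier radical_module" for a
  proof -
    have "a \<odot>\<^bsub>E0\<^esub> ?z = (pe w [] \<otimes>\<^bsub>A\<^esub> a) \<odot>\<^bsub>E0\<^esub> z" using that rad z(1) E0.smult_assoc by auto
    then show ?thesis using z(2) radical_left_closed[OF _ that] by simp
  qed
  have gc: "g a \<in> carrier A" if "a \<in> carrier radical_module" for a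
    using right_module_homD(1)[OF g that] by simp
  show ?thesis
  proof (rule that[of "d ?z"])
    show "d ?z \<in> carrier E1" using dD(1) zc by blast
    show "d ?z \<noteq> \<zero>\<^bsub>E1\<^esub>"
    proof
      assume "d ?z = \<zero>\<^bsub>E1\<^esub>"
      then have "?z \<in> \<eta> ` carrier A" using \<eta>_image zc by (simp add: a_kernel_def')
      then obtain c where c: "c \<in> carrier A" "?z = \<eta> c" by blast
      have "g (pe w [] \<otimes>\<^bsub>A\<^esub> a) = c \<otimes>\<^bsub>A\<^esub> a" if a: "a \<in> carrier radical_module" for a
      proof (rule inj_onD[OF \<eta>_inj])
        show "\<eta> (g (pe w [] \<otimes>\<^bsub>A\<^esub> a)) = \<eta> (c \<otimes>\<^bsub>A\<^esub> a)" using act[OF a] c \<eta>D(3)[of a c] a rad by auto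
        show "g (pe w [] \<otimes>\<^bsub>A\<^esub> a) \<in> carrier A" using gc radical_left_closed[OF _ a] by simp
        show "c \<otimes>\<^bsub>A\<^esub> a \<in> carrier A" using c a rad by auto
      qed
      then show False using nonrep c(1) by blast
    qed
    have "pe w [] \<odot>\<^bsub>E0\<^esub> ?z = ?z"
      using E0.smult_assoc[of "pe w []" "pe w []" z] z(1) by (simp add: pe_mult)
    then show "pe w [] \<odot>\<^bsub>E1\<^esub> d ?z = d ?z" using dD(3)[of "pe w []" ?z] zc by simp
    fix b
    have "pe (tail Q b) [b] \<odot>\<^bsub>E0\<^esub> ?z \<in> \<eta> ` carrier A"
      using act[of "pe (tail Q b) [b]"] pe_radical[of "[b]"] gc[OF radical_left_closed[of "pe w []" "pe (tail Q b) [b]"]]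
      by simp
    then have "d (pe (tail Q b) [b] \<odot>\<^bsub>E0\<^esub> ?z) = \<zero>\<^bsub>E1\<^esub>" using \<eta>_image by (simp add: a_kernel_def')
    then show "pe (tail Q b) [b] \<odot>\<^bsub>E1\<^esub> d ?z = \<zero>\<^bsub>E1\<^esub>" using dD(3)[of "pe (tail Q b) [b]" ?z] zc by simp
  qed
qed

text \<open>
  An element of the syzygy with an annihilator in \<open>A\<close> that \<open>e\<^sub>z A\<close> does not have cannot be
  part of a basis of the projective module \<open>P1\<close>, so it lies in the radical of \<open>P1\<close>.
\<close>

lemma syzygy_radical:
  assumes \<omega>: "\<omega> \<in> carrier P1" "pe z [] \<odot>\<^bsub>P1\<^esub> \<omega> = \<omega>" and q: "(z, q) \<in> N" "pe z q \<odot>\<^bsub>P1\<^esub> \<omega> = \<zero>\<^bsub>P1\<^esub>"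
    and \<theta>: "\<theta> \<in> carrier P0"
    and eq: "\<And>f u p. f \<in> right_module_hom A P0 (regular_module A) \<Longrightarrow>
      cf (f (\<delta> \<omega>)) (u, p @ [b]) = cf (f \<theta> \<otimes>\<^bsub>A\<^esub> pe (tail Q b) [b]) (u, p @ [b])"
  obtains \<theta>' where "\<theta>' \<in> carrier P0" "\<epsilon> \<theta>' = \<epsilon> \<theta>" "pe (tail Q b) [b] \<odot>\<^bsub>P0\<^esub> \<theta>' = \<zero>\<^bsub>P0\<^esub>"
proof -
  \<comment> \<open>A nonzero coefficient at a trivial path would sit at \<open>z\<close> and
    survive multiplication by \<open>q\<close>, although \<open>q\<close> kills
    \<open>\<omega>\<close>.\<close>
  have rad: "cf (f \<omega>) (u, []) = 0" if f: "f \<in> right_module_hom A P1 (regular_module A)" for f u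
  proof (rule ccontr)
    assume nz: "cf (f \<omega>) (u, []) \<noteq> 0"
    note fD = right_module_homD[OF f, simplified]
    have f\<omega>: "f \<omega> \<in> carrier A" using fD(1) \<omega>(1) by blast
    have "f \<omega> = f \<omega> \<otimes>\<^bsub>A\<^esub> pe z []" using fD(3)[of "pe z []" \<omega>] \<omega> by simp
    then have "u = z" using cf_mult_pe_nonzero[OF f\<omega>, of z "[]" u "[]"] nz by auto
    moreover have "f \<omega> \<otimes>\<^bsub>A\<^esub> pe z q = \<zero>\<^bsub>A\<^esub>"
      using fD(3)[of "pe z q" \<omega>] \<omega>(1) q(2) right_module_hom_zero[OF f P1.M.abelian_group_axioms reg_group] by simp
    ultimately show False using cf_mult_pe[OF f\<omega>, of z "[]" q] q(1) nz by (simp add: cf_zero)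
  qed
  obtain \<omega>' where \<omega>': "\<omega>' \<in> carrier P1"
    "\<And>f u p. f \<in> right_module_hom A P1 (regular_module A) \<Longrightarrow>
       cf (f \<omega>) (u, p @ [b]) = cf (f \<omega>' \<otimes>\<^bsub>A\<^esub> pe (tail Q b) [b]) (u, p @ [b])"
    by (rule projective_radical[OF P1_projective \<omega>(1), of b], rule rad, assumption) blast
  \<comment> \<open>By \<open>eq\<close> the part of \<open>\<delta> \<omega>\<close> ending in
    \<open>b\<close> is \<open>\<theta>\<close> times \<open>b\<close>, and by choice of
    \<open>\<omega>'\<close> it is also \<open>\<delta> \<omega>'\<close> times \<open>b\<close>.
    The difference is therefore killed by \<open>b\<close>, and its image in \<open>E1\<close> is
    that of \<open>\<theta>\<close> by exactness.\<close>
  let ?\<theta> = "\<theta> \<ominus>\<^bsub>P0\<^esub> \<delta> \<omega>'"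
  have \<delta>\<omega>': "\<delta> \<omega>' \<in> carrier P0" using \<delta>D(1) \<omega>'(1) by blast
  have \<theta>': "?\<theta> \<in> carrier P0" using \<theta> \<delta>\<omega>' by simp
  have "\<epsilon> ?\<theta> = \<epsilon> \<theta> \<ominus>\<^bsub>E1\<^esub> \<epsilon> (\<delta> \<omega>')"
    by (rule right_module_hom_minus[OF \<epsilon>_hom P0.M.abelian_group_axioms E1.M.abelian_group_axioms \<theta> \<delta>\<omega>'])
  then have "\<epsilon> ?\<theta> = \<epsilon> \<theta>" using \<epsilon>_\<delta>[OF \<omega>'(1)] \<epsilon>D(1)[OF \<theta>] by (simp add: E1.M.minus_eq)
  moreover have "pe (tail Q b) [b] \<odot>\<^bsub>P0\<^esub> ?\<theta> = \<zero>\<^bsub>P0\<^esub>"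
  proof (rule ccontr)
    assume nz: "pe (tail Q b) [b] \<odot>\<^bsub>P0\<^esub> ?\<theta> \<noteq> \<zero>\<^bsub>P0\<^esub>"
    obtain f where f: "f \<in> right_module_hom A P0 (regular_module A)" "f (pe (tail Q b) [b] \<odot>\<^bsub>P0\<^esub> ?\<theta>) \<noteq> \<zero>\<^bsub>A\<^esub>"
      using projective_torsionless[OF P0_projective P0.smult_closed[OF pe_closed \<theta>'] nz] by blast
    note fD = right_module_homD[OF f(1), simplified]
    have c: "f \<theta> \<in> carrier A" "f (\<delta> \<omega>') \<in> carrier A" using fD(1) \<theta> \<delta>\<omega>' by auto
    have "f ?\<theta> = f \<theta> \<ominus>\<^bsub>A\<^esub> f (\<delta> \<omega>')"
      using right_module_hom_minus[OF f(1) P0.M.abelian_group_axioms reg_group \<theta> \<delta>\<omega>']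
      by (simp add: a_minus_def a_inv_def regular_module_def m_inv_def)
    then have f\<theta>: "f (pe (tail Q b) [b] \<odot>\<^bsub>P0\<^esub> ?\<theta>) =
        f \<theta> \<otimes>\<^bsub>A\<^esub> pe (tail Q b) [b] \<ominus>\<^bsub>A\<^esub> f (\<delta> \<omega>') \<otimes>\<^bsub>A\<^esub> pe (tail Q b) [b]"
      using fD(3)[of "pe (tail Q b) [b]" ?\<theta>] \<theta>' c
      by (simp add: A.minus_eq A.l_distr A.l_minus)
    obtain u r where ur: "cf (f (pe (tail Q b) [b] \<odot>\<^bsub>P0\<^esub> ?\<theta>)) (u, r) \<noteq> 0"
      using nonzero_cf[OF _ f(2)] fD(1) P0.smult_closed[OF pe_closed \<theta>'] by metis
    then have "cf (f ?\<theta> \<otimes>\<^bsub>A\<^esub> pe (tail Q b) [b]) (u, r) \<noteq> 0" using fD(3)[of "pe (tail Q b) [b]" ?\<theta>] \<theta>' by simp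
    then obtain p where p: "r = p @ [b]" using cf_mult_pe_nonzero[of "f ?\<theta>"] fD(1) \<theta>' by metis
    have "cf (f \<theta> \<otimes>\<^bsub>A\<^esub> pe (tail Q b) [b]) (u, p @ [b]) = cf (f (\<delta> \<omega>')  \<otimes>\<^bsub>A\<^esub> pe (tail Q b) [b]) (u, p @ [b])"
      using eq[OF f(1)] \<omega>'(2)[OF right_module_hom_compose[OF \<delta>_hom f(1)]] by simp
    then show False using ur c unfolding f\<theta> p by (simp add: cf_minus)
  qed
  ultimately show ?thesis using that \<theta>' by blast
qed

lemma syzygy_lift:
  assumes "\<omega> \<in> carrier P0" "\<epsilon> \<omega> = \<zero>\<^bsub>E1\<^esub>"
  obtains \<omega>' where "\<omega>' \<in> carrier P1" "\<delta> \<omega>' = \<omega>"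
    "\<And>a. \<lbrakk>a \<in> carrier A; a \<odot>\<^bsub>P0\<^esub> \<omega> = \<zero>\<^bsub>P0\<^esub>\<rbrakk> \<Longrightarrow> a \<odot>\<^bsub>P1\<^esub> \<omega>' = \<zero>\<^bsub>P1\<^esub>"
    "\<And>a. \<lbrakk>a \<in> carrier A; a \<odot>\<^bsub>P0\<^esub> \<omega> = \<omega>\<rbrakk> \<Longrightarrow> a \<odot>\<^bsub>P1\<^esub> \<omega>' = \<omega>'"
proof -
  have "\<omega> \<in> \<delta> ` carrier P1" using assms \<delta>_image by (simp add: a_kernel_def')
  then obtain \<omega>' where \<omega>': "\<omega>' \<in> carrier P1" "\<delta> \<omega>' = \<omega>" by blast
  show ?thesis
  proof (rule that[OF \<omega>'])
    fix a assume a: "a \<in> carrier A"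
    have c: "a \<odot>\<^bsub>P1\<^esub> \<omega>' \<in> carrier P1" using P1.smult_closed a \<omega>' by blast
    show "a \<odot>\<^bsub>P1\<^esub> \<omega>' = \<zero>\<^bsub>P1\<^esub>" if "a \<odot>\<^bsub>P0\<^esub> \<omega> = \<zero>\<^bsub>P0\<^esub>"
      using inj_onD[OF \<delta>_inj _ c P1.M.zero_closed] \<delta>D(3)[OF a \<omega>'(1)] \<omega>'(2) that \<delta>_zero by simp
    show "a \<odot>\<^bsub>P1\<^esub> \<omega>' = \<omega>'" if "a \<odot>\<^bsub>P0\<^esub> \<omega> = \<omega>"
      using inj_onD[OF \<delta>_inj _ c \<omega>'(1)] \<delta>D(3)[OF a \<omega>'(1)] \<omega>'(2) that by simp
  qed
qed

text \<open>If both products vanished, the difference of lifts of the two paths, cut right after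
  \<open>d1\<close> and \<open>d2\<close>, would be a syzygy killed by the nonzero path
  \<open>q\<close>. By \<open>syzygy_radical\<close> the lift before \<open>d1\<close> could then be
  corrected to one killed by \<open>d1\<close>. As \<open>\<sigma>\<close> is reached from there
  through \<open>d1 # s\<close>, it would be zero.\<close>

lemma socle_element_cond:
  assumes y: "y \<in> verts Q" and \<sigma>: "\<sigma> \<in> carrier E1" "\<sigma> \<noteq> \<zero>\<^bsub>E1\<^esub>" "pe y [] \<odot>\<^bsub>E1\<^esub> \<sigma> = \<sigma>"
    and soc: "\<And>b. pe (tail Q b) [b] \<odot>\<^bsub>E1\<^esub> \<sigma> = \<zero>\<^bsub>E1\<^esub>"
  shows "socle_cond y"
  unfolding socle_cond_def
proof (intro allI impI)
  fix x1 x2 w1 w2 d1 d2 s q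
  assume d12: "d1 \<noteq> d2" and n1: "(x1, w1 @ d1 # s) \<in> N" and n2: "(x2, w2 @ d2 # s) \<in> N"
    and t1: "target Q x1 (w1 @ d1 # s) = y" and t2: "target Q x2 (w2 @ d2 # s) = y"
    and q: "(head Q d1, q) \<in> N"
  show "(x1, w1 @ d1 # q) \<in> N \<or> (x2, w2 @ d2 # q) \<in> N"
  proof (rule ccontr)
    assume "\<not> ?thesis"
    then have no: "(x1, w1 @ d1 # q) \<notin> N" "(x2, w2 @ d2 # q) \<notin> N" by auto
    let ?z = "head Q d1"
    have m1: "target Q x1 w1 = tail Q d1" "(?z, s) \<in> N" and m2: "(head Q d2, s) \<in> N"
      using N_suffix[OF n1] N_suffix[OF n2] N_Cons by blast+
    have z2: "head Q d2 = ?z" using N_start_unique[of "head Q d2" "[]" s ?z] m1 m2 t1 t2 by simp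
    obtain \<xi> where \<xi>: "\<And>x c. (x, c) \<in> N \<Longrightarrow> \<xi> x c \<in> carrier E1"
      "\<And>x t s. (x, t @ s) \<in> N \<Longrightarrow> pe x t \<odot>\<^bsub>E1\<^esub> \<xi> x (t @ s) = \<xi> (target Q x t) s"
      "\<xi> y [] = \<sigma>"
      using injective_dual_family[OF E1_injective y \<sigma>(1,3) soc] by metis
    obtain \<rho>1 where \<rho>1: "\<rho>1 \<in> carrier P0" "\<epsilon> \<rho>1 = \<xi> x1 (w1 @ d1 # s)"
      using \<xi>(1)[OF n1] \<epsilon>_surj by (metis imageE)
    obtain \<rho>2 where \<rho>2: "\<rho>2 \<in> carrier P0" "\<epsilon> \<rho>2 = \<xi> x2 (w2 @ d2 # s)"
      using \<xi>(1)[OF n2] \<epsilon>_surj by (metis imageE)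
    let ?a1 = "pe x1 (w1 @ [d1]) \<odot>\<^bsub>P0\<^esub> \<rho>1" and ?a2 = "pe x2 (w2 @ [d2]) \<odot>\<^bsub>P0\<^esub> \<rho>2"
    \<comment> \<open>Both summands lie over the same element \<open>\<xi> ?z s\<close>, because the
      two paths agree after \<open>d1\<close> and \<open>d2\<close>.\<close>
    let ?\<omega> = "?a1 \<ominus>\<^bsub>P0\<^esub> ?a2"
    have ac: "?a1 \<in> carrier P0" "?a2 \<in> carrier P0" using \<rho>1 \<rho>2 P0.smult_closed by auto
    have \<omega>c: "?\<omega> \<in> carrier P0" using ac by simp
    have "\<epsilon> ?a1 = \<xi> ?z s" "\<epsilon> ?a2 = \<xi> ?z s"
      using \<epsilon>D(3)[of "pe x1 (w1 @ [d1])" \<rho>1] \<epsilon>D(3)[of "pe x2 (w2 @ [d2])" \<rho>2] \<rho>1 \<rho>2 z2 n1 n2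
        \<xi>(2)[of x1 "w1 @ [d1]" s] \<xi>(2)[of x2 "w2 @ [d2]" s] by auto
    then have "\<epsilon> ?\<omega> = \<zero>\<^bsub>E1\<^esub>"
      using right_module_hom_minus[OF \<epsilon>_hom P0.M.abelian_group_axioms E1.M.abelian_group_axioms ac] \<xi>(1)[OF m1(2)]
      by (simp add: E1.M.minus_eq E1.M.r_neg)
    then obtain \<omega> where \<omega>: "\<omega> \<in> carrier P1" "\<delta> \<omega> = ?\<omega>"
      "\<And>a. \<lbrakk>a \<in> carrier A; a \<odot>\<^bsub>P0\<^esub> ?\<omega> = \<zero>\<^bsub>P0\<^esub>\<rbrakk> \<Longrightarrow> a \<odot>\<^bsub>P1\<^esub> \<omega> = \<zero>\<^bsub>P1\<^esub>"
      "\<And>a. \<lbrakk>a \<in> carrier A; a \<odot>\<^bsub>P0\<^esub> ?\<omega> = ?\<omega>\<rbrakk> \<Longrightarrow> a \<odot>\<^bsub>P1\<^esub> \<omega> = \<omega>"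
      by (rule syzygy_lift[OF \<omega>c]) blast
    have act: "pe ?z v \<odot>\<^bsub>P0\<^esub> ?\<omega> =
      pe x1 (w1 @ d1 # v) \<odot>\<^bsub>P0\<^esub> \<rho>1 \<ominus>\<^bsub>P0\<^esub> pe x2 (w2 @ d2 # v) \<odot>\<^bsub>P0\<^esub> \<rho>2" for v
      using P0.smult_minus_right[OF pe_closed ac, of ?z v] P0.smult_assoc[OF pe_closed pe_closed \<rho>1(1), of x1 "w1 @ [d1]" ?z v]
        P0.smult_assoc[OF pe_closed pe_closed \<rho>2(1), of x2 "w2 @ [d2]" ?z v] z2
      by (simp add: pe_mult)
    have \<omega>z: "pe ?z [] \<odot>\<^bsub>P1\<^esub> \<omega> = \<omega>" using act[of "[]"] by (intro \<omega>(4)) auto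
    have \<omega>q: "pe ?z q \<odot>\<^bsub>P1\<^esub> \<omega> = \<zero>\<^bsub>P1\<^esub>"
      using act[of q] no pe_zero \<rho>1 \<rho>2 by (intro \<omega>(3)) (auto simp: P0.smult_zero_left P0.M.minus_eq)
    let ?\<theta> = "pe x1 w1 \<odot>\<^bsub>P0\<^esub> \<rho>1"
    have \<theta>c: "?\<theta> \<in> carrier P0" using \<rho>1 P0.smult_closed by simp
    have eq: "cf (f (\<delta> \<omega>)) (u, p @ [d1]) = cf (f ?\<theta> \<otimes>\<^bsub>A\<^esub> pe (tail Q d1) [d1]) (u, p @ [d1])"
      if f: "f \<in> right_module_hom A P0 (regular_module A)" for f u p
    proof -
      note fD = right_module_homD[OF f, simplified]
      have c: "f \<rho>1 \<in> carrier A" "f \<rho>2 \<in> carrier A" using fD(1) \<rho>1 \<rho>2 by auto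
      have "f ?\<omega> \<oplus>\<^bsub>A\<^esub> f ?a2 = f ?a1"
        using fD(2)[of ?\<omega> ?a2] ac \<omega>c by (simp add: P0.M.minus_eq P0.M.a_assoc P0.M.l_neg)
      then have "cf (f ?\<omega>) r + cf (f ?a2) r = cf (f ?a1) r" for r
        using cf_add[of "f ?\<omega>" "f ?a2" r] fD(1) ac \<omega>c by simp
      \<comment> \<open>Under maps to \<open>A\<close> the second summand yields paths ending in
        \<open>d2\<close>, so at paths ending in \<open>d1\<close> only the first
        contributes.\<close>
      moreover have "cf (f ?a2) (u, p @ [d1]) = 0"
      proof (rule ccontr)
        assume "cf (f ?a2) (u, p @ [d1]) \<noteq> 0"
        then have "cf (f \<rho>2 \<otimes>\<^bsub>A\<^esub> pe x2 (w2 @ [d2])) (u, p @ [d1]) \<noteq> 0" using fD(3) \<rho>2 by simp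
        then obtain p' where "p @ [d1] = p' @ w2 @ [d2]" using cf_mult_pe_nonzero[OF c(2)] by metis
        then show False using d12 by (simp flip: append_assoc)
      qed
      moreover have "f ?a1 = f ?\<theta> \<otimes>\<^bsub>A\<^esub> pe (tail Q d1) [d1]"
        using fD(3) \<rho>1(1) c(1) m1(1) by (simp add: A.m_assoc pe_mult)
      ultimately show ?thesis using \<omega>(2) by (metis add.right_neutral)
    qed
    obtain \<theta> where \<theta>: "\<theta> \<in> carrier P0" "\<epsilon> \<theta> = \<epsilon> ?\<theta>" "pe (tail Q d1) [d1] \<odot>\<^bsub>P0\<^esub> \<theta> = \<zero>\<^bsub>P0\<^esub>"
      using syzygy_radical[OF \<omega>(1) \<omega>z q \<omega>q \<theta>c eq] by blast
    have x1c: "\<xi> x1 (w1 @ d1 # s) \<in> carrier E1" using \<xi>(1) n1 .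
    have "\<sigma> = pe x1 (w1 @ d1 # s) \<odot>\<^bsub>E1\<^esub> \<xi> x1 (w1 @ d1 # s)"
      using \<xi>(2)[of x1 "w1 @ d1 # s" "[]"] \<xi>(3) n1 t1 by simp
    also have "pe x1 (w1 @ d1 # s) = pe x1 w1 \<otimes>\<^bsub>A\<^esub> pe (tail Q d1) (d1 # s)"
      using m1 by (simp add: pe_mult)
    also have "\<dots> \<odot>\<^bsub>E1\<^esub> \<xi> x1 (w1 @ d1 # s) = pe (tail Q d1) (d1 # s) \<odot>\<^bsub>E1\<^esub> \<epsilon> \<theta>"
      using \<theta>(2) \<epsilon>D(3)[of "pe x1 w1" \<rho>1] \<rho>1 x1c by (simp add: E1.smult_assoc)
    also have "\<dots> = \<epsilon> (pe (tail Q d1) (d1 # s) \<odot>\<^bsub>P0\<^esub> \<theta>)" using \<epsilon>D(3) \<theta>(1) by simp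
    also have "pe (tail Q d1) (d1 # s) = pe (tail Q d1) [d1] \<otimes>\<^bsub>A\<^esub> pe ?z s" by (simp add: pe_mult)
    also have "\<dots> \<odot>\<^bsub>P0\<^esub> \<theta> = \<zero>\<^bsub>P0\<^esub>" using \<theta> by (simp add: P0.smult_assoc P0.smult_zero_right)
    finally show False using \<epsilon>_zero \<sigma>(2) by simp
  qed
qed

lemma out_socle:
  assumes b: "b1 \<in> arcs Q" "b2 \<in> arcs Q" "b1 \<noteq> b2" "tail Q b1 = y" "tail Q b2 = y"
  shows "socle_cond y"
proof -
  have y: "y \<in> verts Q" using b wellformed(1) by blast
  \<comment> \<open>Right multiplication keeps the first arrow, so selecting the paths that begin
    with \<open>b1\<close> is a module map on the radical.\<close>
  define F where "F x = (\<lambda>(u, p). if p \<noteq> [] \<and> hd p = b1 then cf x (u, p) else 0)" for x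
  define g where "g x = elt (F x)" for x
  have g: "g x \<in> carrier A" "cf (g x) (u, p) = (if p \<noteq> [] \<and> hd p = b1 then cf x (u, p) else 0)"
    if "x \<in> carrier A" for x u p
  proof -
    have "F x r = 0" if "r \<notin> N" for r
      using cf_support[OF \<open>x \<in> carrier A\<close> that] by (cases r) (simp add: F_def)
    then show "g x \<in> carrier A" "cf (g x) (u, p) = (if p \<noteq> [] \<and> hd p = b1 then cf x (u, p) else 0)"
      using elt[of "F x"] unfolding g_def by (auto simp: F_def)
  qed
  have ghom: "g \<in> right_module_hom A radical_module (regular_module A)"
  proof (rule right_module_homI)
    fix x assume x: "x \<in> carrier radical_module"
    then have xA: "x \<in> carrier A" and x0: "\<And>u. cf x (u, []) = 0" by (auto simp: radical_module_def)
    show "g x \<in> carrier (regular_module A)" using g xA by simp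
    show "g (x \<oplus>\<^bsub>radical_module\<^esub> x') = g x \<oplus>\<^bsub>regular_module A\<^esub> g x'" if "x' \<in> carrier radical_module" for x'
      using that xA g by (intro cf_eqI) (auto simp: radical_module_def cf_add)
    fix a assume a: "a \<in> carrier A"
    have "g (x \<otimes>\<^bsub>A\<^esub> a) = g x \<otimes>\<^bsub>A\<^esub> a"
    proof (rule cf_eqI)
      fix u p assume N: "(u, p) \<in> N"
      have "cf (g x) (u, take i p) = (if p \<noteq> [] \<and> hd p = b1 then cf x (u, take i p) else 0)" for i
        using g(2)[OF xA] x0 by (cases i; cases p) auto
      then show "cf (g (x \<otimes>\<^bsub>A\<^esub> a)) (u, p) = cf (g x \<otimes>\<^bsub>A\<^esub> a) (u, p)"
        using g xA a by (simp add: cf_mult N)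
    qed (use g xA a in auto)
    then show "g (a \<odot>\<^bsub>radical_module\<^esub> x) = a \<odot>\<^bsub>regular_module A\<^esub> g x" by (simp add: radical_module_def)
  qed
  have nonrep: "\<not> (\<exists>c\<in>carrier A. \<forall>a\<in>carrier radical_module. g (pe y [] \<otimes>\<^bsub>A\<^esub> a) = c \<otimes>\<^bsub>A\<^esub> a)"
  proof
    assume "\<exists>c\<in>carrier A. \<forall>a\<in>carrier radical_module. g (pe y [] \<otimes>\<^bsub>A\<^esub> a) = c \<otimes>\<^bsub>A\<^esub> a"
    then obtain c where c: "c \<in> carrier A"
      "\<forall>a\<in>carrier radical_module. g (pe y [] \<otimes>\<^bsub>A\<^esub> a) = c \<otimes>\<^bsub>A\<^esub> a" by (rule bexE)
    have cb: "g (pe y [b]) = c \<otimes>\<^bsub>A\<^esub> pe y [b]" for b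
      using bspec[OF c(2) pe_radical[of "[b]" y]] by (simp add: pe_mult)
    have n: "(y, [b1]) \<in> N" "(y, [b2]) \<in> N" using arrow_in_N[OF b(1)] arrow_in_N[OF b(2)] b(4,5) by auto
    \<comment> \<open>Comparison at \<open>b1\<close> makes this coefficient of \<open>c\<close>
      one, comparison at \<open>b2\<close> makes it zero.\<close>
    have "cf c (y, []) = cf (g (pe y [b])) (y, [b])" if "(y, [b]) \<in> N" for b
      using cf_mult_pe[OF c(1), of y "[]" "[b]"] cb that by simp
    from this[OF n(1)] this[OF n(2)] show False using g(2)[OF pe_closed] n b(3) by (simp add: cf_pe)
  qed
  obtain \<sigma> where "\<sigma> \<in> carrier E1" "\<sigma> \<noteq> \<zero>\<^bsub>E1\<^esub>" "pe y [] \<odot>\<^bsub>E1\<^esub> \<sigma> = \<sigma>"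
    "\<And>b. pe (tail Q b) [b] \<odot>\<^bsub>E1\<^esub> \<sigma> = \<zero>\<^bsub>E1\<^esub>"
    by (rule cosyzygy_socle[OF ghom y nonrep]) blast
  then show ?thesis by (rule socle_element_cond[OF y])
qed

text \<open>The map on the radical is cancellation of the first arrow \<open>a\<close>;
  \<open>free\<close> makes it compatible with products. It sends \<open>a\<close> to a trivial
  path, whereas a left multiple of \<open>a\<close> has no coefficient at trivial paths.\<close>

lemma in_socle:
  assumes a: "a \<in> arcs Q" and free: "\<And>v. (head Q a, v) \<in> N \<Longrightarrow> (tail Q a, a # v) \<in> N"
  obtains \<sigma> where "\<sigma> \<in> carrier E1" "\<sigma> \<noteq> \<zero>\<^bsub>E1\<^esub>" "pe (tail Q a) [] \<odot>\<^bsub>E1\<^esub> \<sigma> = \<sigma>"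
    "\<And>b. pe (tail Q b) [b] \<odot>\<^bsub>E1\<^esub> \<sigma> = \<zero>\<^bsub>E1\<^esub>"
proof -
  define F where "F x = (\<lambda>(u, p). if u = head Q a \<and> (u, p) \<in> N then cf x (tail Q a, a # p) else 0)" for x
  define g where "g x = elt (F x)" for x
  have g: "g x \<in> carrier A"
    "cf (g x) (u, p) = (if u = head Q a \<and> (u, p) \<in> N then cf x (tail Q a, a # p) else 0)" for x u p
  proof -
    have "F x r = 0" if "r \<notin> N" for r using that by (cases r) (auto simp: F_def)
    then show "g x \<in> carrier A"
      "cf (g x) (u, p) = (if u = head Q a \<and> (u, p) \<in> N then cf x (tail Q a, a # p) else 0)"
      using elt[of "F x"] unfolding g_def by (auto simp: F_def)
  qed
  have ghom: "g \<in> right_module_hom A radical_module (regular_module A)"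
  proof (rule right_module_homI)
    fix x assume x: "x \<in> carrier radical_module"
    then have xA: "x \<in> carrier A" and x0: "\<And>u. cf x (u, []) = 0" by (auto simp: radical_module_def)
    show "g x \<in> carrier (regular_module A)" using g by simp
    show "g (x \<oplus>\<^bsub>radical_module\<^esub> x') = g x \<oplus>\<^bsub>regular_module A\<^esub> g x'" if "x' \<in> carrier radical_module" for x'
      using that xA g by (intro cf_eqI) (auto simp: radical_module_def cf_add)
    fix e assume e: "e \<in> carrier A"
    have "g (x \<otimes>\<^bsub>A\<^esub> e) = g x \<otimes>\<^bsub>A\<^esub> e"
    proof (rule cf_eqI)
      fix u p assume N: "(u, p) \<in> N"
      have Ni: "(u, take i p) \<in> N" for i using N_prefix[of u "take i p" "drop i p"] N by simp
      show "cf (g (x \<otimes>\<^bsub>A\<^esub> e)) (u, p) = cf (g x \<otimes>\<^bsub>A\<^esub> e) (u, p)"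
      proof (cases "u = head Q a")
        case True
        then have "(tail Q a, a # p) \<in> N" using free N by simp
        \<comment> \<open>The factorization that cuts before \<open>a\<close> pairs with a
          coefficient of \<open>x\<close> at a trivial path, which is zero; the remaining cuts shift
          the index by one.\<close>
        then have "cf (x \<otimes>\<^bsub>A\<^esub> e) (tail Q a, a # p) =
          (\<Sum>i\<le>length p. cf x (tail Q a, a # take i p) * cf e (target Q u (take i p), drop i p))"
          using True xA e x0 by (simp add: cf_mult sum.atMost_Suc_shift del: sum.atMost_Suc)
        then show ?thesis using True N Ni g e by (simp add: cf_mult)
      next
        case False
        then show ?thesis using N g e by (simp add: cf_mult)
      qed
    qed (use g e in auto)
    then show "g (e \<odot>\<^bsub>radical_module\<^esub> x) = e \<odot>\<^bsub>regular_module A\<^esub> g x" by (simp add: radical_module_def)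
  qed
  have nonrep: "\<not> (\<exists>c\<in>carrier A. \<forall>x\<in>carrier radical_module. g (pe (tail Q a) [] \<otimes>\<^bsub>A\<^esub> x) = c \<otimes>\<^bsub>A\<^esub> x)"
  proof
    assume "\<exists>c\<in>carrier A. \<forall>x\<in>carrier radical_module. g (pe (tail Q a) [] \<otimes>\<^bsub>A\<^esub> x) = c \<otimes>\<^bsub>A\<^esub> x"
    then obtain c where c: "c \<in> carrier A" "g (pe (tail Q a) [a]) = c \<otimes>\<^bsub>A\<^esub> pe (tail Q a) [a]"
      using pe_radical[of "[a]" "tail Q a"] by (fastforce simp: pe_mult)
    have "(head Q a, []) \<in> N" "(tail Q a, [a]) \<in> N" using trivial_in_N arrow_in_N a wellformed(2) by blast+
    then have "cf (c \<otimes>\<^bsub>A\<^esub> pe (tail Q a) [a]) (head Q a, []) \<noteq> 0"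
      using g(2)[of "pe (tail Q a) [a]"] c(2) by (simp add: cf_pe)
    then show False using cf_mult_pe_nonzero[OF c(1)] by blast
  qed
  have "tail Q a \<in> verts Q" using a wellformed(1) by blast
  from cosyzygy_socle[OF ghom this nonrep] show ?thesis using that by blast
qed

text \<open>If \<open>c @ a # v\<close> were zero, a lift of \<open>\<xi> x c\<close> times
  \<open>c @ [a]\<close> would be a syzygy killed by \<open>v\<close>, and
  \<open>syzygy_radical\<close> would give a lift of \<open>\<sigma>\<close> killed by
  \<open>a\<close>. A map to \<open>A\<close> detects this lift by a path into the start of
  \<open>a\<close>, and by \<open>right\<close> multiplication with \<open>a\<close> does not kill
  that path.\<close>

lemma resolution_arrow_free:
  assumes a: "a \<in> arcs Q" and free: "\<And>v. (head Q a, v) \<in> N \<Longrightarrow> (tail Q a, a # v) \<in> N"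
    and right: "\<And>x c. \<lbrakk>(x, c) \<in> N; target Q x c = tail Q a\<rbrakk> \<Longrightarrow> (x, c @ [a]) \<in> N"
    and c: "(x, c) \<in> N" "target Q x c = tail Q a" and v: "(head Q a, v) \<in> N"
  shows "(x, c @ a # v) \<in> N"
proof (rule ccontr)
  assume no: "(x, c @ a # v) \<notin> N"
  obtain \<sigma> where \<sigma>: "\<sigma> \<in> carrier E1" "\<sigma> \<noteq> \<zero>\<^bsub>E1\<^esub>" "pe (tail Q a) [] \<odot>\<^bsub>E1\<^esub> \<sigma> = \<sigma>"
    and soc: "\<And>b. pe (tail Q b) [b] \<odot>\<^bsub>E1\<^esub> \<sigma> = \<zero>\<^bsub>E1\<^esub>"
    using in_socle[OF a free] by blast
  have y: "tail Q a \<in> verts Q" using a wellformed(1) by blast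
  obtain \<xi> where \<xi>: "\<And>x c. (x, c) \<in> N \<Longrightarrow> \<xi> x c \<in> carrier E1"
    "\<And>x t s. (x, t @ s) \<in> N \<Longrightarrow> pe x t \<odot>\<^bsub>E1\<^esub> \<xi> x (t @ s) = \<xi> (target Q x t) s"
    "\<xi> (tail Q a) [] = \<sigma>"
    using injective_dual_family[OF E1_injective y \<sigma>(1,3) soc] by metis
  obtain \<rho> where \<rho>: "\<rho> \<in> carrier P0" "\<epsilon> \<rho> = \<xi> x c"
    using \<xi>(1)[OF c(1)] \<epsilon>_surj by (metis imageE)
  let ?\<omega> = "pe x (c @ [a]) \<odot>\<^bsub>P0\<^esub> \<rho>" and ?\<theta> = "pe x c \<odot>\<^bsub>P0\<^esub> \<rho>"
  have cl: "?\<omega> \<in> carrier P0" "?\<theta> \<in> carrier P0" using \<rho> P0.smult_closed by auto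
  have \<epsilon>\<theta>: "\<epsilon> ?\<theta> = \<sigma>" using \<epsilon>D(3)[of "pe x c" \<rho>] \<rho> \<xi>(2)[of x c "[]"] \<xi>(3) c by simp
  have \<omega>\<theta>: "?\<omega> = pe (tail Q a) [a] \<odot>\<^bsub>P0\<^esub> ?\<theta>"
    using P0.smult_assoc[OF pe_closed pe_closed \<rho>(1), of x c "tail Q a" "[a]"] c by (simp add: pe_mult)
  have "\<epsilon> ?\<omega> = \<zero>\<^bsub>E1\<^esub>" using \<epsilon>D(3)[of "pe (tail Q a) [a]" ?\<theta>] cl \<epsilon>\<theta> soc \<omega>\<theta> by simp
  then obtain \<omega> where \<omega>: "\<omega> \<in> carrier P1" "\<delta> \<omega> = ?\<omega>"
    "\<And>a. \<lbrakk>a \<in> carrier A; a \<odot>\<^bsub>P0\<^esub> ?\<omega> = \<zero>\<^bsub>P0\<^esub>\<rbrakk> \<Longrightarrow> a \<odot>\<^bsub>P1\<^esub> \<omega> = \<zero>\<^bsub>P1\<^esub>"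
    "\<And>a. \<lbrakk>a \<in> carrier A; a \<odot>\<^bsub>P0\<^esub> ?\<omega> = ?\<omega>\<rbrakk> \<Longrightarrow> a \<odot>\<^bsub>P1\<^esub> \<omega> = \<omega>"
    by (rule syzygy_lift[OF cl(1)]) blast
  have act: "pe (head Q a) t \<odot>\<^bsub>P0\<^esub> ?\<omega> = pe x (c @ a # t) \<odot>\<^bsub>P0\<^esub> \<rho>" for t
    using P0.smult_assoc[OF pe_closed pe_closed \<rho>(1), of x "c @ [a]" "head Q a" t] by (simp add: pe_mult)
  have \<omega>z: "pe (head Q a) [] \<odot>\<^bsub>P1\<^esub> \<omega> = \<omega>" using act[of "[]"] by (intro \<omega>(4)) auto
  have \<omega>v: "pe (head Q a) v \<odot>\<^bsub>P1\<^esub> \<omega> = \<zero>\<^bsub>P1\<^esub>"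
    using act[of v] no pe_zero \<rho> by (intro \<omega>(3)) (auto simp: P0.smult_zero_left)
  have eq: "cf (f (\<delta> \<omega>)) (u, p @ [a]) = cf (f ?\<theta> \<otimes>\<^bsub>A\<^esub> pe (tail Q a) [a]) (u, p @ [a])"
    if f: "f \<in> right_module_hom A P0 (regular_module A)" for f u p
    using right_module_homD(3)[OF f pe_closed cl(2)] \<omega>(2) \<omega>\<theta> by simp
  obtain \<theta> where \<theta>: "\<theta> \<in> carrier P0" "\<epsilon> \<theta> = \<sigma>" "pe (tail Q a) [a] \<odot>\<^bsub>P0\<^esub> \<theta> = \<zero>\<^bsub>P0\<^esub>"
    using syzygy_radical[OF \<omega>(1) \<omega>z v \<omega>v cl(2) eq] \<epsilon>\<theta> by metis
  \<comment> \<open>The trivial path at the start of \<open>a\<close> keeps the image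
    \<open>\<sigma>\<close>, and under maps to \<open>A\<close> it leaves only paths that end where
    \<open>a\<close> starts.\<close>
  let ?\<theta>' = "pe (tail Q a) [] \<odot>\<^bsub>P0\<^esub> \<theta>"
  have \<theta>'c: "?\<theta>' \<in> carrier P0" using \<theta>(1) P0.smult_closed by simp
  have "\<epsilon> ?\<theta>' = \<sigma>" using \<epsilon>D(3)[of "pe (tail Q a) []" \<theta>] \<theta> \<sigma>(3) by simp
  then have nz: "?\<theta>' \<noteq> \<zero>\<^bsub>P0\<^esub>" using \<epsilon>_zero \<sigma>(2) by auto
  obtain f where f: "f \<in> right_module_hom A P0 (regular_module A)" "f ?\<theta>' \<noteq> \<zero>\<^bsub>A\<^esub>"
    using projective_torsionless[OF P0_projective \<theta>'c nz] by blast
  note fD = right_module_homD[OF f(1), simplified]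
  have fc: "f \<theta> \<in> carrier A" "f ?\<theta>' \<in> carrier A" using fD(1) \<theta>(1) \<theta>'c by auto
  obtain u p where up: "(u, p) \<in> N" "cf (f ?\<theta>') (u, p) \<noteq> 0" using nonzero_cf[OF fc(2) f(2)] by blast
  then have "cf (f \<theta> \<otimes>\<^bsub>A\<^esub> pe (tail Q a) []) (u, p) \<noteq> 0" using fD(3)[of _ \<theta>] \<theta>(1) by simp
  then have tp: "target Q u p = tail Q a" using cf_mult_pe_nonzero[OF fc(1), of "tail Q a" "[]" u p] by auto
  have "pe (tail Q a) [a] \<odot>\<^bsub>P0\<^esub> ?\<theta>' = \<zero>\<^bsub>P0\<^esub>"
    using P0.smult_assoc[OF pe_closed pe_closed \<theta>(1), of "tail Q a" "[]" "tail Q a" "[a]"] \<theta>(3) by (simp add: pe_mult)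
  then have "f ?\<theta>' \<otimes>\<^bsub>A\<^esub> pe (tail Q a) [a] = \<zero>\<^bsub>A\<^esub>"
    using fD(3)[OF pe_closed \<theta>'c, of "tail Q a" "[a]"]
      right_module_hom_zero[OF f(1) P0.M.abelian_group_axioms reg_group] by simp
  then show False
    using cf_mult_pe[OF fc(2), of u p "[a]"] right[OF up(1) tp] tp up(2) by (simp add: cf_zero)
qed

sublocale gorenstein_paths Q N
proof
  show "d1 = d2" if "rmax u p" "(x1, d1 # s) \<in> N" "(x2, d2 # s) \<in> N"
    "target Q x1 (d1 # s) = target Q u p" "target Q x2 (d2 # s) = target Q u p" for u p x1 d1 s x2 d2
    using resolution_rmax_coherent that .
  show "b' = b" if "rmax x (r @ b # s)" "lmax x (r @ b # s)" "(x, r @ [b']) \<in> N" for x r b s b'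
    using resolution_bimax_uniserial that .
  show "socle_cond y" if "b1 \<in> arcs Q" "b2 \<in> arcs Q" "b1 \<noteq> b2" "tail Q b1 = y" "tail Q b2 = y" for b1 b2 y
    using out_socle that .
  show "socle_cond (tail Q a)" if "a \<in> arcs Q" "\<And>v. (head Q a, v) \<in> N \<Longrightarrow> (tail Q a, a # v) \<in> N" for a
    using in_socle[OF that] socle_element_cond[OF wellformed(1)[OF that(1)]] by blast
qed (use resolution_arrow_free in blast)

end

section \<open>Monomial ideals\<close>

locale monomial_ideal = fin_digraph Q for Q :: "('v, 'e) pre_digraph" +
  fixes I :: "('v \<times> 'e list \<Rightarrow> 'k::field) set" and S :: "('v \<times> 'e list) set"
  assumes admissible: "admissible_ideal Q I"
    and S_paths: "S \<subseteq> paths Q"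
    and generated: "I = Idl\<^bsub>path_algebra Q\<^esub> (path_elt ` S)"
begin

abbreviation R :: "('k, 'v \<times> 'e list \<Rightarrow> 'k) module" where "R \<equiv> path_algebra Q"

sublocale R: ring R by (rule ring_path_algebra[OF fin_digraph_axioms])

sublocale Id: ideal I R using admissible by (simp add: admissible_ideal_def)

lemma R_carrier: "f \<in> carrier R \<longleftrightarrow> finite {q. f q \<noteq> 0} \<and> {q. f q \<noteq> 0} \<subseteq> paths Q"
  and R_add: "(f \<oplus>\<^bsub>R\<^esub> g) q = f q + g q"
  and R_zero: "\<zero>\<^bsub>R\<^esub> q = 0"
  and R_one: "\<one>\<^bsub>R\<^esub> (u, p) = (if u \<in> verts Q \<and> p = [] then 1 else 0)"
  and R_smult: "(c \<odot>\<^bsub>R\<^esub> f) q = c * f q"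
  by (simp_all add: path_algebra_def)

lemma R_mult: "(f \<otimes>\<^bsub>R\<^esub> g) (u, p) = (\<Sum>i\<le>length p. f (u, take i p) * g (target Q u (take i p), drop i p))"
  by (simp add: path_algebra_def awlast_eq_target)

lemma R_support: "\<lbrakk>f \<in> carrier R; f q \<noteq> 0\<rbrakk> \<Longrightarrow> q \<in> paths Q"
  by (auto simp: R_carrier)

lemma R_uminus:
  assumes "f \<in> carrier R" shows "\<ominus>\<^bsub>R\<^esub> f = (\<lambda>q. - f q)"
  using assms by (intro R.minus_equality) (auto simp: R_carrier path_algebra_def)

lemma R_smult_closed:
  assumes "f \<in> carrier R" shows "c \<odot>\<^bsub>R\<^esub> f \<in> carrier R"
proof -
  have "{q. c * f q \<noteq> 0} \<subseteq> {q. f q \<noteq> 0}" by auto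
  with assms show ?thesis by (auto simp: R_carrier R_smult intro: finite_subset)
qed

lemma path_elt_closed: "r \<in> paths Q \<Longrightarrow> path_elt r \<in> carrier R"
  by (auto simp: R_carrier path_elt_def)

lemma paths_iff: "(u, p) \<in> paths Q \<longleftrightarrow> (\<exists>v. awalk u p v)"
  by (simp add: paths_def)

lemma paths_target: "awalk u p v \<Longrightarrow> v = target Q u p"
  using awlast_eq_target by (metis awalkE)

lemma paths_prefix: "(u, p @ q) \<in> paths Q \<Longrightarrow> (u, p) \<in> paths Q"
  and paths_suffix: "(u, p @ q) \<in> paths Q \<Longrightarrow> (target Q u p, q) \<in> paths Q"
  using paths_target by (auto simp: paths_iff)

lemma paths_appendI: "(u, p) \<in> paths Q \<Longrightarrow> (target Q u p, q) \<in> paths Q \<Longrightarrow> (u, p @ q) \<in> paths Q"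
  using paths_target by (auto simp: paths_iff)

lemma paths_arrow: "a \<in> arcs Q \<Longrightarrow> (tail Q a, [a]) \<in> paths Q"
  using arc_implies_awalk by (auto simp: paths_iff)

lemma path_elt_mult:
  "(path_elt (u, p) \<otimes>\<^bsub>R\<^esub> path_elt (target Q u p, q)) = (path_elt (u, p @ q) :: 'v \<times> 'e list \<Rightarrow> 'k)"
proof
  fix r :: "'v \<times> 'e list"
  obtain w t where r: "r = (w, t)" by fastforce
  have "(path_elt (u, p) \<otimes>\<^bsub>R\<^esub> path_elt (target Q u p, q)) r =
    (\<Sum>i\<le>length t. if i = length p then (if w = u \<and> t = p @ q then 1 else 0) else 0)"
    unfolding r R_mult
  proof (intro sum.cong refl)
    fix i assume i: "i \<in> {..length t}"
    have tk: "take i t = p \<and> drop i t = q \<longleftrightarrow> i = length p \<and> t = p @ q"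
    proof
      assume *: "take i t = p \<and> drop i t = q"
      then have "t = p @ q" using append_take_drop_id[of i t] by simp
      moreover have "length p = i" using * i by (metis atMost_iff length_take min.absorb2)
      ultimately show "i = length p \<and> t = p @ q" by simp
    qed simp
    show "path_elt (u, p) (w, take i t) * path_elt (target Q u p, q) (target Q w (take i t), drop i t) =
      (if i = length p then (if w = u \<and> t = p @ q then 1 else 0 :: 'k) else 0)"
      using tk by (cases "take i t = p"; cases "drop i t = q") (auto simp: path_elt_def)
  qed
  also have "\<dots> = path_elt (u, p @ q) r" by (auto simp: path_elt_def r)
  finally show "(path_elt (u, p) \<otimes>\<^bsub>R\<^esub> path_elt (target Q u p, q)) r = (path_elt (u, p @ q) r :: 'k)" .
qed

lemma arrow_elt_mult:
  assumes "head Q a = tail Q b"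
  shows "arrow_elt Q a \<otimes>\<^bsub>R\<^esub> arrow_elt Q b = (path_elt (tail Q a, [a, b]) :: 'v \<times> 'e list \<Rightarrow> 'k)"
  using path_elt_mult[of "tail Q a" "[a]" "[b]"] assms by (simp add: arrow_elt_def)

text \<open>The value of a product at a path is a sum over its factorizations, and both factors of a
  path in \<open>W\<close> lie in \<open>W\<close> again.\<close>

lemma vanishing_ideal:
  assumes pre: "\<And>u p q. (u, p @ q) \<in> W \<Longrightarrow> (u, p) \<in> W"
    and suf: "\<And>u p q. (u, p @ q) \<in> W \<Longrightarrow> (target Q u p, q) \<in> W"
  shows "ideal {f \<in> carrier R. \<forall>r\<in>W. f r = 0} R"
proof (rule idealI)
  show "ring R" by (rule R.ring_axioms)
  show "subgroup {f \<in> carrier R. \<forall>r\<in>W. f r = 0} (add_monoid R)"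
  proof
    fix f assume f: "f \<in> {f \<in> carrier R. \<forall>r\<in>W. f r = 0}"
    then have "\<ominus>\<^bsub>R\<^esub> f \<in> {f \<in> carrier R. \<forall>r\<in>W. f r = 0}" using R_uminus[of f] R.a_inv_closed[of f] by auto
    then show "inv\<^bsub>add_monoid R\<^esub> f \<in> {f \<in> carrier R. \<forall>r\<in>W. f r = 0}" by (simp add: a_inv_def)
  qed (auto simp: R_add R_zero)
  fix f g assume f: "f \<in> {f \<in> carrier R. \<forall>r\<in>W. f r = 0}" and g: "g \<in> carrier R"
  have "(g \<otimes>\<^bsub>R\<^esub> f) (u, p) = 0 \<and> (f \<otimes>\<^bsub>R\<^esub> g) (u, p) = 0" if "(u, p) \<in> W" for u p
  proof -
    have "(u, take i p) \<in> W" "(target Q u (take i p), drop i p) \<in> W" for i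
      using pre[of u "take i p" "drop i p"] suf[of u "take i p" "drop i p"] that by auto
    then show ?thesis using f unfolding R_mult by simp
  qed
  then show "g \<otimes>\<^bsub>R\<^esub> f \<in> {f \<in> carrier R. \<forall>r\<in>W. f r = 0}" "f \<otimes>\<^bsub>R\<^esub> g \<in> {f \<in> carrier R. \<forall>r\<in>W. f r = 0}"
    using f g by auto
qed

lemma path_elt_factor_in_I:
  assumes "(target Q u p1, s) \<in> paths Q" "path_elt (target Q u p1, s) \<in> I" "(u, p1 @ s @ p2) \<in> paths Q"
  shows "path_elt (u, p1 @ s @ p2) \<in> I"
proof -
  have "(u, p1) \<in> paths Q" "(target Q (target Q u p1) s, p2) \<in> paths Q"
    using paths_prefix[OF assms(3)] paths_suffix[of u "p1 @ s" p2] assms(3) by auto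
  then have "path_elt (u, p1) \<otimes>\<^bsub>R\<^esub> (path_elt (target Q u p1, s) \<otimes>\<^bsub>R\<^esub> path_elt (target Q (target Q u p1) s, p2)) \<in> I"
    using assms(2) path_elt_closed by (intro Id.I_l_closed Id.I_r_closed) auto
  then show ?thesis by (simp add: path_elt_mult)
qed

text \<open>The elements that vanish on all paths without a subpath in \<open>S\<close> form an
  ideal containing the generators. So every path in the support of \<open>f\<close> has a subpath in
  \<open>S\<close> and lies in the ideal on its own.\<close>

lemma coefficient_in_I:
  assumes f: "f \<in> I" and nz: "f r \<noteq> 0" shows "path_elt r \<in> I"
proof -
  let ?W = "{(u, p). \<not> (\<exists>p1 s p2. p = p1 @ s @ p2 \<and> (target Q u p1, s) \<in> S)}"
  let ?K = "{f \<in> carrier R. \<forall>r\<in>?W. f r = 0}"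
  have "ideal ?K R"
  proof (rule vanishing_ideal)
    fix u p q assume "(u, p @ q) \<in> ?W"
    then have no: "\<And>p1 s p2. p @ q = p1 @ s @ p2 \<Longrightarrow> (target Q u p1, s) \<notin> S" by auto
    show "(u, p) \<in> ?W" using no by auto
    show "(target Q u p, q) \<in> ?W" using no[of "p @ _"] by auto
  qed
  moreover have "path_elt ` S \<subseteq> ?K"
  proof
    fix g :: "'v \<times> 'e list \<Rightarrow> 'k" assume "g \<in> path_elt ` S"
    then obtain u p where up: "(u, p) \<in> S" "g = path_elt (u, p)" by auto
    have "(u, p) \<notin> ?W" using up(1) by auto (metis append.right_neutral append_Nil target_Nil)
    then show "g \<in> ?K" using up S_paths path_elt_closed by (auto simp: path_elt_def)
  qed
  ultimately have "I \<subseteq> ?K" unfolding generated by (rule R.genideal_minimal)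
  with f nz have fK: "f \<in> carrier R" "r \<notin> ?W" by auto
  obtain u p where r: "r = (u, p)" by fastforce
  with fK obtain p1 s p2 where p: "p = p1 @ s @ p2" "(target Q u p1, s) \<in> S" by auto
  have "path_elt ` S \<subseteq> I" unfolding generated
    by (rule R.genideal_self) (use S_paths path_elt_closed in auto)
  then have "path_elt (target Q u p1, s) \<in> I" using p(2) by blast
  then show ?thesis
    using path_elt_factor_in_I p S_paths R_support[OF fK(1) nz] unfolding r by auto
qed

lemma I_smult:
  assumes "f \<in> I" shows "c \<odot>\<^bsub>R\<^esub> f \<in> I"
proof -
  have "c \<odot>\<^bsub>R\<^esub> f = (c \<odot>\<^bsub>R\<^esub> \<one>\<^bsub>R\<^esub>) \<otimes>\<^bsub>R\<^esub> f"
  proof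
    fix q :: "'v \<times> 'e list"
    obtain u p where q: "q = (u, p)" by fastforce
    have "((c \<odot>\<^bsub>R\<^esub> \<one>\<^bsub>R\<^esub>) \<otimes>\<^bsub>R\<^esub> f) (u, p) = (\<Sum>i\<le>length p. if i = 0 then (if u \<in> verts Q then c * f (u, p) else 0) else 0)"
      unfolding R_mult by (intro sum.cong refl) (auto simp: R_smult R_one)
    also have "\<dots> = c * f (u, p)"
      using R_support[OF Id.Icarr[OF assms], of "(u, p)"] by (auto simp: paths_iff awalk_def)
    finally show "(c \<odot>\<^bsub>R\<^esub> f) q = ((c \<odot>\<^bsub>R\<^esub> \<one>\<^bsub>R\<^esub>) \<otimes>\<^bsub>R\<^esub> f) q" by (simp add: q R_smult)
  qed
  then show ?thesis using Id.I_l_closed[OF assms] R_smult_closed[OF R.one_closed] by metis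
qed

lemma coefficients_imp_in_I:
  assumes f: "f \<in> carrier R" and c: "\<And>r. f r \<noteq> 0 \<Longrightarrow> path_elt r \<in> I"
  shows "f \<in> I"
proof -
  have "finite T \<Longrightarrow> (\<And>r. g r \<noteq> 0 \<Longrightarrow> r \<in> T \<and> path_elt r \<in> I) \<Longrightarrow> g \<in> I" for T g
  proof (induction T arbitrary: g rule: finite_induct)
    case empty
    then have "g = \<zero>\<^bsub>R\<^esub>" by (auto simp: fun_eq_iff R_zero)
    then show ?case using Id.zero_closed by simp
  next
    case (insert t T)
    have "g(t := 0) \<in> I" using insert.prems by (intro insert.IH) (auto split: if_splits)
    moreover have "g t \<odot>\<^bsub>R\<^esub> path_elt t \<in> I"
    proof (cases "g t = 0")
      case True
      then have "g t \<odot>\<^bsub>R\<^esub> path_elt t = \<zero>\<^bsub>R\<^esub>" by (auto simp: fun_eq_iff R_zero R_smult)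
      then show ?thesis using Id.zero_closed by simp
    qed (use insert.prems I_smult in blast)
    ultimately have "g(t := 0) \<oplus>\<^bsub>R\<^esub> g t \<odot>\<^bsub>R\<^esub> path_elt t \<in> I" by (rule Id.a_closed)
    moreover have "g(t := 0) \<oplus>\<^bsub>R\<^esub> g t \<odot>\<^bsub>R\<^esub> path_elt t = g"
      by (auto simp: fun_eq_iff R_add R_smult path_elt_def)
    ultimately show ?case by simp
  qed
  from this[of "{q. f q \<noteq> 0}" f] show ?thesis using f c by (auto simp: R_carrier)
qed

section \<open>Admissibility and the set of nonzero paths\<close>

lemma arrow_ideal_vanishing:
  assumes "f \<in> arrow_ideal Q" shows "(f :: 'v \<times> 'e list \<Rightarrow> 'k) \<in> carrier R \<and> f (u, []) = 0"
proof -
  have "ideal {f \<in> carrier R. \<forall>r\<in>{(u, p). p = []}. f r = 0} R"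
    by (rule vanishing_ideal) auto
  then have "arrow_ideal Q \<subseteq> {f \<in> carrier R. \<forall>r\<in>{(u, p). p = []}. f r = 0}"
    unfolding arrow_ideal_def
    by (rule R.genideal_minimal) (use paths_arrow path_elt_closed in \<open>auto simp: arrow_elt_def path_elt_def\<close>)
  then show ?thesis using assms by auto
qed

lemma arrow_ideal_square:
  assumes f: "f \<in> arrow_ideal Q [^]\<^bsub>ideals_set R\<^esub> (2::nat)" and p: "length p < 2"
  shows "f (u, p) = 0"
proof -
  let ?J = "arrow_ideal Q :: ('v \<times> 'e list \<Rightarrow> 'k) set"
  \<comment> \<open>The power is computed in the monoid of ideals, whose unit is the whole ring; the
    recursion multiplies it twice by \<open>?J\<close>.\<close>
  have f': "f \<in> ideal_prod R (ideal_prod R (carrier R) ?J) ?J"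
    using f by (simp add: numeral_2_eq_2 ideals_set_def)
  have 1: "g \<in> carrier R \<and> (\<forall>u. g (u, []) = 0)" if "g \<in> ideal_prod R (carrier R) ?J" for g
    using that
  proof induction
    case (prod i j)
    then show ?case using arrow_ideal_vanishing[OF prod(2)] by (simp add: R_mult)
  next
    case (sum s1 s2)
    then show ?case by (intro conjI allI R.a_closed) (auto simp: R_add)
  qed
  have "f (u, p) = 0" if "length p < 2" for u p
    using f' that
  proof induction
    case (prod i j)
    have z: "i (u, take n p) * j (target Q u (take n p), drop n p) = 0" if "n \<le> length p" for n
    proof -
      have "take n p = [] \<or> drop n p = []" using \<open>length p < 2\<close> that by (cases p; cases n) auto
      then show ?thesis using 1[OF prod(1)] arrow_ideal_vanishing[OF prod(2)] by auto
    qed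
    show ?case unfolding R_mult using z by (intro sum.neutral) blast
  qed (simp add: R_add)
  then show ?thesis using p by blast
qed

lemma short_path_not_in_I:
  assumes "length p < 2" shows "path_elt (u, p) \<notin> I"
proof
  assume "path_elt (u, p) \<in> I"
  then have "path_elt (u, p) \<in> arrow_ideal Q [^]\<^bsub>ideals_set R\<^esub> (2::nat)"
    using admissible by (auto simp: admissible_ideal_def)
  from arrow_ideal_square[OF this assms, of u] show False by (simp add: path_elt_def)
qed

lemma path_elt_power:
  assumes "(u, p) \<in> paths Q"
  shows "path_elt (u, p) \<in> arrow_ideal Q [^]\<^bsub>ideals_set R\<^esub> length p"
  using assms
proof (induction p rule: rev_induct)
  case Nil
  then show ?case using path_elt_closed by (simp add: ideals_set_def)
next
  case (snoc a p)
  then have p: "(u, p) \<in> paths Q" and a: "(target Q u p, [a]) \<in> paths Q"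
    using paths_prefix paths_suffix by blast+
  have at: "a \<in> arcs Q" "target Q u p = tail Q a" using a by (auto simp: paths_iff awalk_def)
  have "arrow_elt Q a \<in> (arrow_ideal Q :: ('v \<times> 'e list \<Rightarrow> 'k) set)"
    unfolding arrow_ideal_def
    using R.genideal_self[of "arrow_elt Q ` arcs Q"] paths_arrow path_elt_closed at
    by (auto simp: arrow_elt_def)
  with snoc.IH[OF p] have "path_elt (u, p) \<otimes>\<^bsub>R\<^esub> arrow_elt Q a \<in>
      ideal_prod R (arrow_ideal Q [^]\<^bsub>ideals_set R\<^esub> length p) (arrow_ideal Q)"
    by (rule ideal_prod.prod)
  then show ?case using path_elt_mult[of u p "[a]"] at by (simp add: arrow_elt_def ideals_set_def)
qed

definition N :: "('v \<times> 'e list) set" where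
  "N = {r \<in> paths Q. path_elt r \<notin> I}"

lemma N_subpaths:
  assumes "(u, p @ q) \<in> N" shows "(u, p) \<in> N" "(target Q u p, q) \<in> N"
proof -
  have P: "(u, p @ q) \<in> paths Q" and nI: "path_elt (u, p @ q) \<notin> I" using assms by (auto simp: N_def)
  note pq = paths_prefix[OF P] paths_suffix[OF P]
  show "(u, p) \<in> N" using path_elt_factor_in_I[of u "[]" p q] pq P nI by (auto simp: N_def)
  show "(target Q u p, q) \<in> N" using path_elt_factor_in_I[of u p q "[]"] pq P nI by (auto simp: N_def)
qed

lemma finite_N: "finite N"
proof -
  obtain m where m: "arrow_ideal Q [^]\<^bsub>ideals_set R\<^esub> (m::nat) \<subseteq> I"
    using admissible by (auto simp: admissible_ideal_def)
  have "N \<subseteq> verts Q \<times> {p. set p \<subseteq> arcs Q \<and> length p \<le> m}"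
  proof
    fix r assume r: "r \<in> N"
    obtain u p where up: "r = (u, p)" by fastforce
    with r have P: "(u, p) \<in> paths Q" by (simp add: N_def)
    have "length p \<le> m"
    proof (rule ccontr)
      assume "\<not> length p \<le> m"
      \<comment> \<open>The prefix of length exactly \<open>m\<close> lies in the power of the arrow
        ideal that is contained in \<open>I\<close>.\<close>
      moreover have n: "(u, take m p) \<in> N" using N_subpaths(1)[of u "take m p" "drop m p"] r up by simp
      ultimately have "path_elt (u, take m p) \<in> arrow_ideal Q [^]\<^bsub>ideals_set R\<^esub> m"
        using path_elt_power[of u "take m p"] by (auto simp: N_def min_def)
      with m n show False by (auto simp: N_def)
    qed
    then show "r \<in> verts Q \<times> {p. set p \<subseteq> arcs Q \<and> length p \<le> m}"
      using P by (auto simp: up paths_iff awalk_def)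
  qed
  then show ?thesis using finite_verts finite_lists_length_le[OF finite_arcs] by (meson finite_SigmaI finite_subset)
qed

lemma nonzero_paths_N: "nonzero_paths Q N"
proof
  show "(u, []) \<in> N" if "u \<in> verts Q" for u
    using that short_path_not_in_I by (auto simp: N_def paths_iff awalk_Nil_iff)
  show "(tail Q a, [a]) \<in> N" if "a \<in> arcs Q" for a
    using that short_path_not_in_I paths_arrow by (auto simp: N_def)
  show "N \<subseteq> paths Q" by (auto simp: N_def)
qed (fact finite_N N_subpaths)+

section \<open>The quotient algebra in coordinates\<close>

abbreviation A :: "('k, ('v \<times> 'e list \<Rightarrow> 'k) set) module" where "A \<equiv> bound_quiver_algebra Q I"

text \<open>Representatives of a coset differ by elements of \<open>I\<close>, which vanish on
  \<open>N\<close>, so the choice made by \<open>SOME\<close> does not affect the value.\<close>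

definition cf :: "('v \<times> 'e list \<Rightarrow> 'k) set \<Rightarrow> 'v \<times> 'e list \<Rightarrow> 'k" where
  "cf X r = (if r \<in> N then (SOME x. x \<in> X) r else 0)"

lemma A_carrier: "X \<in> carrier A \<Longrightarrow> \<exists>x\<in>carrier R. X = I +>\<^bsub>R\<^esub> x"
  by (auto simp: bound_quiver_algebra_def FactRing_simps)

lemma A_closed: "x \<in> carrier R \<Longrightarrow> I +>\<^bsub>R\<^esub> x \<in> carrier A"
  by (auto simp: bound_quiver_algebra_def FactRing_simps)

lemma A_ops:
  assumes "x \<in> carrier R" "y \<in> carrier R"
  shows "(I +>\<^bsub>R\<^esub> x) \<oplus>\<^bsub>A\<^esub> (I +>\<^bsub>R\<^esub> y) = I +>\<^bsub>R\<^esub> (x \<oplus>\<^bsub>R\<^esub> y)"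
    and "(I +>\<^bsub>R\<^esub> x) \<otimes>\<^bsub>A\<^esub> (I +>\<^bsub>R\<^esub> y) = I +>\<^bsub>R\<^esub> (x \<otimes>\<^bsub>R\<^esub> y)"
    and "\<one>\<^bsub>A\<^esub> = I +>\<^bsub>R\<^esub> \<one>\<^bsub>R\<^esub>"
  using assms by (auto simp: bound_quiver_algebra_def FactRing_def Id.a_rcos_sum Id.rcoset_mult_add)

lemma coset_member:
  assumes "x \<in> carrier R" "y \<in> I +>\<^bsub>R\<^esub> x"
  obtains i where "i \<in> I" "y = i \<oplus>\<^bsub>R\<^esub> x"
  using assms by (auto simp: a_r_coset_def')

lemma coset_eqI:
  assumes "x \<in> carrier R" "i \<in> I" shows "I +>\<^bsub>R\<^esub> (i \<oplus>\<^bsub>R\<^esub> x) = I +>\<^bsub>R\<^esub> x"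
proof -
  have "i \<oplus>\<^bsub>R\<^esub> x \<in> I +>\<^bsub>R\<^esub> x" using assms by (auto simp: a_r_coset_def')
  from Id.a_repr_independence'[OF this assms(1)] show ?thesis by simp
qed

text \<open>The action is defined by a union over representatives; all of them contribute the same
  coset because \<open>I\<close> is closed under scalars.\<close>

lemma A_smult:
  assumes x: "x \<in> carrier R" shows "c \<odot>\<^bsub>A\<^esub> (I +>\<^bsub>R\<^esub> x) = I +>\<^bsub>R\<^esub> (c \<odot>\<^bsub>R\<^esub> x)"
proof -
  have "I +>\<^bsub>R\<^esub> (c \<odot>\<^bsub>R\<^esub> y) = I +>\<^bsub>R\<^esub> (c \<odot>\<^bsub>R\<^esub> x)" if "y \<in> I +>\<^bsub>R\<^esub> x" for y
  proof -
    obtain i where i: "i \<in> I" "y = i \<oplus>\<^bsub>R\<^esub> x" using coset_member[OF x \<open>y \<in> I +>\<^bsub>R\<^esub> x\<close>] .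
    have "c \<odot>\<^bsub>R\<^esub> y = c \<odot>\<^bsub>R\<^esub> i \<oplus>\<^bsub>R\<^esub> c \<odot>\<^bsub>R\<^esub> x"
      by (auto simp: fun_eq_iff i R_add R_smult algebra_simps)
    then show ?thesis using coset_eqI[OF R_smult_closed[OF x] I_smult[OF i(1)]] by simp
  qed
  moreover have "x \<in> I +>\<^bsub>R\<^esub> x" using Id.a_rcos_self x by blast
  ultimately have "(\<Union>y\<in>I +>\<^bsub>R\<^esub> x. I +>\<^bsub>R\<^esub> (c \<odot>\<^bsub>R\<^esub> y)) = I +>\<^bsub>R\<^esub> (c \<odot>\<^bsub>R\<^esub> x)" by blast
  then show ?thesis by (simp add: bound_quiver_algebra_def)
qed

lemma I_vanishes_on_N: "i \<in> I \<Longrightarrow> r \<in> N \<Longrightarrow> i r = 0"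
  using coefficient_in_I[of i r] by (auto simp: N_def)

lemma cf_coset:
  assumes x: "x \<in> carrier R" shows "cf (I +>\<^bsub>R\<^esub> x) r = (if r \<in> N then x r else 0)"
proof -
  have "(SOME y. y \<in> I +>\<^bsub>R\<^esub> x) \<in> I +>\<^bsub>R\<^esub> x" using Id.a_rcos_self[OF x] some_in_eq by blast
  then obtain i where "i \<in> I" "(SOME y. y \<in> I +>\<^bsub>R\<^esub> x) = i \<oplus>\<^bsub>R\<^esub> x" by (rule coset_member[OF x])
  then show ?thesis using I_vanishes_on_N by (auto simp: cf_def R_add)
qed

text \<open>The difference is supported on paths outside \<open>N\<close>; these belong to
  \<open>I\<close>, and so does their combination.\<close>

lemma coset_eq_if_N:
  assumes x: "x \<in> carrier R" and y: "y \<in> carrier R" and eq: "\<And>r. r \<in> N \<Longrightarrow> x r = y r"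
  shows "I +>\<^bsub>R\<^esub> x = I +>\<^bsub>R\<^esub> y"
proof -
  let ?i = "x \<oplus>\<^bsub>R\<^esub> (\<ominus>\<^bsub>R\<^esub> y)"
  have ic: "?i \<in> carrier R" using x y by simp
  have val: "?i r = x r - y r" for r by (simp add: R_add R_uminus[OF y])
  have "?i \<in> I"
  proof (rule coefficients_imp_in_I[OF ic])
    fix r assume "?i r \<noteq> 0"
    then show "path_elt r \<in> I" using R_support[OF ic, of r] eq[of r] val by (auto simp: N_def)
  qed
  moreover have "?i \<oplus>\<^bsub>R\<^esub> y = x" using x y by (simp add: R.a_assoc R.l_neg)
  ultimately show ?thesis using coset_eqI[OF y, of ?i] by simp
qed

lemma path_basis_algebra_A: "path_basis_algebra Q N A cf"
proof (intro path_basis_algebra.intro nonzero_paths_N path_basis_algebra_axioms.intro)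
  show "ring A" by (rule ring_bound_quiver_algebra[OF Id.ideal_axioms])
  show "cf X r = 0" if "r \<notin> N" for X r using that by (simp add: cf_def)
  show "X = Y" if XY: "X \<in> carrier A" "Y \<in> carrier A" and eq: "cf X = cf Y" for X Y
  proof -
    obtain x y where x: "x \<in> carrier R" "X = I +>\<^bsub>R\<^esub> x" and y: "y \<in> carrier R" "Y = I +>\<^bsub>R\<^esub> y"
      using A_carrier[OF XY(1)] A_carrier[OF XY(2)] by (elim bexE)
    have "x r = y r" if "r \<in> N" for r using fun_cong[OF eq, of r] that x y by (simp add: cf_coset)
    then show ?thesis using coset_eq_if_N[OF x(1) y(1)] x(2) y(2) by simp
  qed
  show "\<exists>X\<in>carrier A. cf X = f" if f: "\<And>r. r \<notin> N \<Longrightarrow> f r = 0" for f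
  proof
    have "{q. f q \<noteq> 0} \<subseteq> N" using f by blast
    then have fR: "f \<in> carrier R" using finite_N by (auto simp: R_carrier N_def intro: finite_subset)
    then show "I +>\<^bsub>R\<^esub> f \<in> carrier A" by (rule A_closed)
    show "cf (I +>\<^bsub>R\<^esub> f) = f" using f by (auto simp: cf_coset[OF fR])
  qed
  fix X Y assume XY: "X \<in> carrier A" "Y \<in> carrier A"
  obtain x y where x: "x \<in> carrier R" "X = I +>\<^bsub>R\<^esub> x" and y: "y \<in> carrier R" "Y = I +>\<^bsub>R\<^esub> y"
    using A_carrier[OF XY(1)] A_carrier[OF XY(2)] by (elim bexE)
  show "cf (X \<oplus>\<^bsub>A\<^esub> Y) r = cf X r + cf Y r" for r
    using x y by (simp add: A_ops cf_coset R_add)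
  show "cf (X \<otimes>\<^bsub>A\<^esub> Y) (u, p) = (\<Sum>i\<le>length p. cf X (u, take i p) * cf Y (target Q u (take i p), drop i p))"
    if "(u, p) \<in> N" for u p
  proof -
    have "(u, take i p) \<in> N" "(target Q u (take i p), drop i p) \<in> N" for i
      using N_subpaths[of u "take i p" "drop i p"] that by auto
    then show ?thesis using x y that by (simp add: A_ops cf_coset R_mult)
  qed
next
  have N1: "(u, []) \<in> N" if "u \<in> verts Q" for u
    using nonzero_paths.trivial_in_N[OF nonzero_paths_N that] .
  show "cf \<one>\<^bsub>A\<^esub> (u, p) = (if u \<in> verts Q \<and> p = [] then 1 else 0)" for u p
    using N1 by (auto simp: A_ops(3)[OF R.one_closed R.one_closed] cf_coset R_one)
  show "c \<odot>\<^bsub>A\<^esub> \<one>\<^bsub>A\<^esub> \<in> carrier A" for c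
    by (simp add: A_ops(3)[OF R.one_closed R.one_closed] A_smult A_closed R_smult_closed)
  show "cf (c \<odot>\<^bsub>A\<^esub> \<one>\<^bsub>A\<^esub>) r = c * cf \<one>\<^bsub>A\<^esub> r" for c r
    by (simp add: A_ops(3)[OF R.one_closed R.one_closed] A_smult cf_coset R_smult_closed R_smult)
qed

lemma string_algebraI:
  assumes "gorenstein_paths Q N" shows "string_algebra Q I"
proof -
  interpret gorenstein_paths Q N by fact
  have prod: "arrow_elt Q a \<otimes>\<^bsub>R\<^esub> arrow_elt Q b \<in> I"
    if "a \<in> arcs Q" "b \<in> arcs Q" "head Q a = tail Q b" "(tail Q a, [a, b]) \<notin> N" for a b
  proof -
    have "(tail Q a, [a] @ [b]) \<in> paths Q" using that paths_arrow by (intro paths_appendI) auto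
    then show ?thesis using that by (simp add: arrow_elt_mult N_def)
  qed
  have card: "1 \<le> card ({x, y} \<inter> I)" if "x \<in> I \<or> y \<in> I" for x y
  proof -
    have "0 < card ({x, y} \<inter> I)" using that by (subst card_gt_0_iff) auto
    then show ?thesis by simp
  qed
  show ?thesis unfolding string_algebra_def
  proof (intro conjI ballI impI)
    show "monomial_algebra Q I"
      unfolding monomial_algebra_def using fin_digraph_axioms admissible generated S_paths by blast
    show "biserial_quiver Q" by (rule biserial)
    show "1 \<le> card ({arrow_elt Q a1 \<otimes>\<^bsub>R\<^esub> arrow_elt Q b, arrow_elt Q a2 \<otimes>\<^bsub>R\<^esub> arrow_elt Q b} \<inter> I)"
      if "a1 \<in> arcs Q" "a2 \<in> arcs Q" "b \<in> arcs Q" "a1 \<noteq> a2 \<and> head Q a1 = head Q a2 \<and> head Q a2 = tail Q b"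
      for a1 a2 b
      using that string_in[of a1 a2 b] prod by (intro card) auto
    show "1 \<le> card ({arrow_elt Q a \<otimes>\<^bsub>R\<^esub> arrow_elt Q b1, arrow_elt Q a \<otimes>\<^bsub>R\<^esub> arrow_elt Q b2} \<inter> I)"
      if "a \<in> arcs Q" "b1 \<in> arcs Q" "b2 \<in> arcs Q" "b1 \<noteq> b2 \<and> head Q a = tail Q b1 \<and> tail Q b1 = tail Q b2"
      for a b1 b2
      using that string_out[of b1 b2 a] prod by (intro card) auto
  qed
qed

end

section \<open>From projective dimensions to truncated resolutions\<close>

lemma right_module_hom_injI:
  assumes f: "f \<in> right_module_hom A M N" and M: "abelian_group M" and N: "abelian_group N"
    and ker: "a_kernel M N f = {\<zero>\<^bsub>M\<^esub>}"
  shows "inj_on f (carrier M)"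
proof (rule inj_onI)
  interpret M: abelian_group M by fact
  interpret N: abelian_group N by fact
  fix x y assume xy: "x \<in> carrier M" "y \<in> carrier M" "f x = f y"
  then have "f (x \<ominus>\<^bsub>M\<^esub> y) = \<zero>\<^bsub>N\<^esub>"
    using right_module_hom_minus[OF f M N] right_module_homD(1)[OF f] by (simp add: N.minus_eq N.r_neg)
  then have "x \<ominus>\<^bsub>M\<^esub> y = \<zero>\<^bsub>M\<^esub>" using ker xy by (auto simp: a_kernel_def')
  moreover have "x = (x \<ominus>\<^bsub>M\<^esub> y) \<oplus>\<^bsub>M\<^esub> y" using xy by (simp add: M.minus_eq M.a_assoc M.l_neg)
  ultimately show "x = y" using xy by simp
qed

lemma projective_module_iso:
  fixes A :: "('k::field, 'a) module" and P M :: "('k, 'a) std_module"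
  assumes P: "projective_module A P" and M: "fd_right_module A M"
    and f: "f \<in> right_module_hom A P M" "inj_on f (carrier P)" "f ` carrier P = carrier M"
  shows "projective_module A M"
  unfolding projective_module_def
proof (intro conjI M allI impI)
  fix X Y :: "('k, 'a) std_module" and g h
  assume *: "fd_right_module A X \<and> fd_right_module A Y \<and> g \<in> right_module_hom A X Y \<and>
    g ` carrier X = carrier Y \<and> h \<in> right_module_hom A M Y"
  let ?i = "inv_into (carrier P) f"
  interpret P: right_module A P using P by (simp add: projective_module_def fd_right_module_def)
  note fD = right_module_homD[OF f(1)]
  have i: "?i x \<in> carrier P" "f (?i x) = x" if "x \<in> carrier M" for x
    using that f(3) inv_into_into[of x f "carrier P"] f_inv_into_f[of x f "carrier P"] by auto
  have ihom: "?i \<in> right_module_hom A M P"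
  proof (rule right_module_homI)
    show "?i x \<in> carrier P" if "x \<in> carrier M" for x using i that by blast
    show "?i (x \<oplus>\<^bsub>M\<^esub> y) = ?i x \<oplus>\<^bsub>P\<^esub> ?i y" if "x \<in> carrier M" "y \<in> carrier M" for x y
      using i that fD(2)[of "?i x" "?i y"] inv_into_f_f[OF f(2), of "?i x \<oplus>\<^bsub>P\<^esub> ?i y"] by simp
    show "?i (a \<odot>\<^bsub>M\<^esub> x) = a \<odot>\<^bsub>P\<^esub> ?i x" if "a \<in> carrier A" "x \<in> carrier M" for a x
      using i that fD(3)[of a "?i x"] inv_into_f_f[OF f(2), of "a \<odot>\<^bsub>P\<^esub> ?i x"] P.smult_closed by simp
  qed
  have "(\<lambda>x. h (f x)) \<in> right_module_hom A P Y" using right_module_hom_compose[OF f(1)] * by blast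
  then obtain h' where h': "h' \<in> right_module_hom A P X" "\<And>x. x \<in> carrier P \<Longrightarrow> g (h' x) = h (f x)"
    using P * unfolding projective_module_def by metis
  show "\<exists>h'\<in>right_module_hom A M X. \<forall>x\<in>carrier M. g (h' x) = h x"
    using right_module_hom_compose[OF ihom h'(1)] h'(2) i by (intro bexI[of _ "\<lambda>x. h' (?i x)"]) auto
qed

text \<open>A finite bound makes the set of lengths nonempty, so its infimum is attained. A
  resolution of that length, which is at most \<open>n\<close>, vanishes beyond
  \<open>n\<close>.\<close>

lemma pdim_leE:
  fixes A :: "('k::field, 'a) module" and M :: "('a, 'm) module"
  assumes "pdim A M \<le> enat n"
  obtains P d \<epsilon> where "projective_resolution A M P d \<epsilon>" "\<And>i. i > n \<Longrightarrow> zero_module (P i)"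
proof -
  define S where "S = {enat n | n. \<exists>P d \<epsilon>. projective_resolution A M P d \<epsilon> \<and> (\<forall>i>n. zero_module (P i))}"
  have pdim: "pdim A M = Inf S" by (simp add: pdim_def S_def)
  have ne: "S \<noteq> {}"
  proof
    assume "S = {}"
    then have "Inf S = \<infinity>" by (simp add: Inf_enat_def)
    with assms show False by (simp add: pdim)
  qed
  then obtain s where "s \<in> S" by blast
  then have "Inf S \<in> S" using ne LeastI[of "\<lambda>x. x \<in> S" s] by (simp add: Inf_enat_def)
  then obtain m P d \<epsilon> where "pdim A M = enat m" "projective_resolution A M P d \<epsilon>" "\<forall>i>m. zero_module (P i)"
    unfolding pdim by (auto simp: S_def)
  with assms show ?thesis using that by simp
qed

lemma (in monomial_ideal) two_Gorenstein_imp_string: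
  assumes "n_Gorenstein 2 A" shows "string_algebra Q I"
proof -
  interpret path_basis_algebra Q N A cf by (rule path_basis_algebra_A)
  obtain E d \<eta> where res: "injective_resolution A (regular_module A) E d \<eta>"
    and pd: "\<And>i. i < 2 \<Longrightarrow> pdim A (E i) \<le> enat i"
    using assms by (auto simp: n_Gorenstein_def minimal_injective_resolution_def)
  have E: "injective_module A (E i)" for i using res by (simp add: injective_resolution_def)
  have group: "abelian_group M" if "fd_right_module A M" for M :: "(('v \<times> 'e list \<Rightarrow> 'k) set, nat \<Rightarrow> 'k) module"
    using that right_module_abelian_group by (auto simp: fd_right_module_def)
  have fdE: "fd_right_module A (E i)" for i using E by (simp add: injective_module_def)
  have "pdim A (E 0) \<le> enat 0" "pdim A (E 1) \<le> enat 1" using pd[of 0] pd[of 1] by auto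
  then obtain P' d' \<epsilon>' P d'' \<epsilon> where
    r0: "projective_resolution A (E 0) P' d' \<epsilon>'" "\<And>i. i > 0 \<Longrightarrow> zero_module (P' i)" and
    r1: "projective_resolution A (E 1) P d'' \<epsilon>" "\<And>i. i > 1 \<Longrightarrow> zero_module (P i)"
    by (metis pdim_leE)
  \<comment> \<open>A zero module in front of an exact spot makes the kernel there trivial: at
    \<open>P' 0\<close> the augmentation becomes an isomorphism, at \<open>P 1\<close> the
    differential becomes injective.\<close>
  have ker: "a_kernel M M' g = {\<zero>\<^bsub>M\<^esub>}"
    if "zero_module L" "f \<in> right_module_hom A L M" "f ` carrier L = a_kernel M M' g"
      "abelian_group L" "abelian_group M"
    for L M M' :: "('k, ('v \<times> 'e list \<Rightarrow> 'k) set) std_module" and f g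
    using that right_module_hom_zero[OF that(2,4,5)] by (auto simp: zero_module_def)
  have P': "projective_module A (P' i)" "fd_right_module A (P' i)"
    and P: "projective_module A (P i)" "fd_right_module A (P i)" for i
    using r0(1) r1(1) by (auto simp: projective_resolution_def projective_module_def)
  have E0: "projective_module A (E 0)"
  proof (rule projective_module_iso[OF P'(1) fdE])
    show \<epsilon>': "\<epsilon>' \<in> right_module_hom A (P' 0) (E 0)" "\<epsilon>' ` carrier (P' 0) = carrier (E 0)"
      using r0(1) by (auto simp: projective_resolution_def)
    have "a_kernel (P' 0) (E 0) \<epsilon>' = {\<zero>\<^bsub>P' 0\<^esub>}"
      by (rule ker[of "P' (Suc 0)" "d' 0"])
        (use r0 P' group in \<open>auto simp: projective_resolution_def\<close>)
    then show "inj_on \<epsilon>' (carrier (P' 0))"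
      using right_module_hom_injI[OF \<epsilon>'(1)] group P' fdE by blast
  qed
  have \<delta>: "inj_on (d'' 0) (carrier (P 1))"
  proof (rule right_module_hom_injI)
    show "d'' 0 \<in> right_module_hom A (P 1) (P 0)" using r1(1) by (simp add: projective_resolution_def)
    show "a_kernel (P 1) (P 0) (d'' 0) = {\<zero>\<^bsub>P 1\<^esub>}"
      by (rule ker[of "P 2" "d'' 1"])
        (use r1 P group in \<open>auto simp: projective_resolution_def numeral_2_eq_2\<close>)
  qed (use group P in auto)
  interpret G: gorenstein_resolution Q N A cf "E 0" "E 1" "P 0" "P 1" \<eta> "d 0" "d'' 0" \<epsilon>
    using E E0 P \<delta> res r1(1)
    by unfold_locales (auto simp: injective_resolution_def projective_resolution_def)
  show ?thesis by (rule string_algebraI[OF G.gorenstein_paths_axioms])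
qed

theorem corollary4p2:
  fixes Q :: "('v, 'e) pre_digraph"
    and I :: "('v \<times> 'e list \<Rightarrow> 'k::field) set"
  assumes "fin_digraph Q"
    and "admissible_ideal Q I"
    and "finite_dimensional (bound_quiver_algebra Q I)
           (regular_module (bound_quiver_algebra Q I))"
    and "monomial_algebra Q I"
  shows "(n_Gorenstein 2 (bound_quiver_algebra Q I) \<longrightarrow> string_algebra Q I) \<and>
         (Auslander_Gorenstein (bound_quiver_algebra Q I) \<longrightarrow> string_algebra Q I)"
proof -
  obtain S where S: "S \<subseteq> paths Q" "I = Idl\<^bsub>path_algebra Q\<^esub> (path_elt ` S)"
    using assms(4) by (auto simp: monomial_algebra_def)
  interpret monomial_ideal Q I S
    by (intro monomial_ideal.intro monomial_ideal_axioms.intro assms(1,2) S)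
  have "n_Gorenstein 2 (bound_quiver_algebra Q I) \<longrightarrow> string_algebra Q I"
    using two_Gorenstein_imp_string by blast
  then show ?thesis by (auto simp: Auslander_Gorenstein_def)
qed

end
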